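(* Let $G$ be a locally compact group, and let $E$ be any one of the Banach spaces $$L^{\infty}(G),\quad \mathcal{C}^b(G),\quad \mathcal{C}^b_{lu}(G),\quad \mathcal{C}^b_{ru}(G),\quad \mathcal{C}^b_u(G).$$ Then $G$ has the translate property for $E$ if and only if $G$ has the invariant normalized integral property for $E$.
   Context: Locally compact groups are Hausdorff; $G$ carries a fixed left Haar measure $m_G$. $L^\infty(G)$ is the space of bounded Borel measurable real functions on $G$ modulo null sets (essential supremum norm, almost-everywhere order). $\mathcal{C}^b(G)$ is the space of bounded continuous real functions on $G$ (supremum norm, pointwise order). $\mathcal{C}^b_{ru}(G)$ is the set of $f\in\mathcal{C}^b(G)$ for which $g\mapsto f(g^{-1}\,\cdot\,)$ is sup-norm continuous, $\mathcal{C}^b_{lu}(G)$ is the set of $f\in\mathcal{C}^b(G)$ for which $g\mapsto f(\,\cdot\,g)$ is sup-norm continuous, and $\mathcal{C}^b_u(G)=\mathcal{C}^b_{ru}(G)\cap\mathcal{C}^b_{lu}(G)$. On each of these spaces $G$ acts by left translation, $(gf)(x)=f(g^{-1}x)$. $G$ has the translate property for $E$ if for every non-zero $f\ge 0$ in $E$, all $t_1,\dots,t_n\in\mathbf{R}$ and all $g_1,\dots,g_n\in G$: $\sum_{j=1}^n t_jg_jf\ge 0$ implies $\sum_{j=1}^n t_j\ge 0$. For a non-zero $f\in E$ with $f\ge 0$, let $(E,f)$ be the set of all $h\in E$ such that $|h|\le\sum_{j=1}^n g_jf$ for some $g_1,\dots,g_n\in G$; it is a $G$-invariant linear subspace. An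 invariant normalized integral on $(E,f)$ is a positive, $G$-invariant linear functional $\mathrm{I}$ on $(E,f)$ with $\mathrm{I}(f)=1$. $G$ has the invariant normalized integral property for $E$ if $(E,f)$ admits an invariant normalized integral for every non-zero $f\ge 0$ in $E$. *)

theory Defs
  imports "HOL-Analysis.Analysis"
begin

text \<open>
  Groups are written additively: the class \<open>topological_group_add\<close> does not assume
  commutativity, so \<open>g + x\<close> is the product \<open>gx\<close> and \<open>- g\<close> is the inverse of \<open>g\<close>.
\<close>

definition left_haar_measure :: "'a::topological_group_add measure \<Rightarrow> bool" where
  "left_haar_measure m \<longleftrightarrow>
     sets m = sets borel \<and>
     emeasure m UNIV \<noteq> 0 \<and>
     (\<forall>g. \<forall>A\<in>sets borel. emeasure m ((\<lambda>x. g + x) ` A) = emeasure m A) \<and>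
     (\<forall>K. compact K \<longrightarrow> emeasure m K < \<infinity>) \<and>
     (\<forall>A\<in>sets borel. emeasure m A = (INF U\<in>{U. open U \<and> A \<subseteq> U}. emeasure m U)) \<and>
     (\<forall>U. open U \<longrightarrow> emeasure m U = (SUP K\<in>{K. compact K \<and> K \<subseteq> U}. emeasure m K))"

definition ltrans :: "'a::group_add \<Rightarrow> ('a \<Rightarrow> real) \<Rightarrow> 'a \<Rightarrow> real" where
  "ltrans g f = (\<lambda>x. f (- g + x))"

definition rtrans :: "'a::group_add \<Rightarrow> ('a \<Rightarrow> real) \<Rightarrow> 'a \<Rightarrow> real" where
  "rtrans g f = (\<lambda>x. f (x + g))"

text \<open>
  A function space is given by a set \<open>E\<close> of functions together with a filter \<open>F\<close> on \<open>G\<close>: two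
  members are identified when they agree \<open>F\<close>-eventually, and ordered by the \<open>F\<close>-eventual
  inequality. With \<open>F = ae_filter m\<close> these are equality and order almost everywhere, so
  elements of \<open>L\<^sup>\<infinity>\<close> are handled through representatives; with \<open>F = top\<close> they are plain
  equality and the pointwise order.
\<close>

definition L_infty :: "('a::topological_space \<Rightarrow> real) set" where
  "L_infty = {f \<in> borel_measurable borel. bounded (range f)}"

text \<open>\<open>Bcontfun\<close> maps into the type of bounded continuous functions with the supremum metric.\<close>

definition C_b :: "('a::topological_group_add \<Rightarrow> real) set" where
  "C_b = bcontfun"

definition C_b_ru :: "('a::topological_group_add \<Rightarrow> real) set" where
  "C_b_ru = {f \<in> C_b. continuous_on UNIV (\<lambda>g. Bcontfun (ltrans g f))}"

definition C_b_lu :: "('a::topological_group_add \<Rightarrow> real) set" where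
  "C_b_lu = {f \<in> C_b. continuous_on UNIV (\<lambda>g. Bcontfun (rtrans g f))}"

definition C_b_u :: "('a::topological_group_add \<Rightarrow> real) set" where
  "C_b_u = C_b_ru \<inter> C_b_lu"

definition nonneg_in :: "'a filter \<Rightarrow> ('a \<Rightarrow> real) \<Rightarrow> bool" where
  "nonneg_in F f \<longleftrightarrow> (\<forall>\<^sub>F x in F. 0 \<le> f x)"

definition eq_in :: "'a filter \<Rightarrow> ('a \<Rightarrow> real) \<Rightarrow> ('a \<Rightarrow> real) \<Rightarrow> bool" where
  "eq_in F f h \<longleftrightarrow> (\<forall>\<^sub>F x in F. f x = h x)"

definition nonzero_nonneg :: "'a filter \<Rightarrow> ('a \<Rightarrow> real) set \<Rightarrow> ('a \<Rightarrow> real) set" where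
  "nonzero_nonneg F E = {f \<in> E. nonneg_in F f \<and> \<not> eq_in F f (\<lambda>x. 0)}"

definition translate_property :: "'a::group_add filter \<Rightarrow> ('a \<Rightarrow> real) set \<Rightarrow> bool" where
  "translate_property F E \<longleftrightarrow>
     (\<forall>f\<in>nonzero_nonneg F E. \<forall>(n::nat) (t::nat \<Rightarrow> real) (g::nat \<Rightarrow> 'a).
        nonneg_in F (\<lambda>x. \<Sum>j=1..n. t j * ltrans (g j) f x) \<longrightarrow> 0 \<le> (\<Sum>j=1..n. t j))"

definition dominated :: "'a::group_add filter \<Rightarrow> ('a \<Rightarrow> real) set \<Rightarrow> ('a \<Rightarrow> real) \<Rightarrow> ('a \<Rightarrow> real) set" where
  "dominated F E f =
     {h \<in> E. \<exists>(n::nat) (g::nat \<Rightarrow> 'a). \<forall>\<^sub>F x in F. \<bar>h x\<bar> \<le> (\<Sum>j=1..n. ltrans (g j) f x)}"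

text \<open>The first clause makes \<open>I\<close> a function of the class of \<open>h\<close>; it is vacuous for \<open>F = top\<close>.\<close>

definition invariant_normalized_integral ::
  "'a::group_add filter \<Rightarrow> ('a \<Rightarrow> real) set \<Rightarrow> ('a \<Rightarrow> real) \<Rightarrow> (('a \<Rightarrow> real) \<Rightarrow> real) \<Rightarrow> bool" where
  "invariant_normalized_integral F E f I \<longleftrightarrow>
     (\<forall>h\<in>dominated F E f. \<forall>k\<in>dominated F E f. eq_in F h k \<longrightarrow> I h = I k) \<and>
     (\<forall>h\<in>dominated F E f. \<forall>k\<in>dominated F E f. I (\<lambda>x. h x + k x) = I h + I k) \<and>
     (\<forall>c. \<forall>h\<in>dominated F E f. I (\<lambda>x. c * h x) = c * I h) \<and>
     (\<forall>h\<in>dominated F E f. nonneg_in F h \<longrightarrow> 0 \<le> I h) \<and>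
     (\<forall>g. \<forall>h\<in>dominated F E f. I (ltrans g h) = I h) \<and>
     I f = 1"

definition invariant_normalized_integral_property ::
  "'a::group_add filter \<Rightarrow> ('a \<Rightarrow> real) set \<Rightarrow> bool" where
  "invariant_normalized_integral_property F E \<longleftrightarrow>
     (\<forall>f\<in>nonzero_nonneg F E. \<exists>I. invariant_normalized_integral F E f I)"

end

theory Submission
  imports Defs
begin

text \<open>
  Suppose that a positive functional \<open>J\<close> takes the value \<open>1\<close> at all translates of \<open>f\<close>; by
  Hahn-Banach such functionals exist under the translate property. Given \<open>w\<close>, a functional \<open>M\<close> of
  the same kind for \<open>b(s) = J(s\<^sup>-\<^sup>1w) + c \<ge> 1\<close> satisfies \<open>M(gb) = M(b)\<close>, so that averaging
  \<open>s \<mapsto> J(s\<^sup>-\<^sup>1v)\<close> against \<open>M\<close> makes \<open>J\<close> invariant at \<open>w\<close> and preserves any invariance obtained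
  before. Compactness yields a \<open>J\<close> which is invariant at all \<open>w\<close> for which these \<open>b\<close> are covered by
  the translate property. The property for uniformly continuous functions suffices for the \<open>w\<close> whose
  translates vary continuously in the norm defined by \<open>f\<close>.

  If \<open>f\<close> is not null on some compact set, let \<open>h \<mapsto> h'\<close> denote smoothing by integration over right
  translates, and let \<open>\<phi>\<close> be a non-negative bump function. Take \<open>J\<close> for \<open>f\<^sub>0 = \<phi> * f'\<close> and put
  \<open>I(h) = J(\<phi> * h')\<close>. Although \<open>\<phi> * (gh')\<close> is not a translate of \<open>\<phi> * h'\<close>, the functional
  \<open>\<psi> \<mapsto> J(\<psi> * h')\<close> on compactly supported continuous functions is left invariant, hence a multiple
  of the Haar integral, and the invariance of \<open>I\<close> follows. If \<open>f\<close> is null on every compact set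
  without being null, then \<open>G\<close> is not \<open>\<sigma>\<close>-compact, the translate property for \<open>L\<^sup>\<infinity>(G)\<close> covers
  all bounded functions \<open>b \<ge> 1\<close> on \<open>G\<close>, and no smoothing is needed.
\<close>

section \<open>A Hahn-Banach theorem for cones of functions\<close>

text \<open>With an invariant mean on G a single average would make every functional invariant, but
  the existence of such a mean is the case f = 1 of the claim. The translate property only gives a
  functional M adapted to one function b, so each w needs an average of its own. Since translation
  fixes constants, M(gb) = M(b) also holds for b - c. The bound b \<ge> 1 makes b dominate every
  bounded function, so that M applies to the orbit function of every v.

  The weakest of the five hypotheses is the property for \<open>C_b_u\<close>. It reaches b only if
  s \<mapsto> J(s^-1 w) is continuous under left perturbations, uniformly on G; as J is controlled
  by domination by translates of f, continuity of orbits is measured by that domination and not by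
  the supremum norm. Smoothing by right translates commutes with the action but gives continuity
  under right perturbations only. The continuity on the left has to come from convolution with
  \<phi>, which does not commute with the action, and the uniqueness of Haar measure repairs
  this.\<close>

definition function_space :: "('x \<Rightarrow> real) set \<Rightarrow> bool" where
  "function_space W \<longleftrightarrow> (\<forall>v\<in>W. \<forall>w\<in>W. (\<lambda>x. v x + w x) \<in> W) \<and> (\<forall>c. \<forall>w\<in>W. (\<lambda>x. c * w x) \<in> W)"

definition linear_functional :: "('x \<Rightarrow> real) set \<Rightarrow> (('x \<Rightarrow> real) \<Rightarrow> real) \<Rightarrow> bool" where
  "linear_functional W J \<longleftrightarrow>
     (\<forall>v\<in>W. \<forall>w\<in>W. J (\<lambda>x. v x + w x) = J v + J w) \<and> (\<forall>c. \<forall>w\<in>W. J (\<lambda>x. c * w x) = c * J w)"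

definition function_cone :: "('x \<Rightarrow> real) set \<Rightarrow> bool" where
  "function_cone P \<longleftrightarrow> (\<lambda>x. 0) \<in> P \<and>
     (\<forall>v\<in>P. \<forall>w\<in>P. (\<lambda>x. v x + w x) \<in> P) \<and> (\<forall>c\<ge>0. \<forall>w\<in>P. (\<lambda>x. c * w x) \<in> P)"

lemma function_cone_comb:
  assumes "function_cone P" "v \<in> P" "w \<in> P" "0 \<le> a" "0 \<le> b"
  shows "(\<lambda>x. a * v x + b * w x) \<in> P"
  using assms by (auto simp: function_cone_def)

lemma function_space_comb:
  assumes "function_space P" "v \<in> P" "w \<in> P"
  shows "(\<lambda>x. a * v x + b * w x) \<in> P"
  using assms by (auto simp: function_space_def)

lemma function_space_diff:
  assumes "function_space W" "v \<in> W" "w \<in> W"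
  shows "(\<lambda>x. v x - w x) \<in> W"
  using function_space_comb[OF assms, of 1 "-1"] by simp

lemma function_space_minus:
  assumes "function_space W" "v \<in> W"
  shows "(\<lambda>x. - v x) \<in> W"
  using function_space_comb[OF assms(1,2,2), of "-1" 0] by simp

lemma linear_functional_scale:
  "linear_functional W J \<Longrightarrow> w \<in> W \<Longrightarrow> J (\<lambda>x. c * w x) = c * J w"
  by (simp add: linear_functional_def)

lemma function_spaceI:
  assumes "\<And>v w a b. v \<in> W \<Longrightarrow> w \<in> W \<Longrightarrow> (\<lambda>x. a * v x + b * w x) \<in> W"
  shows "function_space W"
  unfolding function_space_def
proof (intro conjI ballI allI)
  fix v w assume "v \<in> W" "w \<in> W"
  from assms[OF this, of 1 1] show "(\<lambda>x. v x + w x) \<in> W" by simp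
next
  fix c w assume "w \<in> W"
  from assms[OF this this, of c 0] show "(\<lambda>x. c * w x) \<in> W" by simp
qed

lemma linear_functionalI:
  assumes "\<And>v w a b. v \<in> W \<Longrightarrow> w \<in> W \<Longrightarrow> J (\<lambda>x. a * v x + b * w x) = a * J v + b * J w"
  shows "linear_functional W J"
  unfolding linear_functional_def
proof (intro conjI ballI allI)
  fix v w assume "v \<in> W" "w \<in> W"
  from assms[OF this, of 1 1] show "J (\<lambda>x. v x + w x) = J v + J w" by simp
next
  fix c w assume "w \<in> W"
  from assms[OF this this, of c 0] show "J (\<lambda>x. c * w x) = c * J w" by simp
qed

lemma linear_functional_comb:
  assumes "linear_functional W J" "function_space W" "v \<in> W" "w \<in> W"
  shows "J (\<lambda>x. a * v x + b * w x) = a * J v + b * J w"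
  using assms by (simp add: linear_functional_def function_space_def)

lemma linear_functional_diff:
  assumes "linear_functional W J" "function_space W" "v \<in> W" "w \<in> W"
  shows "J (\<lambda>x. v x - w x) = J v - J w"
  using linear_functional_comb[OF assms, of 1 "-1"] by simp

lemma linear_functional_minus:
  assumes "linear_functional W J" "v \<in> W"
  shows "J (\<lambda>x. - v x) = - J v"
  using linear_functional_scale[OF assms, of "-1"] by simp

text \<open>Zorn's lemma is applied to the cones that omit -f. If a maximal M contained neither v
  nor -v, adjoining each of them would give -f = p + s v = q - t v with p, q in M. Averaging with
  weights proportional to t and s cancels v and puts -f into M.\<close>

lemma maximal_proper_cone:
  fixes f :: "'x \<Rightarrow> real"
  assumes W: "function_space W" and P: "function_cone P" "P \<subseteq> W" and f: "(\<lambda>x. - f x) \<notin> P"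
  obtains M where "function_cone M" "P \<subseteq> M" "M \<subseteq> W" "(\<lambda>x. - f x) \<notin> M"
    "\<And>v. v \<in> W \<Longrightarrow> v \<in> M \<or> (\<lambda>x. - v x) \<in> M"
proof -
  define A where "A = {Q. function_cone Q \<and> P \<subseteq> Q \<and> Q \<subseteq> W \<and> (\<lambda>x. - f x) \<notin> Q}"
  have "\<exists>M\<in>A. \<forall>X\<in>A. M \<subseteq> X \<longrightarrow> X = M"
  proof (rule subset_Zorn_nonempty)
    show "A \<noteq> {}" using assms by (auto simp: A_def)
    fix C assume C: "C \<noteq> {}" "subset.chain A C"
    have CA: "Q \<in> A" if "Q \<in> C" for Q using C that by (auto simp: subset.chain_def)
    have ch: "X \<subseteq> Y \<or> Y \<subseteq> X" if "X \<in> C" "Y \<in> C" for X Y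
      using C that by (auto simp: subset.chain_def)
    have "function_cone (\<Union>C)"
      unfolding function_cone_def
    proof (intro conjI ballI allI impI)
      show "(\<lambda>x. 0) \<in> \<Union>C" using C(1) CA by (auto simp: A_def function_cone_def)
    next
      fix v w assume "v \<in> \<Union>C" "w \<in> \<Union>C"
      then obtain X where "X \<in> C" "v \<in> X" "w \<in> X" using ch by blast
      then show "(\<lambda>x. v x + w x) \<in> \<Union>C" using CA[of X] by (auto simp: A_def function_cone_def)
    next
      fix c :: real and w assume "0 \<le> c" "w \<in> \<Union>C"
      then show "(\<lambda>x. c * w x) \<in> \<Union>C" using CA by (fastforce simp: A_def function_cone_def)
    qed
    then show "\<Union>C \<in> A" using CA C(1) by (fastforce simp: A_def)
  qed
  then obtain M where M: "M \<in> A" and max: "\<And>X. X \<in> A \<Longrightarrow> M \<subseteq> X \<Longrightarrow> X = M" by blast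
  have cM: "function_cone M" and PM: "P \<subseteq> M" and MW: "M \<subseteq> W" and fM: "(\<lambda>x. - f x) \<notin> M"
    using M by (auto simp: A_def)
  have ext: "\<exists>p\<in>M. \<exists>s>0. (\<lambda>x. - f x) = (\<lambda>x. p x + s * v x)" if v: "v \<in> W" "v \<notin> M" for v
  proof -
    define X where "X = {\<lambda>x. p x + s * v x | p s. p \<in> M \<and> 0 \<le> s}"
    have MX: "M \<subseteq> X"
    proof
      fix p assume "p \<in> M"
      then show "p \<in> X" unfolding X_def by (intro CollectI exI[of _ p] exI[of _ 0]) auto
    qed
    have "v \<in> X" unfolding X_def using cM
      by (intro CollectI exI[of _ "\<lambda>x. 0"] exI[of _ 1]) (auto simp: function_cone_def)
    moreover have "function_cone X"
      unfolding function_cone_def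
    proof (intro conjI ballI allI impI)
      show "(\<lambda>x. 0) \<in> X" using MX cM by (auto simp: function_cone_def)
    next
      fix a b assume "a \<in> X" "b \<in> X"
      then obtain p s q t where *: "a = (\<lambda>x. p x + s * v x)" "b = (\<lambda>x. q x + t * v x)"
          "p \<in> M" "q \<in> M" "0 \<le> s" "0 \<le> t" by (auto simp: X_def)
      have "(\<lambda>x. p x + q x) \<in> M" using cM * by (auto simp: function_cone_def)
      then show "(\<lambda>x. a x + b x) \<in> X" unfolding X_def using *
        by (intro CollectI exI[of _ "\<lambda>x. p x + q x"] exI[of _ "s + t"]) (auto simp: algebra_simps)
    next
      fix c :: real and a assume "0 \<le> c" "a \<in> X"
      then obtain p s where *: "a = (\<lambda>x. p x + s * v x)" "p \<in> M" "0 \<le> s" by (auto simp: X_def)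
      have "(\<lambda>x. c * p x) \<in> M" using cM * \<open>0 \<le> c\<close> by (auto simp: function_cone_def)
      then show "(\<lambda>x. c * a x) \<in> X" unfolding X_def using * \<open>0 \<le> c\<close>
        by (intro CollectI exI[of _ "\<lambda>x. c * p x"] exI[of _ "c * s"]) (auto simp: algebra_simps)
    qed
    moreover have "X \<subseteq> W"
      using function_space_comb[OF W _ v(1), where a=1] MW by (auto simp: X_def)
    ultimately have "(\<lambda>x. - f x) \<in> X"
      using max[of X] MX v PM by (auto simp: A_def)
    then obtain p s where *: "(\<lambda>x. - f x) = (\<lambda>x. p x + s * v x)" "p \<in> M" "0 \<le> s"
      by (auto simp: X_def)
    then have "s \<noteq> 0" using fM by (cases "s = 0") auto
    then show ?thesis using * by (intro bexI[of _ p] exI[of _ s]) auto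
  qed
  have "v \<in> M \<or> (\<lambda>x. - v x) \<in> M" if v: "v \<in> W" for v
  proof (rule ccontr)
    assume "\<not> ?thesis"
    then have n: "v \<notin> M" "(\<lambda>x. - v x) \<notin> M" by auto
    obtain p s where 1: "p \<in> M" "s > 0" "(\<lambda>x. - f x) = (\<lambda>x. p x + s * v x)"
      using ext[OF v n(1)] by blast
    obtain q t where 2: "q \<in> M" "t > 0" "(\<lambda>x. - f x) = (\<lambda>x. q x + t * - v x)"
      using ext[OF function_space_minus[OF W v] n(2)] by blast
    have e1: "- f x = p x + s * v x" and e2: "- f x = q x + t * - v x" for x
      using fun_cong[OF 1(3), of x] fun_cong[OF 2(3), of x] by simp_all
    have "- f x = t / (s + t) * p x + s / (s + t) * q x" for x
    proof -
      have "- f x * (s + t) = t * p x + s * q x"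
        using e1[of x] e2[of x] by algebra
      then have "- f x = (t * p x + s * q x) / (s + t)"
        using 1(2) 2(2) by (simp add: eq_divide_eq)
      then show ?thesis by (simp add: add_divide_distrib)
    qed
    moreover have "(\<lambda>x. t / (s + t) * p x + s / (s + t) * q x) \<in> M"
      using 1 2 by (intro function_cone_comb[OF cM]) auto
    ultimately show False using fM by simp
  qed
  then show ?thesis using that[of M] cM PM MW fM by blast
qed

text \<open>The maximal cone is the positive cone of a total preorder on \<open>W\<close>, in which
  \<open>unit\<close> makes f an order unit. The value of J at w is the cut that w makes among the
  multiples of f.\<close>

lemma cone_functional:
  fixes f :: "'x \<Rightarrow> real"
  assumes W: "function_space W" and P: "function_cone P" "P \<subseteq> W" and f: "(\<lambda>x. - f x) \<notin> P" "f \<in> W"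
    and unit: "\<And>v. v \<in> W \<Longrightarrow> \<exists>c. (\<lambda>x. c * f x - v x) \<in> P"
  obtains J where "linear_functional W J" "\<And>v. v \<in> P \<Longrightarrow> 0 \<le> J v" "J f = 1"
proof -
  obtain M where cM: "function_cone M" and PM: "P \<subseteq> M" and MW: "M \<subseteq> W" and fM: "(\<lambda>x. - f x) \<notin> M"
    and tot: "\<And>v. v \<in> W \<Longrightarrow> v \<in> M \<or> (\<lambda>x. - v x) \<in> M"
    using maximal_proper_cone[OF W P f(1)] by blast
  have fP: "f \<in> M" using tot[OF f(2)] fM by auto
  have nonneg: "0 \<le> c" if "(\<lambda>x. c * f x) \<in> M" for c
  proof (rule ccontr)
    assume "\<not> 0 \<le> c"
    then have "(\<lambda>x. (1 / - c) * (c * f x) + 0 * (c * f x)) \<in> M"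
      using that by (intro function_cone_comb[OF cM]) auto
    then show False using fM \<open>\<not> 0 \<le> c\<close> by simp
  qed
  \<comment> \<open>M need not be closed, and w may differ from its multiple of f by an
    infinitesimal; hence the slack e on both sides.\<close>
  define val where "val w t \<longleftrightarrow>
    (\<forall>e>0. (\<lambda>x. (t + e) * f x - w x) \<in> M \<and> (\<lambda>x. w x - (t - e) * f x) \<in> M)" for w t
  have ex: "\<exists>t. val w t" if w: "w \<in> W" for w
  proof -
    define S where "S = {t. (\<lambda>x. t * f x - w x) \<in> M}"
    have up: "t \<in> S" if "s \<in> S" "s \<le> t" for s t
    proof -
      have "(\<lambda>x. 1 * (s * f x - w x) + (t - s) * f x) \<in> M"
        using that fP by (intro function_cone_comb[OF cM]) (auto simp: S_def)
      then show ?thesis by (simp add: S_def algebra_simps)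
    qed
    obtain c where c: "c \<in> S" using unit[OF w] PM by (auto simp: S_def)
    obtain d where d: "(\<lambda>x. d * f x - - w x) \<in> M"
      using unit[OF function_space_minus[OF W w]] PM by auto
    have low: "- d \<le> s" if "s \<in> S" for s
    proof -
      have "(\<lambda>x. 1 * (d * f x - - w x) + 1 * (s * f x - w x)) \<in> M"
        using that d by (intro function_cone_comb[OF cM]) (auto simp: S_def)
      then have "0 \<le> d + s" by (intro nonneg) (simp add: algebra_simps)
      then show ?thesis by simp
    qed
    have bdd: "bdd_below S" using low by (auto simp: bdd_below_def)
    have "val w (Inf S)"
      unfolding val_def
    proof (intro allI impI conjI)
      fix e :: real assume e: "e > 0"
      then obtain s where "s \<in> S" "s < Inf S + e"
        using cInf_lessD[of S "Inf S + e"] c by auto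
      then have "Inf S + e \<in> S" using up by auto
      then show "(\<lambda>x. (Inf S + e) * f x - w x) \<in> M" by (simp add: S_def)
      have "Inf S - e \<notin> S" using cInf_lower[OF _ bdd, of "Inf S - e"] e by auto
      moreover have "(\<lambda>x. (Inf S - e) * f x - w x) \<in> W"
        using function_space_comb[OF W f(2) w, of "Inf S - e" "-1"] by simp
      ultimately show "(\<lambda>x. w x - (Inf S - e) * f x) \<in> M"
        using tot[of "\<lambda>x. (Inf S - e) * f x - w x"] by (auto simp: S_def)
    qed
    then show ?thesis by blast
  qed
  have le: "s \<le> t" if "val w s" "val w t" for w s t
  proof (rule field_le_epsilon)
    fix e :: real assume e: "0 < e"
    have "(\<lambda>x. 1 * ((t + e/2) * f x - w x) + 1 * (w x - (s - e/2) * f x)) \<in> M"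
      using that e by (intro function_cone_comb[OF cM]) (auto simp: val_def)
    then have "0 \<le> t + e/2 - (s - e/2)" by (intro nonneg) (simp add: algebra_simps)
    then show "s \<le> t + e" by simp
  qed
  define J where "J w = (THE t. val w t)" for w
  have Jeq: "J w = t" if "val w t" for w t
    unfolding J_def using that le by (intro the_equality) (auto intro: antisym)
  have valJ: "val w (J w)" if "w \<in> W" for w using ex[OF that] Jeq by auto
  have val_add: "val (\<lambda>x. v x + w x) (s + t)" if "val v s" "val w t" for v w s t
    unfolding val_def
  proof (intro allI impI conjI)
    fix e :: real assume e: "e > 0"
    have "(\<lambda>x. 1 * ((s + e/2) * f x - v x) + 1 * ((t + e/2) * f x - w x)) \<in> M"
      using that e by (intro function_cone_comb[OF cM]) (auto simp: val_def)
    then show "(\<lambda>x. (s + t + e) * f x - (v x + w x)) \<in> M" by (simp add: algebra_simps)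
    have "(\<lambda>x. 1 * (v x - (s - e/2) * f x) + 1 * (w x - (t - e/2) * f x)) \<in> M"
      using that e by (intro function_cone_comb[OF cM]) (auto simp: val_def)
    then show "(\<lambda>x. v x + w x - (s + t - e) * f x) \<in> M" by (simp add: algebra_simps)
  qed
  have val_scale_pos: "val (\<lambda>x. c * w x) (c * t)" if "val w t" "c > 0" for w c t
    unfolding val_def
  proof (intro allI impI conjI)
    fix e :: real assume e: "e > 0"
    have "(\<lambda>x. c * ((t + e/c) * f x - w x) + 0 * f x) \<in> M"
      using that e fP by (intro function_cone_comb[OF cM]) (auto simp: val_def)
    then show "(\<lambda>x. (c * t + e) * f x - c * w x) \<in> M" using that by (simp add: algebra_simps)
    have "(\<lambda>x. c * (w x - (t - e/c) * f x) + 0 * f x) \<in> M"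
      using that e fP by (intro function_cone_comb[OF cM]) (auto simp: val_def)
    then show "(\<lambda>x. c * w x - (c * t - e) * f x) \<in> M" using that by (simp add: algebra_simps)
  qed
  have val_minus: "val (\<lambda>x. - w x) (- t)" if "val w t" for w t
    unfolding val_def
  proof (intro allI impI conjI)
    fix e :: real assume "e > 0"
    then have "(\<lambda>x. (t + e) * f x - w x) \<in> M" "(\<lambda>x. w x - (t - e) * f x) \<in> M"
      using that by (auto simp: val_def)
    then show "(\<lambda>x. (- t + e) * f x - - w x) \<in> M" "(\<lambda>x. - w x - (- t - e) * f x) \<in> M"
      by (simp_all add: algebra_simps)
  qed
  have val_0: "val (\<lambda>x. 0) 0" and val_f: "val f 1"
  proof -
    have *: "(\<lambda>x. e * f x) \<in> M" if "e > 0" for e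
      using fP cM that by (auto simp: function_cone_def)
    show "val (\<lambda>x. 0) 0" "val f 1" using * by (auto simp: val_def algebra_simps)
  qed
  have val_scale: "val (\<lambda>x. c * w x) (c * t)" if "val w t" for w c t
  proof -
    consider "c > 0" | "c = 0" | "c < 0" by linarith
    then show ?thesis
    proof cases
      case 3
      then show ?thesis using val_minus[OF val_scale_pos[OF that, of "- c"]] by simp
    qed (use val_scale_pos[OF that] val_0 in auto)
  qed
  show ?thesis
  proof
    show "linear_functional W J"
      unfolding linear_functional_def by (auto intro!: Jeq val_add val_scale valJ)
    show "J f = 1" using val_f by (rule Jeq)
    show "0 \<le> J v" if "v \<in> P" for v
    proof (rule field_le_epsilon)
      fix e :: real assume e: "0 < e"
      have "val v (J v)" using that P by (auto intro: valJ)
      then have "(\<lambda>x. 1 * ((J v + e) * f x - v x) + 1 * v x) \<in> M"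
        using that PM e by (intro function_cone_comb[OF cM]) (auto simp: val_def)
      then show "0 \<le> J v + e" by (intro nonneg) simp
    qed
  qed
qed

section \<open>Functionals normalized on all translates of a function\<close>

text \<open>A list of pairs stands for an element of the real group ring, repetitions allowed, so
  that addition is concatenation. The weight is the augmentation.\<close>

definition weight :: "(real \<times> 'a) list \<Rightarrow> real" where
  "weight ts = sum_list (map fst ts)"

definition translate_sum :: "(real \<times> 'a::group_add) list \<Rightarrow> ('a \<Rightarrow> real) \<Rightarrow> 'a \<Rightarrow> real" where
  "translate_sum ts f = (\<lambda>x. \<Sum>p\<leftarrow>ts. fst p * ltrans (snd p) f x)"

definition left_invariant_filter :: "'a::group_add filter \<Rightarrow> bool" where
  "left_invariant_filter F \<longleftrightarrow> (\<forall>P g. eventually P F \<longrightarrow> eventually (\<lambda>x. P (- g + x)) F)"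

definition translates_nonneg_weight :: "'a::group_add filter \<Rightarrow> ('a \<Rightarrow> real) \<Rightarrow> bool" where
  "translates_nonneg_weight F f \<longleftrightarrow> (\<forall>ts. nonneg_in F (translate_sum ts f) \<longrightarrow> 0 \<le> weight ts)"

definition dominated_by :: "'a::group_add filter \<Rightarrow> ('a \<Rightarrow> real) \<Rightarrow> real \<Rightarrow> ('a \<Rightarrow> real) \<Rightarrow> bool" where
  "dominated_by F f c v \<longleftrightarrow> (\<exists>ts. (\<forall>p\<in>set ts. 0 \<le> fst p) \<and> weight ts \<le> c \<and>
     (\<forall>\<^sub>F x in F. \<bar>v x\<bar> \<le> translate_sum ts f x))"

definition dominated_space :: "'a::group_add filter \<Rightarrow> ('a \<Rightarrow> real) \<Rightarrow> ('a \<Rightarrow> real) set" where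
  "dominated_space F f = {v. \<exists>c. dominated_by F f c v}"

definition translate_functional ::
  "'a::group_add filter \<Rightarrow> ('a \<Rightarrow> real) \<Rightarrow> (('a \<Rightarrow> real) \<Rightarrow> real) \<Rightarrow> bool" where
  "translate_functional F f J \<longleftrightarrow> linear_functional (dominated_space F f) J \<and>
     (\<forall>v\<in>dominated_space F f. nonneg_in F v \<longrightarrow> 0 \<le> J v) \<and> (\<forall>g. J (ltrans g f) = 1)"

lemma minus_add_add: "- (g + h) + x = - h + (- g + x)" for g h x :: "'a::group_add"
  by (simp add: minus_add add.assoc del: add_uminus_conv_diff)

lemma ltrans_ltrans: "ltrans g (ltrans h f) = ltrans (g + h) f"
  by (simp add: ltrans_def minus_add_add)

lemma ltrans_zero [simp]: "ltrans 0 f = f"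
  by (simp add: ltrans_def)

lemma weight_simps [simp]:
  "weight [] = 0" "weight (p # ts) = fst p + weight ts" "weight (ts @ us) = weight ts + weight us"
  by (auto simp: weight_def)

lemma translate_sum_simps [simp]:
  "translate_sum [] f x = 0"
  "translate_sum (p # ts) f x = fst p * ltrans (snd p) f x + translate_sum ts f x"
  "translate_sum (ts @ us) f x = translate_sum ts f x + translate_sum us f x"
  by (auto simp: translate_sum_def)

lemma weight_scale: "weight (map (\<lambda>p. (c * fst p, h (snd p))) ts) = c * weight ts"
  by (induction ts) (auto simp: algebra_simps)

lemma translate_sum_scale:
  "translate_sum (map (\<lambda>p. (c * fst p, g + snd p)) ts) f x = c * ltrans g (translate_sum ts f) x"
  by (induction ts) (auto simp: distrib_left mult.assoc ltrans_def minus_add_add)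

lemma translate_sum_closed:
  assumes "function_space W" "\<And>g. ltrans g f \<in> W"
  shows "translate_sum ts f \<in> W"
proof (induction ts)
  case Nil
  show ?case using function_space_comb[OF assms(1) assms(2,2), of 0 0 0] by (simp add: translate_sum_def)
next
  case (Cons p ts)
  then show ?case
    using function_space_comb[OF assms(1) assms(2) Cons, of "fst p" "snd p" 1] by (simp add: translate_sum_def)
qed

lemma linear_functional_translate_sum:
  assumes J: "linear_functional W J" and W: "function_space W" "\<And>g. ltrans g f \<in> W"
  shows "J (translate_sum ts f) = (\<Sum>p\<leftarrow>ts. fst p * J (ltrans (snd p) f))"
proof (induction ts)
  case Nil
  show ?case using linear_functional_scale[OF J W(2), of 0 0] by (simp add: translate_sum_def)
next
  case (Cons p ts)
  then show ?case
    using linear_functional_comb[OF J W(1) W(2) translate_sum_closed[OF W], of "fst p" "snd p" 1 ts]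
    by (simp add: translate_sum_def)
qed

lemma left_invariant_top: "left_invariant_filter top"
  by (simp add: left_invariant_filter_def)

lemma dominated_by_add:
  assumes "dominated_by F f c v" "dominated_by F f d w"
  shows "dominated_by F f (c + d) (\<lambda>x. v x + w x)"
proof -
  obtain ts us where *: "\<forall>p\<in>set ts. 0 \<le> fst p" "weight ts \<le> c" "\<forall>\<^sub>F x in F. \<bar>v x\<bar> \<le> translate_sum ts f x"
    "\<forall>p\<in>set us. 0 \<le> fst p" "weight us \<le> d" "\<forall>\<^sub>F x in F. \<bar>w x\<bar> \<le> translate_sum us f x"
    using assms unfolding dominated_by_def by blast
  have "\<forall>\<^sub>F x in F. \<bar>v x + w x\<bar> \<le> translate_sum (ts @ us) f x"
    using *(3,6) by eventually_elim auto
  then show ?thesis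
    unfolding dominated_by_def using * by (intro exI[of _ "ts @ us"]) auto
qed

lemma dominated_by_mono:
  assumes "dominated_by F f c w" "\<forall>\<^sub>F x in F. \<bar>v x\<bar> \<le> \<bar>w x\<bar>" "c \<le> d"
  shows "dominated_by F f d v"
proof -
  obtain ts where *: "\<forall>p\<in>set ts. 0 \<le> fst p" "weight ts \<le> c" "\<forall>\<^sub>F x in F. \<bar>w x\<bar> \<le> translate_sum ts f x"
    using assms unfolding dominated_by_def by blast
  have "\<forall>\<^sub>F x in F. \<bar>v x\<bar> \<le> translate_sum ts f x"
    using *(3) assms(2) by eventually_elim auto
  then show ?thesis
    unfolding dominated_by_def using * assms(3) by (intro exI[of _ ts]) auto
qed

lemma dominated_by_scale:
  assumes "dominated_by F f c v"
  shows "dominated_by F f (\<bar>a\<bar> * c) (\<lambda>x. a * v x)"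
proof -
  obtain ts where *: "\<forall>p\<in>set ts. 0 \<le> fst p" "weight ts \<le> c" "\<forall>\<^sub>F x in F. \<bar>v x\<bar> \<le> translate_sum ts f x"
    using assms unfolding dominated_by_def by blast
  define us where "us = map (\<lambda>p. (\<bar>a\<bar> * fst p, 0 + snd p)) ts"
  have "\<forall>\<^sub>F x in F. \<bar>a * v x\<bar> \<le> translate_sum us f x"
    using *(3) by eventually_elim (simp add: us_def translate_sum_scale[where g=0, simplified] abs_mult mult_left_mono)
  then show ?thesis
    unfolding dominated_by_def using *
    by (intro exI[of _ us]) (auto simp: us_def weight_scale[where h="\<lambda>x. x"] mult_left_mono)
qed

lemma dominated_by_ltrans:
  assumes "left_invariant_filter F" "dominated_by F f c v"
  shows "dominated_by F f c (ltrans g v)"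
proof -
  obtain ts where *: "\<forall>p\<in>set ts. 0 \<le> fst p" "weight ts \<le> c" "\<forall>\<^sub>F x in F. \<bar>v x\<bar> \<le> translate_sum ts f x"
    using assms unfolding dominated_by_def by blast
  define us where "us = map (\<lambda>p. (1 * fst p, g + snd p)) ts"
  have "\<forall>\<^sub>F x in F. \<bar>v (- g + x)\<bar> \<le> translate_sum ts f (- g + x)"
    using *(3) assms(1) unfolding left_invariant_filter_def by blast
  then have "\<forall>\<^sub>F x in F. \<bar>ltrans g v x\<bar> \<le> translate_sum us f x"
    by eventually_elim (simp only: us_def translate_sum_scale, simp add: ltrans_def)
  then show ?thesis
    unfolding dominated_by_def using * weight_scale[where h="\<lambda>x. g + x" and ts=ts and c=1]
    by (intro exI[of _ us]) (auto simp: us_def)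
qed

lemma dominated_by_self:
  assumes "nonneg_in F f"
  shows "dominated_by F f 1 f"
  unfolding dominated_by_def using assms by (intro exI[of _ "[(1, 0)]"]) (auto simp: nonneg_in_def)

lemma function_space_dominated: "function_space (dominated_space F f)"
  unfolding function_space_def dominated_space_def
  using dominated_by_add dominated_by_scale by blast

lemma dominated_space_ltrans:
  assumes "left_invariant_filter F" "v \<in> dominated_space F f"
  shows "ltrans g v \<in> dominated_space F f"
  using assms dominated_by_ltrans unfolding dominated_space_def by blast

lemma dominated_space_self: "nonneg_in F f \<Longrightarrow> f \<in> dominated_space F f"
  using dominated_by_self unfolding dominated_space_def by blast

lemma translate_sum_dominated_space:
  assumes "left_invariant_filter F" "nonneg_in F f"
  shows "translate_sum ts f \<in> dominated_space F f"
  by (intro translate_sum_closed function_space_dominated dominated_space_ltrans dominated_space_self assms)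

lemma translate_functional_translate_sum:
  assumes "left_invariant_filter F" "nonneg_in F f" "translate_functional F f J"
  shows "J (translate_sum ts f) = weight ts"
  using linear_functional_translate_sum[OF _ function_space_dominated
      dominated_space_ltrans[OF assms(1) dominated_space_self[OF assms(2)]], of J ts] assms(3)
  by (simp add: translate_functional_def weight_def)

lemma translate_functional_mono:
  assumes "translate_functional F f J" "v \<in> dominated_space F f" "w \<in> dominated_space F f"
    "\<forall>\<^sub>F x in F. v x \<le> w x"
  shows "J v \<le> J w"
proof -
  have "0 \<le> J (\<lambda>x. w x - v x)"
    using assms function_space_diff[OF function_space_dominated assms(3,2)]
    unfolding translate_functional_def nonneg_in_def by simp
  then show ?thesis
    using linear_functional_diff[of "dominated_space F f" J w v] assms
      function_space_dominated[of F f]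
    by (auto simp: translate_functional_def)
qed

text \<open>The bound is the same for all admissible J. This uniformity takes the place of a
  compactness argument when conditions on J are collected later.\<close>

lemma translate_functional_bound:
  assumes F: "left_invariant_filter F" "nonneg_in F f" and J: "translate_functional F f J"
    and v: "dominated_by F f c v"
  shows "\<bar>J v\<bar> \<le> c"
proof -
  obtain ts where ts: "weight ts \<le> c" "\<forall>\<^sub>F x in F. \<bar>v x\<bar> \<le> translate_sum ts f x"
    using v unfolding dominated_by_def by blast
  have vD: "v \<in> dominated_space F f" using v by (auto simp: dominated_space_def)
  note tD = translate_sum_dominated_space[OF F, of ts]
  have "J v \<le> J (translate_sum ts f)"
    by (rule translate_functional_mono[OF J vD tD]) (use ts(2) in \<open>eventually_elim, simp\<close>)
  moreover have "J (\<lambda>x. - v x) \<le> J (translate_sum ts f)"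
    by (rule translate_functional_mono[OF J function_space_minus[OF function_space_dominated vD] tD])
      (use ts(2) in \<open>eventually_elim, simp\<close>)
  ultimately show ?thesis
    using ts(1) translate_functional_translate_sum[OF F J, of ts]
      linear_functional_minus[of "dominated_space F f" J v] vD J
    by (auto simp: translate_functional_def)
qed

text \<open>The cone P consists of the v that become non-negative after adding a combination of
  translates of weight 0. If -f were in P, a combination of weight -1 would be non-negative, against
  the translate property. Since P contains gf - f and f - gf, a functional that is non-negative on P
  takes the same value at all translates of f.\<close>

lemma translate_functional_exists:
  assumes F: "left_invariant_filter F" and f: "nonneg_in F f" and T: "translates_nonneg_weight F f"
  obtains J where "translate_functional F f J"
proof -
  let ?D = "dominated_space F f"
  define P where "P = {v \<in> ?D. \<exists>ts. weight ts = 0 \<and> nonneg_in F (\<lambda>x. v x + translate_sum ts f x)}"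
  have D: "function_space ?D" by (rule function_space_dominated)
  have fD: "f \<in> ?D" by (rule dominated_space_self[OF f])
  have posP: "v \<in> P" if "v \<in> ?D" "nonneg_in F v" for v
    unfolding P_def using that by (auto intro!: exI[of _ "[]"])
  have cP: "function_cone P"
    unfolding function_cone_def
  proof (intro conjI ballI allI impI)
    have "(\<lambda>x. 0 * f x) \<in> ?D" using D fD unfolding function_space_def by blast
    then show "(\<lambda>x. 0) \<in> P" by (intro posP) (auto simp: nonneg_in_def)
  next
    fix v w assume "v \<in> P" "w \<in> P"
    then obtain ts us where *: "v \<in> ?D" "w \<in> ?D" "weight ts = 0" "weight us = 0"
      "\<forall>\<^sub>F x in F. 0 \<le> v x + translate_sum ts f x" "\<forall>\<^sub>F x in F. 0 \<le> w x + translate_sum us f x"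
      by (auto simp: P_def nonneg_in_def)
    have "\<forall>\<^sub>F x in F. 0 \<le> v x + w x + translate_sum (ts @ us) f x"
      using *(5,6) by eventually_elim auto
    then show "(\<lambda>x. v x + w x) \<in> P"
      using * D by (auto simp: P_def nonneg_in_def function_space_def intro!: exI[of _ "ts @ us"])
  next
    fix c :: real and w assume c: "0 \<le> c" and "w \<in> P"
    then obtain ts where *: "w \<in> ?D" "weight ts = 0" "\<forall>\<^sub>F x in F. 0 \<le> w x + translate_sum ts f x"
      by (auto simp: P_def nonneg_in_def)
    define us where "us = map (\<lambda>p. (c * fst p, 0 + snd p)) ts"
    have us: "translate_sum us f x = c * translate_sum ts f x" for x
      unfolding us_def translate_sum_scale by simp
    have "\<forall>\<^sub>F x in F. 0 \<le> c * w x + translate_sum us f x"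
      using *(3)
    proof eventually_elim
      case (elim x)
      then have "0 \<le> c * (w x + translate_sum ts f x)" using c by simp
      then show ?case unfolding us by (simp add: algebra_simps)
    qed
    moreover have "weight us = 0" using * unfolding us_def weight_scale by simp
    ultimately show "(\<lambda>x. c * w x) \<in> P"
      using * D by (auto simp: P_def nonneg_in_def function_space_def intro!: exI[of _ us])
  qed
  have nf: "(\<lambda>x. - f x) \<notin> P"
  proof
    assume "(\<lambda>x. - f x) \<in> P"
    then obtain ts where "weight ts = 0" "nonneg_in F (\<lambda>x. - f x + translate_sum ts f x)"
      by (auto simp: P_def)
    moreover have "translate_sum ((-1, 0) # ts) f = (\<lambda>x. - f x + translate_sum ts f x)"
      by (rule ext) simp
    ultimately have "0 \<le> weight ((-1, 0) # ts)"
      using T unfolding translates_nonneg_weight_def by metis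
    then show False using \<open>weight ts = 0\<close> by simp
  qed
  have unit: "\<exists>c. (\<lambda>x. c * f x - v x) \<in> P" if v: "v \<in> ?D" for v
  proof -
    obtain ts where ts: "\<forall>\<^sub>F x in F. \<bar>v x\<bar> \<le> translate_sum ts f x"
      using v by (auto simp: dominated_space_def dominated_by_def)
    \<comment> \<open>Adding this combination of weight 0 trades \<open>weight ts\<close> copies of
      f for the translates that dominate v.\<close>
    let ?us = "(- weight ts, 0) # ts"
    have "nonneg_in F (\<lambda>x. (weight ts * f x - v x) + translate_sum ?us f x)"
      unfolding nonneg_in_def using ts by eventually_elim auto
    moreover have "weight ?us = 0" by simp
    moreover have "(\<lambda>x. weight ts * f x - v x) \<in> ?D"
      using function_space_comb[OF D fD v, of "weight ts" "-1"] by simp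
    ultimately show ?thesis unfolding P_def by blast
  qed
  obtain J where J: "linear_functional ?D J" "\<And>v. v \<in> P \<Longrightarrow> 0 \<le> J v" "J f = 1"
    using cone_functional[OF D cP _ nf fD unit] unfolding P_def by blast
  have "J (ltrans g f) = 1" for g
  proof -
    have gD: "ltrans g f \<in> ?D" by (rule dominated_space_ltrans[OF F fD])
    have "(\<lambda>x. ltrans g f x - f x) \<in> P"
      using function_space_diff[OF D gD fD] unfolding P_def
      by (auto intro!: exI[of _ "[(1, 0), (-1, g)]"] simp: nonneg_in_def)
    moreover have "(\<lambda>x. f x - ltrans g f x) \<in> P"
      using function_space_diff[OF D fD gD] unfolding P_def
      by (auto intro!: exI[of _ "[(-1, 0), (1, g)]"] simp: nonneg_in_def)
    ultimately show ?thesis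
      using J(2)[of "\<lambda>x. ltrans g f x - f x"] J(2)[of "\<lambda>x. f x - ltrans g f x"] J(3)
        linear_functional_diff[OF J(1) D gD fD] linear_functional_diff[OF J(1) D fD gD] by simp
  qed
  then show ?thesis using that[of J] J posP by (auto simp: translate_functional_def)
qed

lemma bounded_in_dominated_space_top:
  assumes b: "\<And>s. 1 \<le> b s" and h: "\<And>s. \<bar>h s\<bar> \<le> C"
  shows "h \<in> dominated_space top b"
proof -
  have "0 \<le> C" using h[of undefined] by linarith
  have "\<bar>h s\<bar> \<le> C * b s" for s
    using h[of s] mult_left_mono[OF b[of s] \<open>0 \<le> C\<close>] by simp
  then have "dominated_by top b C h"
    unfolding dominated_by_def using \<open>0 \<le> C\<close> by (intro exI[of _ "[(C, 0)]"]) auto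
  then show ?thesis by (auto simp: dominated_space_def)
qed

section \<open>From normalized functionals to invariant ones\<close>

definition invariant_on :: "('a::group_add \<Rightarrow> real) set \<Rightarrow> (('a \<Rightarrow> real) \<Rightarrow> real) \<Rightarrow> bool" where
  "invariant_on S J \<longleftrightarrow> (\<forall>w\<in>S. \<forall>g. J (ltrans g w) = J w)"

text \<open>Average \<open>s \<mapsto> J (s\<^sup>-\<^sup>1 v)\<close> against a functional normalized on the translates of
  \<open>s \<mapsto> J (s\<^sup>-\<^sup>1 w) + c\<close>.\<close>

lemma translate_functional_average:
  assumes F: "left_invariant_filter F" and f: "nonneg_in F f" and J: "translate_functional F f J"
    and S: "invariant_on S J" "S \<subseteq> dominated_space F f" and w: "w \<in> dominated_space F f"
    and T: "\<And>c. (\<And>s. 1 \<le> J (ltrans (- s) w) + c) \<Longrightarrow>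
      translates_nonneg_weight top (\<lambda>s. J (ltrans (- s) w) + c)"
  obtains J' where "translate_functional F f J'" "invariant_on (insert w S) J'"
proof -
  let ?D = "dominated_space F f"
  have linJ: "linear_functional ?D J" and posJ: "\<And>v. v \<in> ?D \<Longrightarrow> nonneg_in F v \<Longrightarrow> 0 \<le> J v"
    and J1: "\<And>g. J (ltrans g f) = 1"
    using J by (auto simp: translate_functional_def)
  have tD: "ltrans g v \<in> ?D" if "v \<in> ?D" for g v by (rule dominated_space_ltrans[OF F that])
  have bd: "\<exists>C. \<forall>s. \<bar>J (ltrans (- s) v)\<bar> \<le> C" if "v \<in> ?D" for v
    using that dominated_by_ltrans[OF F] translate_functional_bound[OF F f J]
    unfolding dominated_space_def by blast
  define B where "B v = (\<lambda>s. J (ltrans (- s) v))" for v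
  obtain C where C: "\<And>s. \<bar>B w s\<bar> \<le> C" using bd[OF w] by (auto simp: B_def)
  \<comment> \<open>As B w \<ge> -C, the shift by C + 1 gives b \<ge> 1. The shift is a constant, so
    it does not disturb translations.\<close>
  define b where "b = (\<lambda>s. B w s + (C + 1))"
  have b1: "1 \<le> b s" for s using C[of s] by (auto simp: b_def abs_le_iff)
  have b2: "b s \<le> 2 * C + 1" for s using C[of s] by (auto simp: b_def abs_le_iff)
  have bpos: "nonneg_in top b" using b1 by (auto simp: nonneg_in_def intro: order_trans[of 0 1])
  have "translates_nonneg_weight top b"
    using T[of "C + 1"] b1 by (simp add: b_def B_def)
  then obtain M where M: "translate_functional top b M"
    using translate_functional_exists[OF left_invariant_top bpos] by blast
  let ?B = "dominated_space top b"
  have linM: "linear_functional ?B M" and posM: "\<And>v. v \<in> ?B \<Longrightarrow> nonneg_in top v \<Longrightarrow> 0 \<le> M v"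
    and M1: "\<And>g. M (ltrans g b) = 1"
    using M by (auto simp: translate_functional_def)
  have inB: "h \<in> ?B" if "\<And>s. \<bar>h s\<bar> \<le> K" for h K
    by (rule bounded_in_dominated_space_top[OF b1 that])
  have BB: "B v \<in> ?B" if v: "v \<in> ?D" for v
    using bd[OF v] inB[of "B v"] unfolding B_def by auto
  have oneB: "(\<lambda>s. c) \<in> ?B" for c by (rule inB[of _ "\<bar>c\<bar>"]) simp
  \<comment> \<open>M is normalized on the translates of b, not on constants, and \<open>J'\<close>
    has to be divided by M(1). This is positive because M(b) = 1 while b is at most 2 C + 1.\<close>
  define \<mu> where "\<mu> = M (\<lambda>s. 1)"
  have Mconst: "M (\<lambda>s. c) = c * \<mu>" for c
  proof -
    have "M (\<lambda>s. c * 1) = c * M (\<lambda>s. 1)"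
      by (rule linear_functional_scale[OF linM oneB])
    then show ?thesis by (simp add: \<mu>_def)
  qed
  have "M b \<le> M (\<lambda>s. 2 * C + 1)"
    using b2 by (intro translate_functional_mono[OF M dominated_space_self[OF bpos] oneB]) auto
  then have "1 \<le> (2 * C + 1) * \<mu>" using M1[of 0] Mconst by simp
  moreover have "0 \<le> \<mu>" unfolding \<mu>_def by (rule posM[OF oneB]) (simp add: nonneg_in_def)
  ultimately have \<mu>: "0 < \<mu>" by (cases "\<mu> = 0") auto
  define J' where "J' v = M (B v) / \<mu>" for v
  have Blin: "B (\<lambda>x. a * u x + b * v x) = (\<lambda>s. a * B u s + b * B v s)" if "u \<in> ?D" "v \<in> ?D" for u v a b
    using linear_functional_comb[OF linJ function_space_dominated tD[OF that(1)] tD[OF that(2)]]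
    by (simp add: B_def ltrans_def fun_eq_iff del: minus_minus)
  have Bt: "B (ltrans g v) = ltrans g (B v)" for g v
    by (rule ext) (simp add: B_def ltrans_ltrans, simp add: ltrans_def minus_add del: add_uminus_conv_diff)
  have "translate_functional F f J'"
    unfolding translate_functional_def
  proof (intro conjI ballI allI impI)
    show "linear_functional ?D J'"
    proof (rule linear_functionalI)
      fix u v a b assume uv: "u \<in> ?D" "v \<in> ?D"
      show "J' (\<lambda>x. a * u x + b * v x) = a * J' u + b * J' v"
        unfolding J'_def Blin[OF uv] linear_functional_comb[OF linM function_space_dominated BB[OF uv(1)] BB[OF uv(2)]]
        by (simp add: add_divide_distrib)
    qed
  next
    fix v assume v: "v \<in> ?D" "nonneg_in F v"
    have "0 \<le> B v s" for s
      unfolding B_def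
    proof (rule posJ[OF tD[OF v(1)]])
      show "nonneg_in F (ltrans (- s) v)"
        using v(2) F unfolding nonneg_in_def ltrans_def left_invariant_filter_def by blast
    qed
    then have "0 \<le> M (B v)" using BB[OF v(1)] by (intro posM) (auto simp: nonneg_in_def)
    then show "0 \<le> J' v" using \<mu> by (simp add: J'_def)
  next
    fix g
    have "B (ltrans g f) = (\<lambda>s. 1)" by (rule ext) (simp add: B_def ltrans_ltrans J1)
    then show "J' (ltrans g f) = 1" using \<mu> by (simp add: J'_def \<mu>_def)
  qed
  \<comment> \<open>For v in S the orbit function B v is constant, so invariance obtained earlier
    survives whatever M is.\<close>
  moreover have "J' (ltrans g v) = J' v" if "v \<in> S" for v g
  proof -
    have "B (ltrans g v) = B v"
      using S that by (auto simp: B_def ltrans_ltrans invariant_on_def)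
    then show ?thesis by (simp add: J'_def)
  qed
  moreover have "J' (ltrans g w) = J' w" for g
  proof -
    have gw: "ltrans g (B w) \<in> ?B" using BB[OF tD[OF w]] by (simp add: Bt[symmetric])
    \<comment> \<open>The equality M(gb) = M(b) loses the same constant term on both sides, which
      leaves the invariance of M at B w.\<close>
    have "M (\<lambda>s. ltrans g (B w) s + (C + 1)) = M (ltrans g (B w)) + M (\<lambda>s. C + 1)"
      using linM gw oneB[of "C + 1"] unfolding linear_functional_def by (auto dest: bspec)
    moreover have "(\<lambda>s. ltrans g (B w) s + (C + 1)) = ltrans g b"
      by (simp add: ltrans_def b_def)
    moreover have "M (\<lambda>s. B w s + (C + 1)) = M (B w) + M (\<lambda>s. C + 1)"
      using linM BB[OF w] oneB[of "C + 1"] unfolding linear_functional_def by (auto dest: bspec)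
    ultimately have "M (ltrans g (B w)) = M (B w)"
      using M1[of g] M1[of 0] by (simp add: b_def)
    then show ?thesis by (simp add: J'_def Bt)
  qed
  ultimately show ?thesis using that[of J'] by (auto simp: invariant_on_def)
qed

text \<open>Compactness takes the form of a second Hahn-Banach argument. The cone P contains v as
  soon as v is non-negative under all admissible functionals that are invariant on some finite
  subset of W. Iterated averaging provides such a functional for every finite subset, and its value
  -1 at -f keeps -f out of P. For w in W both gw - w and w - gw lie in P, with {w} as the finite
  subset.\<close>

lemma invariant_translate_functional:
  assumes F: "left_invariant_filter F" and f: "nonneg_in F f" and Tf: "translates_nonneg_weight F f"
    and W: "W \<subseteq> dominated_space F f"
    and T: "\<And>J w c. translate_functional F f J \<Longrightarrow> w \<in> W \<Longrightarrow> (\<And>s. 1 \<le> J (ltrans (- s) w) + c) \<Longrightarrow>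
      translates_nonneg_weight top (\<lambda>s. J (ltrans (- s) w) + c)"
  obtains J where "translate_functional F f J" "invariant_on W J"
proof -
  let ?D = "dominated_space F f"
  have fin: "\<exists>J. translate_functional F f J \<and> invariant_on S J" if "finite S" "S \<subseteq> W" for S
    using that
  proof (induction S rule: finite_induct)
    case empty
    then show ?case using translate_functional_exists[OF F f Tf] by (auto simp: invariant_on_def)
  next
    case (insert w S)
    then obtain J where J: "translate_functional F f J" "invariant_on S J" by auto
    have "S \<subseteq> ?D" "w \<in> ?D" using W insert.prems by auto
    then show ?case
      using translate_functional_average[OF F f J, of w] T[OF J(1)] insert.prems by (metis insert_subset)
  qed
  define P where "P = {v \<in> ?D. \<exists>S. finite S \<and> S \<subseteq> W \<and>
    (\<forall>J. translate_functional F f J \<longrightarrow> invariant_on S J \<longrightarrow> 0 \<le> J v)}"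
  have D: "function_space ?D" by (rule function_space_dominated)
  have fD: "f \<in> ?D" by (rule dominated_space_self[OF f])
  have PI: "v \<in> P" if "v \<in> ?D" "finite S" "S \<subseteq> W"
    "\<And>J. translate_functional F f J \<Longrightarrow> invariant_on S J \<Longrightarrow> 0 \<le> J v" for v S
    using that unfolding P_def by blast
  have lin: "linear_functional ?D J" if "translate_functional F f J" for J
    using that by (simp add: translate_functional_def)
  have J1: "J f = 1" if "translate_functional F f J" for J
    using that ltrans_zero[of f] by (auto simp: translate_functional_def simp del: ltrans_zero dest: spec[of _ 0])
  have zero: "(\<lambda>x. 0 * f x) \<in> ?D" using D fD unfolding function_space_def by blast
  have cP: "function_cone P"
    unfolding function_cone_def
  proof (intro conjI ballI allI impI)
    show "(\<lambda>x. 0) \<in> P"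
      using zero by (intro PI[of _ "{}"]) (auto simp: translate_functional_def nonneg_in_def)
  next
    fix v w assume "v \<in> P" "w \<in> P"
    then obtain S T where *: "v \<in> ?D" "w \<in> ?D" "finite S" "S \<subseteq> W" "finite T" "T \<subseteq> W"
      "\<And>J. translate_functional F f J \<Longrightarrow> invariant_on S J \<Longrightarrow> 0 \<le> J v"
      "\<And>J. translate_functional F f J \<Longrightarrow> invariant_on T J \<Longrightarrow> 0 \<le> J w"
      unfolding P_def by blast
    show "(\<lambda>x. v x + w x) \<in> P"
    proof (rule PI[of _ "S \<union> T"])
      fix J assume J: "translate_functional F f J" "invariant_on (S \<union> T) J"
      then have "0 \<le> J v" "0 \<le> J w" using * by (auto simp: invariant_on_def)
      then show "0 \<le> J (\<lambda>x. v x + w x)"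
        using lin[OF J(1)] * unfolding linear_functional_def by (auto dest: bspec)
    qed (use * D in \<open>auto simp: function_space_def\<close>)
  next
    fix c :: real and w assume c: "0 \<le> c" and "w \<in> P"
    then obtain S where *: "w \<in> ?D" "finite S" "S \<subseteq> W"
      "\<And>J. translate_functional F f J \<Longrightarrow> invariant_on S J \<Longrightarrow> 0 \<le> J w"
      unfolding P_def by blast
    show "(\<lambda>x. c * w x) \<in> P"
    proof (rule PI[of _ S])
      fix J assume J: "translate_functional F f J" "invariant_on S J"
      then show "0 \<le> J (\<lambda>x. c * w x)"
        using lin[OF J(1)] * c unfolding linear_functional_def by auto
    qed (use * D in \<open>auto simp: function_space_def\<close>)
  qed
  have nf: "(\<lambda>x. - f x) \<notin> P"
  proof
    assume "(\<lambda>x. - f x) \<in> P"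
    then obtain S where *: "finite S" "S \<subseteq> W"
      "\<And>J. translate_functional F f J \<Longrightarrow> invariant_on S J \<Longrightarrow> 0 \<le> J (\<lambda>x. - f x)"
      unfolding P_def by blast
    obtain J where J: "translate_functional F f J" "invariant_on S J" using fin *(1,2) by blast
    show False using *(3)[OF J] linear_functional_minus[OF lin[OF J(1)] fD] J1[OF J(1)] by simp
  qed
  have unit: "\<exists>c. (\<lambda>x. c * f x - v x) \<in> P" if v: "v \<in> ?D" for v
  proof -
    obtain c where c: "dominated_by F f c v" using v by (auto simp: dominated_space_def)
    have cf: "(\<lambda>x. c * f x) \<in> ?D" using D fD unfolding function_space_def by blast
    have "(\<lambda>x. c * f x - v x) \<in> P"
    proof (rule PI[of _ "{}"])
      show "(\<lambda>x. c * f x - v x) \<in> ?D" by (rule function_space_diff[OF D cf v])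
      fix J assume J: "translate_functional F f J"
      have "J (\<lambda>x. c * f x) = c * J f"
        using lin[OF J] fD unfolding linear_functional_def by blast
      then show "0 \<le> J (\<lambda>x. c * f x - v x)"
        using linear_functional_diff[OF lin[OF J] D cf v] J1[OF J]
          translate_functional_bound[OF F f J c] by simp
    qed auto
    then show ?thesis by blast
  qed
  obtain J where J: "linear_functional ?D J" "\<And>v. v \<in> P \<Longrightarrow> 0 \<le> J v" "J f = 1"
    using cone_functional[OF D cP _ nf fD unit] unfolding P_def by blast
  have eq: "J (ltrans g w) = J w" if w: "w \<in> ?D" and S: "finite S" "S \<subseteq> W"
    and inv: "\<And>J. translate_functional F f J \<Longrightarrow> invariant_on S J \<Longrightarrow> J (ltrans g w) = J w" for g w S
  proof -
    have gD: "ltrans g w \<in> ?D" by (rule dominated_space_ltrans[OF F w])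
    have "(\<lambda>x. ltrans g w x - w x) \<in> P"
    proof (rule PI[OF function_space_diff[OF D gD w] S])
      fix J assume "translate_functional F f J" "invariant_on S J"
      then show "0 \<le> J (\<lambda>x. ltrans g w x - w x)"
        using inv[of J] linear_functional_diff[OF lin[of J] D gD w] by simp
    qed
    moreover have "(\<lambda>x. w x - ltrans g w x) \<in> P"
    proof (rule PI[OF function_space_diff[OF D w gD] S])
      fix J assume "translate_functional F f J" "invariant_on S J"
      then show "0 \<le> J (\<lambda>x. w x - ltrans g w x)"
        using inv[of J] linear_functional_diff[OF lin[of J] D w gD] by simp
    qed
    ultimately show ?thesis
      using J(2)[of "\<lambda>x. ltrans g w x - w x"] J(2)[of "\<lambda>x. w x - ltrans g w x"]
        linear_functional_diff[OF J(1) D gD w] linear_functional_diff[OF J(1) D w gD] by simp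
  qed
  have "J (ltrans g f) = 1" for g
    using eq[OF fD, of "{}" g] J(3) J1 by (auto simp: translate_functional_def)
  moreover have "0 \<le> J v" if "v \<in> ?D" "nonneg_in F v" for v
    using that by (intro J(2) PI[of _ "{}"]) (auto simp: translate_functional_def)
  moreover have "J (ltrans g w) = J w" if "w \<in> W" for g w
    using that W by (intro eq[of w "{w}"]) (auto simp: invariant_on_def)
  ultimately show ?thesis
    using that[of J] J(1) by (auto simp: translate_functional_def invariant_on_def)
qed

section \<open>Uniform continuity and compact supports\<close>

text \<open>The name tells on which side the argument is perturbed: the bounded functions with this
  property form \<open>C_b_ru\<close>, and those with \<open>right_uniform\<close> form
  \<open>C_b_lu\<close>.\<close>

definition left_uniform :: "('a::topological_group_add \<Rightarrow> real) \<Rightarrow> bool" where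
  "left_uniform b \<longleftrightarrow> (\<forall>e>0. \<forall>\<^sub>F t in nhds 0. \<forall>x. \<bar>b (t + x) - b x\<bar> \<le> e)"

definition right_uniform :: "('a::topological_group_add \<Rightarrow> real) \<Rightarrow> bool" where
  "right_uniform b \<longleftrightarrow> (\<forall>e>0. \<forall>\<^sub>F t in nhds 0. \<forall>x. \<bar>b (x + t) - b x\<bar> \<le> e)"

lemma eventually_nhds_compose:
  assumes "continuous_on UNIV h" "h a = b" "eventually P (nhds b)"
  shows "\<forall>\<^sub>F x in nhds a. P (h x)"
proof -
  have "filterlim h (nhds (h a)) (nhds a)"
    using assms(1) by (simp add: continuous_on_def tendsto_at_iff_tendsto_nhds[symmetric])
  then show ?thesis using assms by (simp add: filterlim_iff)
qed

lemma continuous_on_UNIV_realI: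
  fixes b :: "'a::topological_space \<Rightarrow> 'b::metric_space"
  assumes "\<And>x e. 0 < e \<Longrightarrow> \<forall>\<^sub>F z in nhds x. dist (b z) (b x) \<le> e"
  shows "continuous_on UNIV b"
proof -
  have "(b \<longlongrightarrow> b x) (nhds x)" for x
  proof (rule tendstoI)
    fix e :: real assume "0 < e"
    then show "\<forall>\<^sub>F z in nhds x. dist (b z) (b x) < e"
      using assms[of "e/2" x] by (auto elim: eventually_mono)
  qed
  then show ?thesis
    by (simp add: continuous_on_def tendsto_at_iff_tendsto_nhds)
qed

lemma left_uniform_imp_continuous:
  assumes "left_uniform b"
  shows "continuous_on UNIV b"
proof (rule continuous_on_UNIV_realI)
  fix x :: 'a and e :: real assume "0 < e"
  then have "\<forall>\<^sub>F z in nhds x. \<forall>y. \<bar>b ((z - x) + y) - b y\<bar> \<le> e"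
    using assms by (intro eventually_nhds_compose[of "\<lambda>z. z - x"])
      (auto simp: left_uniform_def intro!: continuous_intros)
  then show "\<forall>\<^sub>F z in nhds x. dist (b z) (b x) \<le> e"
  proof eventually_elim
    case (elim z)
    then show ?case using elim[rule_format, of x] by (simp add: dist_real_def)
  qed
qed

lemma right_uniform_imp_continuous:
  assumes "right_uniform b"
  shows "continuous_on UNIV b"
proof (rule continuous_on_UNIV_realI)
  fix x :: 'a and e :: real assume "0 < e"
  then have "\<forall>\<^sub>F z in nhds x. \<forall>y. \<bar>b (y + (- x + z)) - b y\<bar> \<le> e"
    using assms by (intro eventually_nhds_compose[of "\<lambda>z. - x + z"])
      (auto simp: right_uniform_def intro!: continuous_intros)
  then show "\<forall>\<^sub>F z in nhds x. dist (b z) (b x) \<le> e"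
  proof eventually_elim
    case (elim z)
    then show ?case using elim[rule_format, of x] by (simp add: dist_real_def)
  qed
qed

lemma bcontfun_translates:
  fixes f :: "'a::topological_group_add \<Rightarrow> real"
  assumes "f \<in> bcontfun"
  shows "ltrans g f \<in> bcontfun" "rtrans g f \<in> bcontfun"
proof -
  have c: "continuous_on UNIV f" and b: "bounded (range f)" using assms by (auto simp: bcontfun_def)
  have "continuous_on UNIV (ltrans g f)" "continuous_on UNIV (rtrans g f)"
    unfolding ltrans_def rtrans_def
    by (auto intro!: continuous_on_compose2[OF c] continuous_intros)
  moreover have "bounded (range (ltrans g f))" "bounded (range (rtrans g f))"
    by (rule bounded_subset[OF b]; auto simp: ltrans_def rtrans_def)+
  ultimately show "ltrans g f \<in> bcontfun" "rtrans g f \<in> bcontfun" by (auto simp: bcontfun_def)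
qed

lemma dist_Bcontfun_le:
  assumes "u \<in> bcontfun" "v \<in> bcontfun" "\<And>x. dist (u x) (v x) \<le> e"
  shows "dist (Bcontfun u) (Bcontfun v) \<le> e"
  using assms by (intro dist_bound) (simp add: Bcontfun_inverse)

lemma dist_le_Bcontfun:
  assumes "u \<in> bcontfun" "v \<in> bcontfun"
  shows "dist (u x) (v x) \<le> dist (Bcontfun u) (Bcontfun v)"
  using dist_bounded[of "Bcontfun u" x "Bcontfun v"] assms by (simp add: Bcontfun_inverse)

lemma continuous_dist_le:
  fixes h :: "'a::topological_space \<Rightarrow> 'b::metric_space"
  assumes "continuous_on UNIV h" "0 < e"
  shows "\<forall>\<^sub>F z in nhds a. dist (h z) (h a) < e"
proof -
  have "(h \<longlongrightarrow> h a) (nhds a)"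
    using assms(1) by (simp add: continuous_on_def tendsto_at_iff_tendsto_nhds[symmetric])
  then show ?thesis using tendstoD assms(2) by blast
qed

text \<open>Continuity of the orbit map may be tested at the neutral element, since the distance of
  hf and gf is the supremum over y of |f((-h + g) + y) - f(y)|.\<close>

lemma C_b_ru_iff: "f \<in> C_b_ru \<longleftrightarrow> bounded (range f) \<and> left_uniform f"
proof
  assume f: "f \<in> C_b_ru"
  then have bc: "f \<in> bcontfun" and cont: "continuous_on UNIV (\<lambda>g. Bcontfun (ltrans g f))"
    by (auto simp: C_b_ru_def C_b_def)
  have "\<forall>\<^sub>F t in nhds 0. \<forall>x. \<bar>f (t + x) - f x\<bar> \<le> e" if "0 < e" for e
  proof -
    have "\<forall>\<^sub>F t in nhds (0::'a). dist (Bcontfun (ltrans (- t) f)) (Bcontfun (ltrans 0 f)) < e"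
      using continuous_dist_le[OF cont that, of 0]
      by (intro eventually_nhds_compose[of uminus 0 0]) (auto intro!: continuous_intros)
    then show ?thesis
    proof eventually_elim
      case (elim t)
      show ?case
      proof
        fix x
        show "\<bar>f (t + x) - f x\<bar> \<le> e"
          using elim dist_le_Bcontfun[OF bcontfun_translates(1)[OF bc, of "- t"]
              bcontfun_translates(1)[OF bc, of 0], of x]
          by (simp add: ltrans_def dist_real_def)
      qed
    qed
  qed
  then show "bounded (range f) \<and> left_uniform f" using bc by (auto simp: left_uniform_def bcontfun_def)
next
  assume f: "bounded (range f) \<and> left_uniform f"
  then have bc: "f \<in> bcontfun" by (simp add: bcontfun_def left_uniform_imp_continuous)
  have "continuous_on UNIV (\<lambda>g. Bcontfun (ltrans g f))"
  proof (rule continuous_on_UNIV_realI)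
    fix g :: 'a and e :: real assume "0 < e"
    then have "\<forall>\<^sub>F h in nhds g. \<forall>x. \<bar>f ((- h + g) + x) - f x\<bar> \<le> e"
      using f by (intro eventually_nhds_compose[of "\<lambda>h. - h + g"])
        (auto simp: left_uniform_def intro!: continuous_intros)
    then show "\<forall>\<^sub>F h in nhds g. dist (Bcontfun (ltrans h f)) (Bcontfun (ltrans g f)) \<le> e"
    proof eventually_elim
      case (elim h)
      show ?case
      proof (rule dist_Bcontfun_le[OF bcontfun_translates(1)[OF bc] bcontfun_translates(1)[OF bc]])
        fix x
        have "(- h + g) + (- g + x) = - h + x" by (simp add: add.assoc)
        then show "dist (ltrans h f x) (ltrans g f x) \<le> e"
          using elim[rule_format, of "- g + x"] by (simp add: ltrans_def dist_real_def)
      qed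
    qed
  qed
  then show "f \<in> C_b_ru" using bc by (simp add: C_b_ru_def C_b_def)
qed

lemma C_b_lu_iff: "f \<in> C_b_lu \<longleftrightarrow> bounded (range f) \<and> right_uniform f"
proof
  assume f: "f \<in> C_b_lu"
  then have bc: "f \<in> bcontfun" and cont: "continuous_on UNIV (\<lambda>g. Bcontfun (rtrans g f))"
    by (auto simp: C_b_lu_def C_b_def)
  have "\<forall>\<^sub>F t in nhds 0. \<forall>x. \<bar>f (x + t) - f x\<bar> \<le> e" if "0 < e" for e
    using continuous_dist_le[OF cont that, of 0]
  proof eventually_elim
    case (elim t)
    show ?case
    proof
      fix x
      show "\<bar>f (x + t) - f x\<bar> \<le> e"
        using elim dist_le_Bcontfun[OF bcontfun_translates(2)[OF bc, of t]
            bcontfun_translates(2)[OF bc, of 0], of x]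
        by (simp add: rtrans_def dist_real_def)
    qed
  qed
  then show "bounded (range f) \<and> right_uniform f" using bc by (auto simp: right_uniform_def bcontfun_def)
next
  assume f: "bounded (range f) \<and> right_uniform f"
  then have bc: "f \<in> bcontfun" by (simp add: bcontfun_def right_uniform_imp_continuous)
  have "continuous_on UNIV (\<lambda>g. Bcontfun (rtrans g f))"
  proof (rule continuous_on_UNIV_realI)
    fix g :: 'a and e :: real assume "0 < e"
    then have "\<forall>\<^sub>F h in nhds g. \<forall>x. \<bar>f (x + (- g + h)) - f x\<bar> \<le> e"
      using f by (intro eventually_nhds_compose[of "\<lambda>h. - g + h"])
        (auto simp: right_uniform_def intro!: continuous_intros)
    then show "\<forall>\<^sub>F h in nhds g. dist (Bcontfun (rtrans h f)) (Bcontfun (rtrans g f)) \<le> e"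
    proof eventually_elim
      case (elim h)
      show ?case
      proof (rule dist_Bcontfun_le[OF bcontfun_translates(2)[OF bc] bcontfun_translates(2)[OF bc]])
        fix x
        have "(x + g) + (- g + h) = x + h" by (simp add: add.assoc)
        then show "dist (rtrans h f x) (rtrans g f x) \<le> e"
          using elim[rule_format, of "x + g"] by (simp add: rtrans_def dist_real_def)
      qed
    qed
  qed
  then show "f \<in> C_b_lu" using bc by (simp add: C_b_lu_def C_b_def)
qed

text \<open>A left translation by g turns the perturbation t into the conjugate -g + t + g, which
  still tends to 0.\<close>

lemma left_uniform_ltrans:
  assumes "left_uniform f"
  shows "left_uniform (ltrans g f)"
  unfolding left_uniform_def
proof (intro allI impI)
  fix e :: real assume "0 < e"
  then have "\<forall>\<^sub>F t in nhds 0. \<forall>x. \<bar>f ((- g + t + g) + x) - f x\<bar> \<le> e"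
    using assms by (intro eventually_nhds_compose[of "\<lambda>t. - g + t + g"])
      (auto simp: left_uniform_def intro!: continuous_intros)
  then show "\<forall>\<^sub>F t in nhds 0. \<forall>x. \<bar>ltrans g f (t + x) - ltrans g f x\<bar> \<le> e"
  proof eventually_elim
    case (elim t)
    show ?case
    proof
      fix x
      have "(- g + t + g) + (- g + x) = - g + (t + x)" by (simp add: add.assoc)
      then show "\<bar>ltrans g f (t + x) - ltrans g f x\<bar> \<le> e"
        using elim[rule_format, of "- g + x"] by (simp add: ltrans_def)
    qed
  qed
qed

lemma right_uniform_ltrans:
  assumes "right_uniform f"
  shows "right_uniform (ltrans g f)"
  unfolding right_uniform_def
proof (intro allI impI)
  fix e :: real assume "0 < e"
  then have "\<forall>\<^sub>F t in nhds 0. \<forall>x. \<bar>f (x + t) - f x\<bar> \<le> e"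
    using assms by (simp add: right_uniform_def)
  then show "\<forall>\<^sub>F t in nhds 0. \<forall>x. \<bar>ltrans g f (x + t) - ltrans g f x\<bar> \<le> e"
    by eventually_elim (simp add: ltrans_def add.assoc[symmetric])
qed

section \<open>Compactly supported functions\<close>

definition C_c :: "('a::topological_space \<Rightarrow> real) set" where
  "C_c = {\<psi>. continuous_on UNIV \<psi> \<and> (\<exists>K. compact K \<and> (\<forall>x. x \<notin> K \<longrightarrow> \<psi> x = 0))}"

lemma C_c_bounded:
  assumes "\<psi> \<in> C_c"
  obtains C where "0 \<le> C" "\<And>x. \<bar>\<psi> x\<bar> \<le> C"
proof -
  obtain K where K: "compact K" "\<And>x. x \<notin> K \<Longrightarrow> \<psi> x = 0" and c: "continuous_on UNIV \<psi>"
    using assms by (auto simp: C_c_def)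
  have "compact (\<psi> ` K)" using K c by (meson compact_continuous_image continuous_on_subset subset_UNIV)
  then have "bounded (\<psi> ` K)" by (rule compact_imp_bounded)
  then obtain C where "\<And>x. x \<in> K \<Longrightarrow> \<bar>\<psi> x\<bar> \<le> C"
    unfolding bounded_iff by auto
  then have "\<bar>\<psi> x\<bar> \<le> max C 0" for x using K(2)[of x] by (cases "x \<in> K") (auto simp: le_max_iff_disj)
  then show ?thesis using that[of "max C 0"] by auto
qed

lemma C_c_compose:
  assumes "\<psi> \<in> C_c" "continuous_on UNIV h" "continuous_on UNIV h'" "\<And>x. h' (h x) = x"
  shows "(\<lambda>x. \<psi> (h x)) \<in> C_c"
proof -
  obtain K where K: "compact K" "\<And>x. x \<notin> K \<Longrightarrow> \<psi> x = 0" and c: "continuous_on UNIV \<psi>"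
    using assms by (auto simp: C_c_def)
  have "compact (h' ` K)"
    using K assms(3) by (meson compact_continuous_image continuous_on_subset subset_UNIV)
  moreover have "\<psi> (h x) = 0" if "x \<notin> h' ` K" for x
    using that K(2)[of "h x"] assms(4)[of x] by force
  moreover have "continuous_on UNIV (\<lambda>x. \<psi> (h x))"
    by (rule continuous_on_compose2[OF c assms(2)]) auto
  ultimately show ?thesis by (auto simp: C_c_def)
qed

lemma C_c_left:
  fixes \<psi> :: "'a::topological_group_add \<Rightarrow> real"
  shows "\<psi> \<in> C_c \<Longrightarrow> (\<lambda>x. \<psi> (g + x)) \<in> C_c"
  by (rule C_c_compose[where h' = "\<lambda>x. - g + x"]) (auto intro!: continuous_intros)

lemma C_c_ltrans:
  fixes \<psi> :: "'a::topological_group_add \<Rightarrow> real"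
  shows "\<psi> \<in> C_c \<Longrightarrow> ltrans g \<psi> \<in> C_c"
  unfolding ltrans_def by (rule C_c_left)

lemma C_c_right:
  fixes \<psi> :: "'a::topological_group_add \<Rightarrow> real"
  shows "\<psi> \<in> C_c \<Longrightarrow> (\<lambda>x. \<psi> (x + g)) \<in> C_c"
  by (rule C_c_compose[where h' = "\<lambda>x. x + - g"]) (auto intro!: continuous_intros)

lemma C_c_uminus:
  fixes \<psi> :: "'a::topological_group_add \<Rightarrow> real"
  shows "\<psi> \<in> C_c \<Longrightarrow> (\<lambda>x. \<psi> (- x)) \<in> C_c"
  by (rule C_c_compose[where h' = "\<lambda>x. - x"]) (auto intro!: continuous_intros)

lemma C_c_comb:
  fixes \<phi> \<psi> :: "'a::t2_space \<Rightarrow> real"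
  assumes "\<phi> \<in> C_c" "\<psi> \<in> C_c"
  shows "(\<lambda>x. a * \<phi> x + b * \<psi> x) \<in> C_c"
proof -
  obtain K L where "compact K" "\<And>x. x \<notin> K \<Longrightarrow> \<phi> x = 0" "compact L" "\<And>x. x \<notin> L \<Longrightarrow> \<psi> x = 0"
    "continuous_on UNIV \<phi>" "continuous_on UNIV \<psi>"
    using assms by (auto simp: C_c_def)
  then show ?thesis unfolding C_c_def mem_Collect_eq
    by (intro conjI exI[of _ "K \<union> L"]) (auto intro!: continuous_intros)
qed

lemma function_space_C_c: "function_space (C_c :: ('a::t2_space \<Rightarrow> real) set)"
  by (rule function_spaceI) (rule C_c_comb)

locale lc_group =
  fixes dummy :: "'a::{topological_group_add, t2_space} itself"
  assumes lc: "locally_compact_space (euclidean :: 'a topology)"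
begin

lemma compact_neighbourhood:
  obtains U K :: "'a set" where "open U" "0 \<in> U" "U \<subseteq> K" "compact K"
proof -
  have "\<exists>U K. open U \<and> compact K \<and> (0::'a) \<in> U \<and> U \<subseteq> K"
    using lc unfolding locally_compact_space_def by simp
  then show ?thesis using that by blast
qed

text \<open>The compact set is chosen before e. Functionals on \<open>C_c\<close> are only bounded
  on each compact set separately, so small differences have to live on one fixed set. Uniformity in
  x is the tube lemma.\<close>

lemma small_left_translate:
  fixes \<psi> :: "'a \<Rightarrow> real"
  assumes "\<psi> \<in> C_c"
  obtains K where "compact K"
    "\<And>e. 0 < e \<Longrightarrow> \<forall>\<^sub>F t in nhds 0. \<forall>x. \<bar>\<psi> (t + x) - \<psi> x\<bar> \<le> e * indicator K x"
proof -
  obtain K where K: "compact K" "\<And>x. x \<notin> K \<Longrightarrow> \<psi> x = 0" and c: "continuous_on UNIV \<psi>"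
    using assms by (auto simp: C_c_def)
  obtain U V :: "'a set" where UV: "open U" "0 \<in> U" "U \<subseteq> V" "compact V" by (rule compact_neighbourhood)
  \<comment> \<open>With -V + K included, t in V and t + x in K force x into L; off L both values of
    \<psi> vanish.\<close>
  define L where "L = K \<union> (\<lambda>p. - fst p + snd p) ` (V \<times> K)"
  have "compact L"
    unfolding L_def using UV K
    by (intro compact_Un compact_continuous_image compact_Times) (auto intro!: continuous_intros)
  moreover have "\<forall>\<^sub>F t in nhds 0. \<forall>x. \<bar>\<psi> (t + x) - \<psi> x\<bar> \<le> e * indicator L x" if e: "0 < e" for e
  proof -
    define W where "W = {p. \<bar>\<psi> (fst p + snd p) - \<psi> (snd p)\<bar> < e}"
    have "open W" unfolding W_def
      by (intro open_Collect_less continuous_intros continuous_on_compose2[OF c]) auto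
    moreover have "{0} \<times> L \<subseteq> W" using e by (auto simp: W_def)
    ultimately have "\<exists>X. 0 \<in> X \<and> open X \<and> X \<times> L \<subseteq> W"
      by (rule Elementary_Topology.tube_lemma[OF \<open>compact L\<close>])
    then obtain X where X: "0 \<in> X" "open X" "X \<times> L \<subseteq> W" by auto
    have "\<forall>\<^sub>F t in nhds 0. t \<in> X \<inter> U"
      using X UV by (intro eventually_nhds_in_open) auto
    then show ?thesis
    proof eventually_elim
      case (elim t)
      show ?case
      proof
        fix x
        show "\<bar>\<psi> (t + x) - \<psi> x\<bar> \<le> e * indicator L x"
        proof (cases "x \<in> L")
          case True
          then have "(t, x) \<in> W" using X elim by auto
          then show ?thesis using True by (simp add: W_def)
        next
          case False
          have "t + x \<notin> K"
          proof
            assume "t + x \<in> K"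
            then have "- t + (t + x) \<in> L" unfolding L_def using elim UV by force
            then show False using False by simp
          qed
          moreover have "x \<notin> K" using False by (auto simp: L_def)
          ultimately show ?thesis using K(2) False by simp
        qed
      qed
    qed
  qed
  ultimately show ?thesis using that by blast
qed

lemma small_right_translate:
  fixes \<psi> :: "'a \<Rightarrow> real"
  assumes "\<psi> \<in> C_c"
  obtains K where "compact K"
    "\<And>e. 0 < e \<Longrightarrow> \<forall>\<^sub>F t in nhds 0. \<forall>x. \<bar>\<psi> (x + t) - \<psi> x\<bar> \<le> e * indicator K x"
proof -
  obtain K where K: "compact K"
    "\<And>e. 0 < e \<Longrightarrow> \<forall>\<^sub>F t in nhds 0. \<forall>x. \<bar>\<psi> (- (t + x)) - \<psi> (- x)\<bar> \<le> e * indicator K x"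
    using small_left_translate[OF C_c_uminus[OF assms]] by blast
  have "compact (uminus ` K)" by (intro compact_continuous_image K continuous_intros)
  moreover have "\<forall>\<^sub>F t in nhds 0. \<forall>x. \<bar>\<psi> (x + t) - \<psi> x\<bar> \<le> e * indicator (uminus ` K) x" if "0 < e" for e
  proof -
    have "\<forall>\<^sub>F t in nhds 0. \<forall>x. \<bar>\<psi> (- (- t + x)) - \<psi> (- x)\<bar> \<le> e * indicator K x"
      by (rule eventually_nhds_compose[where h=uminus]) (use K(2)[OF that] in \<open>auto intro!: continuous_intros\<close>)
    then show ?thesis
    proof eventually_elim
      case (elim t)
      show ?case
      proof
        fix x
        have "(indicator K (- x) :: real) = indicator (uminus ` K) x"
          by (auto simp: indicator_def image_iff)
        moreover have "- (- t + - x) = x + t" by (simp only: minus_add minus_minus)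
        ultimately show "\<bar>\<psi> (x + t) - \<psi> x\<bar> \<le> e * indicator (uminus ` K) x"
          using elim[rule_format, of "- x"] by (simp del: add_uminus_conv_diff)
      qed
    qed
  qed
  ultimately show ?thesis using that by blast
qed

lemma bump_function:
  fixes U :: "'a set"
  assumes "open U" "0 \<in> U"
  obtains \<phi> :: "'a \<Rightarrow> real" where "\<phi> \<in> C_c" "\<And>x. 0 \<le> \<phi> x" "\<phi> 0 = 1" "\<And>x. x \<notin> U \<Longrightarrow> \<phi> x = 0"
proof -
  obtain V K :: "'a set" where V: "open V" "0 \<in> V" "V \<subseteq> K" "compact K" by (rule compact_neighbourhood)
  have "Hausdorff_space (euclidean :: 'a topology)"
    unfolding Hausdorff_space_def using hausdorff by (simp add: disjnt_def) blast
  then have "completely_regular_space (euclidean :: 'a topology)"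
    using lc locally_compact_regular_imp_completely_regular_space by blast
  moreover have "openin euclidean (U \<inter> V)" "0 \<in> U \<inter> V" using V assms by auto
  ultimately obtain f :: "'a \<Rightarrow> real" where
    f: "continuous_map euclidean euclideanreal f" "f 0 = 0" "f ` (UNIV - U \<inter> V) \<subseteq> {1}"
    unfolding completely_regular_space_alt' topspace_euclidean by blast
  have cf: "continuous_on UNIV f" using f(1) by simp
  have f1: "f x = 1" if "x \<notin> U \<inter> V" for x using f(3) that by blast
  have f0: "f x = 1" if "x \<notin> K" for x using f1[of x] V that by auto
  show ?thesis
  proof (rule that[of "\<lambda>x. max 0 (1 - f x)"])
    show "(\<lambda>x. max 0 (1 - f x)) \<in> C_c"
      unfolding C_c_def mem_Collect_eq using V f0
      by (intro conjI exI[of _ K]) (auto intro!: continuous_intros cf)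
  qed (use f f1 in auto)
qed

text \<open>Finitely many translates of the open set where \<phi> exceeds \<phi>(0)/2 cover K, and
  the coefficient 2 C / \<phi>(0) lifts each of them above C. Applied to an indicator, this yields
  continuous majorants of compact sets.\<close>

lemma compact_support_dominated:
  fixes h \<phi> :: "'a \<Rightarrow> real"
  assumes \<phi>: "continuous_on UNIV \<phi>" "\<And>x. 0 \<le> \<phi> x" "0 < \<phi> 0"
    and K: "compact K" "\<And>x. x \<notin> K \<Longrightarrow> h x = 0" and h: "\<And>x. \<bar>h x\<bar> \<le> C"
  shows "h \<in> dominated_space top \<phi>"
proof -
  define U where "U y = {x. \<phi> 0 / 2 < \<phi> (- y + x)}" for y
  have opU: "open (U y)" for y unfolding U_def
    by (intro open_Collect_less continuous_intros continuous_on_compose2[OF \<phi>(1)]) auto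
  have "K \<subseteq> (\<Union>y\<in>K. U y)" using \<phi> by (auto simp: U_def)
  then obtain Y where Y: "finite Y" "K \<subseteq> (\<Union>y\<in>Y. U y)"
    by (rule compactE_image[OF K(1) opU])
  obtain ys where ys: "set ys = Y" using Y(1) finite_list by blast
  have C: "0 \<le> C" using h[of 0] by linarith
  define c where "c = C * 2 / \<phi> 0"
  have c: "0 \<le> c" using C \<phi>(3) by (simp add: c_def)
  define ts where "ts = map (\<lambda>y. (c, y)) ys"
  have nn: "0 \<le> c * ltrans y \<phi> x" for x y using c \<phi>(2) by (simp add: ltrans_def)
  have ts: "translate_sum ts \<phi> x = (\<Sum>y\<leftarrow>ys. c * ltrans y \<phi> x)" for x
    by (simp add: ts_def translate_sum_def o_def)
  have "\<bar>h x\<bar> \<le> translate_sum ts \<phi> x" for x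
  proof (cases "x \<in> K")
    case True
    then obtain y where y: "y \<in> set ys" "x \<in> U y" using Y ys by blast
    have "\<bar>h x\<bar> \<le> C" by (rule h)
    also have "C = c * (\<phi> 0 / 2)" using \<phi>(3) by (simp add: c_def)
    also have "\<dots> \<le> c * ltrans y \<phi> x"
      using y(2) c by (intro mult_left_mono) (auto simp: U_def ltrans_def)
    also have "\<dots> \<le> (\<Sum>y\<leftarrow>ys. c * ltrans y \<phi> x)"
      using y(1) nn by (intro member_le_sum_list) auto
    finally show ?thesis by (simp add: ts)
  next
    case False
    then show ?thesis using K(2) nn by (auto simp: ts intro!: sum_list_nonneg)
  qed
  then have "dominated_by top \<phi> (weight ts) h"
    unfolding dominated_by_def using c by (intro exI[of _ ts]) (auto simp: ts_def)
  then show ?thesis by (auto simp: dominated_space_def)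
qed

end

section \<open>Convolutions on a locally compact group\<close>

lemma L_inftyE:
  assumes "h \<in> L_infty"
  obtains C where "0 \<le> C" "\<And>x. \<bar>h x\<bar> \<le> C" "h \<in> borel_measurable borel"
proof -
  obtain C where "\<And>x. \<bar>h x\<bar> \<le> C" using assms by (auto simp: L_infty_def bounded_iff)
  then show ?thesis using that[of C] assms by (auto simp: L_infty_def intro: order_trans[OF abs_ge_zero])
qed

lemma L_inftyI:
  assumes "h \<in> borel_measurable borel" "\<And>x. \<bar>h x\<bar> \<le> C"
  shows "h \<in> L_infty"
  using assms by (auto simp: L_infty_def bounded_iff)

lemma L_infty_comb:
  assumes "h \<in> L_infty" "k \<in> L_infty"
  shows "(\<lambda>x. a * h x + b * k x) \<in> L_infty"
proof -
  obtain C where C: "\<And>x. \<bar>h x\<bar> \<le> C" "h \<in> borel_measurable borel" using assms(1) by (metis L_inftyE)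
  obtain D where D: "\<And>x. \<bar>k x\<bar> \<le> D" "k \<in> borel_measurable borel" using assms(2) by (metis L_inftyE)
  show ?thesis
  proof (rule L_inftyI)
    show "\<bar>a * h x + b * k x\<bar> \<le> \<bar>a\<bar> * C + \<bar>b\<bar> * D" for x
      using C(1)[of x] D(1)[of x] mult_left_mono[of "\<bar>h x\<bar>" C "\<bar>a\<bar>"] mult_left_mono[of "\<bar>k x\<bar>" D "\<bar>b\<bar>"]
        abs_triangle_ineq[of "a * h x" "b * k x"] by (simp add: abs_mult)
    show "(\<lambda>x. a * h x + b * k x) \<in> borel_measurable borel" using C(2) D(2) by measurable
  qed
qed

lemma L_infty_compose:
  assumes "h \<in> L_infty" "continuous_on UNIV T"
  shows "(\<lambda>x. h (T x)) \<in> L_infty"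
proof -
  have "(\<lambda>x. h (T x)) \<in> borel_measurable borel"
    using assms borel_measurable_continuous_onI[OF assms(2)]
    by (auto simp: L_infty_def intro: measurable_compose)
  moreover have "bounded (range (\<lambda>x. h (T x)))"
    using assms by (auto simp: L_infty_def intro: bounded_subset)
  ultimately show ?thesis by (simp add: L_infty_def)
qed

lemma L_infty_translates:
  fixes h :: "'a::topological_group_add \<Rightarrow> real"
  assumes "h \<in> L_infty"
  shows "ltrans g h \<in> L_infty" "(\<lambda>x. h (g + x)) \<in> L_infty" "(\<lambda>x. h (x + g)) \<in> L_infty"
    "(\<lambda>x. h (- x + g)) \<in> L_infty"
  unfolding ltrans_def
  by (rule L_infty_compose[OF assms]; intro continuous_intros)+

lemma bcontfun_L_infty: "h \<in> bcontfun \<Longrightarrow> h \<in> L_infty"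
  by (auto simp: bcontfun_def L_infty_def intro: borel_measurable_continuous_onI)

lemma function_space_L_infty: "function_space L_infty"
  by (rule function_spaceI) (rule L_infty_comb)

lemma translate_sum_L_infty:
  fixes h :: "'a::topological_group_add \<Rightarrow> real"
  shows "h \<in> L_infty \<Longrightarrow> translate_sum ts h \<in> L_infty"
  by (intro translate_sum_closed function_space_L_infty L_infty_translates)

section \<open>Haar measure and integration\<close>

locale haar_group =
  fixes m :: "'a::{topological_group_add, t2_space} measure"
  assumes locally_compact: "locally_compact_space (euclidean :: 'a topology)"
    and haar: "left_haar_measure m"

sublocale haar_group \<subseteq> lc_group "TYPE('a)"
  by unfold_locales (rule locally_compact)

context haar_group
begin

lemma sets_m [simp, measurable_cong]: "sets m = sets borel"
  using haar by (simp add: left_haar_measure_def)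

lemma space_m [simp]: "space m = UNIV"
  using sets_eq_imp_space_eq[OF sets_m] by simp

lemma measurable_translate [measurable]: "(\<lambda>x. g + x) \<in> measurable m m"
proof -
  have "(\<lambda>x::'a. g + x) \<in> measurable borel borel"
    by (intro borel_measurable_continuous_onI continuous_intros)
  then show ?thesis by (simp add: measurable_cong_sets[OF sets_m sets_m])
qed

lemma distr_translate: "distr m m (\<lambda>x. g + x) = m"
proof (rule measure_eqI)
  fix A assume A: "A \<in> sets (distr m m (\<lambda>x. g + x))"
  have "(\<lambda>x. g + x) -` A = (\<lambda>x. - g + x) ` A"
    by (force simp: image_iff add.assoc[symmetric])
  then show "emeasure (distr m m (\<lambda>x. g + x)) A = emeasure m A"
    using A haar by (simp add: emeasure_distr left_haar_measure_def)
qed simp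

lemma left_invariant_ae: "left_invariant_filter (ae_filter m)"
  unfolding left_invariant_filter_def
proof (intro allI impI)
  fix P g assume "eventually P (ae_filter m)"
  then have "AE x in distr m m (\<lambda>x. - g + x). P x" unfolding distr_translate .
  then show "AE x in m. P (- g + x)" by (rule AE_distrD[rotated]) (rule measurable_translate)
qed

lemma ae_translate:
  assumes "AE x in m. P x"
  shows "AE x in m. P (g + x)"
proof -
  have "AE x in m. P (- (- g) + x)"
    using left_invariant_ae assms unfolding left_invariant_filter_def by blast
  then show ?thesis by simp
qed

lemma integral_translate:
  fixes f :: "'a \<Rightarrow> real"
  assumes "f \<in> borel_measurable borel"
  shows "(\<integral>x. f (g + x) \<partial>m) = (\<integral>x. f x \<partial>m)"
  using integral_distr[of "\<lambda>x. g + x" m m f] assms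
  by (simp add: distr_translate measurable_cong_sets[OF sets_m refl])

lemma compact_sets: "compact (K :: 'a set) \<Longrightarrow> K \<in> sets m"
  using borel_compact by simp

lemma compact_finite: "compact (K :: 'a set) \<Longrightarrow> emeasure m K < \<infinity>"
  using haar by (simp add: left_haar_measure_def)

text \<open>Translates of a null open set would cover every compact set by finitely many null sets.
  Inner regularity of the open set \<open>UNIV\<close> would then make the whole measure
  zero.\<close>

lemma open_positive:
  assumes "open (U :: 'a set)" "U \<noteq> {}"
  shows "0 < emeasure m U"
proof (rule ccontr)
  assume "\<not> 0 < emeasure m U"
  then have U0: "emeasure m U = 0" by simp
  obtain a where a: "a \<in> U" using assms by blast
  have null: "emeasure m K = 0" if K: "compact K" for K :: "'a set"
  proof -
    define V where "V y = (\<lambda>x. (a - y) + x) -` U" for y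
    have opV: "open (V y)" for y unfolding V_def
      by (intro open_vimage assms continuous_intros)
    have "K \<subseteq> (\<Union>y\<in>K. V y)" using a by (auto simp: V_def)
    then obtain Y where Y: "finite Y" "K \<subseteq> (\<Union>y\<in>Y. V y)"
      by (rule compactE_image[OF K opV])
    have "V y \<in> null_sets m" for y
    proof -
      have "emeasure (distr m m (\<lambda>x. (a - y) + x)) U = emeasure m (V y)"
        unfolding V_def using assms by (subst emeasure_distr) (auto simp del: distr_translate)
      then show ?thesis using U0 opV by (simp add: distr_translate null_sets_def)
    qed
    then have "(\<Union>y\<in>Y. V y) \<in> null_sets m" using Y(1) by (intro null_sets_UN') (auto intro: countable_finite)
    then have "K \<in> null_sets m" using Y(2) compact_sets[OF K] by (metis null_sets_subset)
    then show ?thesis by (simp add: null_sets_def)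
  qed
  have "emeasure m UNIV = (SUP K\<in>{K. compact K \<and> K \<subseteq> UNIV}. emeasure m K)"
    using haar open_UNIV unfolding left_haar_measure_def by blast
  also have "\<dots> \<le> 0"
    using null by (intro SUP_least) auto
  finally have "emeasure m UNIV = 0" by simp
  then show False using haar by (simp add: left_haar_measure_def)
qed

lemma integrable_compact:
  fixes h :: "'a \<Rightarrow> real"
  assumes "compact K" "\<And>x. \<bar>h x\<bar> \<le> C * indicator K x" "h \<in> borel_measurable borel"
  shows "integrable m h" "\<bar>\<integral>x. h x \<partial>m\<bar> \<le> C * measure m K"
proof -
  have iK: "integrable m (\<lambda>x. C * indicator K x)"
    using compact_finite[OF assms(1)] compact_sets[OF assms(1)] by simp
  have meas: "h \<in> borel_measurable m" using assms(3) by (simp add: measurable_cong_sets[OF sets_m refl])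
  show int: "integrable m h"
    by (rule Bochner_Integration.integrable_bound[OF iK meas])
      (use assms(2) in \<open>auto intro: order_trans[OF _ abs_ge_self]\<close>)
  have "\<bar>\<integral>x. h x \<partial>m\<bar> \<le> (\<integral>x. \<bar>h x\<bar> \<partial>m)" by (rule integral_abs_bound)
  also have "\<dots> \<le> (\<integral>x. C * indicator K x \<partial>m)"
    using int iK assms(2) by (intro integral_mono) auto
  also have "\<dots> = C * measure m K" by simp
  finally show "\<bar>\<integral>x. h x \<partial>m\<bar> \<le> C * measure m K" .
qed

lemma integrable_product:
  assumes "\<psi> \<in> C_c" "h \<in> L_infty"
  shows "integrable m (\<lambda>x. h x * \<psi> x)"
proof -
  obtain K where K: "compact K" "\<And>x. x \<notin> K \<Longrightarrow> \<psi> x = 0" and c: "continuous_on UNIV \<psi>"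
    using assms by (auto simp: C_c_def)
  obtain C where C: "0 \<le> C" "\<And>x. \<bar>\<psi> x\<bar> \<le> C" using C_c_bounded[OF assms(1)] by blast
  obtain D where D: "0 \<le> D" "\<And>x. \<bar>h x\<bar> \<le> D" "h \<in> borel_measurable borel" using assms(2) by (metis L_inftyE)
  have [measurable]: "\<psi> \<in> borel_measurable borel" using c by (rule borel_measurable_continuous_onI)
  have [measurable]: "h \<in> borel_measurable borel" by (rule D)
  show ?thesis
  proof (rule integrable_compact(1)[OF K(1)])
    show "\<bar>h x * \<psi> x\<bar> \<le> (D * C) * indicator K x" for x
      using K(2)[of x] mult_mono[OF D(2)[of x] C(2)[of x]] D(1) by (cases "x \<in> K") (auto simp: abs_mult)
  qed measurable
qed

lemma C_c_L_infty:
  fixes \<psi> :: "'a \<Rightarrow> real"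
  assumes "\<psi> \<in> C_c" shows "\<psi> \<in> L_infty"
proof -
  obtain C where "\<And>x. \<bar>\<psi> x\<bar> \<le> C" using C_c_bounded[OF assms] by metis
  moreover have "continuous_on UNIV \<psi>" using assms by (simp add: C_c_def)
  ultimately show ?thesis by (intro L_inftyI borel_measurable_continuous_onI)
qed

lemma L_infty_const: "(\<lambda>x. c) \<in> L_infty"
  by (rule L_inftyI[of _ "\<bar>c\<bar>"]) auto

lemma integrable_C_c: "\<psi> \<in> C_c \<Longrightarrow> integrable m \<psi>"
  using integrable_product[OF _ L_infty_const[of 1]] by simp

lemma integral_positive:
  fixes \<psi> :: "'a \<Rightarrow> real"
  assumes "integrable m \<psi>" "continuous_on UNIV \<psi>" "\<And>x. 0 \<le> \<psi> x" "0 < \<psi> a"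
  shows "0 < (\<integral>x. \<psi> x \<partial>m)"
proof (rule ccontr)
  assume "\<not> ?thesis"
  moreover have "0 \<le> (\<integral>x. \<psi> x \<partial>m)" using assms by simp
  ultimately have "(\<integral>x. \<psi> x \<partial>m) = 0" by simp
  then have "AE x in m. \<psi> x = 0"
    using assms integral_nonneg_eq_0_iff_AE by blast
  moreover have "open {x. 0 < \<psi> x}"
    by (intro open_Collect_less assms continuous_intros)
  moreover have "{x. 0 < \<psi> x} \<in> sets m" using calculation(2) by simp
  ultimately have "emeasure m {x. 0 < \<psi> x} = 0"
    by (subst AE_iff_measurable[symmetric, where P = "\<lambda>x. \<psi> x \<le> 0"]) (auto elim!: eventually_mono)
  then show False using open_positive[OF \<open>open {x. 0 < \<psi> x}\<close>] assms(4) by auto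
qed

text \<open>This averages right translates of h; it is the convolution of h with the reflected
  kernel w \<mapsto> k(w^-1). It commutes with the action of G on h. In \<open>conv\<close>, the
  usual convolution of \<psi> and u, the action is carried by the left factor \<psi>
  instead.\<close>

definition rconv :: "('a \<Rightarrow> real) \<Rightarrow> ('a \<Rightarrow> real) \<Rightarrow> 'a \<Rightarrow> real" where
  "rconv k h x = (\<integral>w. h (x + w) * k w \<partial>m)"

definition conv :: "('a \<Rightarrow> real) \<Rightarrow> ('a \<Rightarrow> real) \<Rightarrow> 'a \<Rightarrow> real" where
  "conv \<psi> u x = (\<integral>y. u (- y + x) * \<psi> y \<partial>m)"

lemma integrable_rconv:
  "k \<in> C_c \<Longrightarrow> h \<in> L_infty \<Longrightarrow> integrable m (\<lambda>w. h (x + w) * k w)"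
  by (rule integrable_product[OF _ L_infty_translates(2)])

lemma integrable_conv:
  "\<psi> \<in> C_c \<Longrightarrow> u \<in> L_infty \<Longrightarrow> integrable m (\<lambda>y. u (- y + x) * \<psi> y)"
  by (rule integrable_product[OF _ L_infty_translates(4)])

lemma integral_product_bound:
  assumes "k \<in> C_c" "h \<in> L_infty" "\<And>x. \<bar>h x\<bar> \<le> C"
  shows "\<bar>\<integral>w. h w * k w \<partial>m\<bar> \<le> C * (\<integral>w. \<bar>k w\<bar> \<partial>m)"
proof -
  have ik: "integrable m (\<lambda>w. C * \<bar>k w\<bar>)"
    using integrable_C_c[OF assms(1)] by simp
  have "\<bar>\<integral>w. h w * k w \<partial>m\<bar> \<le> (\<integral>w. \<bar>h w * k w\<bar> \<partial>m)" by (rule integral_abs_bound)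
  also have "\<dots> \<le> (\<integral>w. C * \<bar>k w\<bar> \<partial>m)"
  proof (rule integral_mono[OF integrable_abs[OF integrable_product[OF assms(1,2)]] ik])
    show "\<bar>h w * k w\<bar> \<le> C * \<bar>k w\<bar>" for w
      using assms(3)[of w] by (simp add: abs_mult mult_right_mono)
  qed
  finally show ?thesis by simp
qed

lemma rconv_bound:
  assumes "k \<in> C_c" "h \<in> L_infty" "\<And>x. \<bar>h x\<bar> \<le> C"
  shows "\<bar>rconv k h x\<bar> \<le> C * (\<integral>w. \<bar>k w\<bar> \<partial>m)"
  unfolding rconv_def using assms
  by (intro integral_product_bound L_infty_translates) auto

lemma conv_bound:
  assumes "\<psi> \<in> C_c" "u \<in> L_infty" "\<And>x. \<bar>u x\<bar> \<le> C"
  shows "\<bar>conv \<psi> u x\<bar> \<le> C * (\<integral>w. \<bar>\<psi> w\<bar> \<partial>m)"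
  unfolding conv_def using assms
  by (intro integral_product_bound L_infty_translates) auto

lemma rconv_ltrans: "rconv k (ltrans g h) = ltrans g (rconv k h)"
  by (rule ext) (simp add: rconv_def ltrans_def add.assoc)

lemma rconv_comb:
  assumes "k \<in> C_c" "h \<in> L_infty" "h' \<in> L_infty"
  shows "rconv k (\<lambda>x. a * h x + b * h' x) x = a * rconv k h x + b * rconv k h' x"
proof -
  have "rconv k (\<lambda>x. a * h x + b * h' x) x = (\<integral>w. a * (h (x + w) * k w) + b * (h' (x + w) * k w) \<partial>m)"
    by (simp add: rconv_def algebra_simps)
  also have "\<dots> = a * rconv k h x + b * rconv k h' x"
    unfolding rconv_def using integrable_rconv assms by (subst Bochner_Integration.integral_add) auto
  finally show ?thesis .
qed

lemma conv_comb_right: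
  assumes "\<psi> \<in> C_c" "u \<in> L_infty" "v \<in> L_infty"
  shows "conv \<psi> (\<lambda>x. a * u x + b * v x) x = a * conv \<psi> u x + b * conv \<psi> v x"
proof -
  have "conv \<psi> (\<lambda>x. a * u x + b * v x) x = (\<integral>w. a * (u (- w + x) * \<psi> w) + b * (v (- w + x) * \<psi> w) \<partial>m)"
    by (simp add: conv_def algebra_simps)
  also have "\<dots> = a * conv \<psi> u x + b * conv \<psi> v x"
    unfolding conv_def using integrable_conv assms by (subst Bochner_Integration.integral_add) auto
  finally show ?thesis .
qed

lemma conv_comb_left:
  assumes "\<psi> \<in> C_c" "\<phi> \<in> C_c" "u \<in> L_infty"
  shows "conv (\<lambda>x. a * \<psi> x + b * \<phi> x) u x = a * conv \<psi> u x + b * conv \<phi> u x"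
proof -
  have "conv (\<lambda>x. a * \<psi> x + b * \<phi> x) u x = (\<integral>w. a * (u (- w + x) * \<psi> w) + b * (u (- w + x) * \<phi> w) \<partial>m)"
    by (simp add: conv_def algebra_simps)
  also have "\<dots> = a * conv \<psi> u x + b * conv \<phi> u x"
    unfolding conv_def using integrable_conv assms by (subst Bochner_Integration.integral_add) auto
  finally show ?thesis .
qed

lemma rconv_mono:
  assumes "k \<in> C_c" "\<And>x. 0 \<le> k x" "h \<in> L_infty" "h' \<in> L_infty"
    and "AE x in m. h x \<le> h' x"
  shows "rconv k h x \<le> rconv k h' x"
  unfolding rconv_def
proof (rule integral_mono_AE[OF integrable_rconv integrable_rconv])
  have "AE w in m. h (x + w) \<le> h' (x + w)" by (rule ae_translate[OF assms(5)])
  then show "AE w in m. h (x + w) * k w \<le> h' (x + w) * k w"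
    using assms(2) by (auto elim!: eventually_mono intro: mult_right_mono)
qed (use assms in auto)

lemma rconv_abs_le:
  assumes "k \<in> C_c" "\<And>x. 0 \<le> k x" "h \<in> L_infty" "h' \<in> L_infty"
    and ae: "AE x in m. \<bar>h x\<bar> \<le> h' x"
  shows "\<bar>rconv k h x\<bar> \<le> rconv k h' x"
proof -
  have m: "(\<lambda>x. (-1) * h x + 0 * h x) \<in> L_infty" by (rule L_infty_comb[OF assms(3,3)])
  have "rconv k h x \<le> rconv k h' x"
    using ae by (intro rconv_mono assms(1-4)) auto
  moreover have "rconv k (\<lambda>x. (-1) * h x + 0 * h x) x \<le> rconv k h' x"
    using ae by (intro rconv_mono assms(1-4) m) auto
  ultimately show ?thesis unfolding rconv_comb[OF assms(1,3,3)] by simp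
qed

lemma conv_abs_le:
  assumes "\<psi> \<in> C_c" "\<phi> \<in> C_c" "\<And>x. \<bar>\<psi> x\<bar> \<le> \<phi> x"
    and "u \<in> L_infty" "v \<in> L_infty" "\<And>x. \<bar>u x\<bar> \<le> v x"
  shows "\<bar>conv \<psi> u x\<bar> \<le> conv \<phi> v x"
proof -
  have "\<bar>conv \<psi> u x\<bar> \<le> (\<integral>y. \<bar>u (- y + x) * \<psi> y\<bar> \<partial>m)"
    unfolding conv_def by (rule integral_abs_bound)
  also have "\<dots> \<le> conv \<phi> v x"
    unfolding conv_def using assms
    by (intro integral_mono integrable_abs integrable_conv)
      (auto simp: abs_mult intro!: mult_mono intro: order_trans[OF abs_ge_zero])
  finally show ?thesis .
qed

lemma conv_ltrans: "h \<in> L_infty \<Longrightarrow> \<psi> \<in> C_c \<Longrightarrow> conv (ltrans g \<psi>) h = ltrans g (conv \<psi> h)"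
proof
  fix x assume h: "h \<in> L_infty" "\<psi> \<in> C_c"
  define F where "F y = h (- y + x) * \<psi> (- g + y)" for y
  have "(\<lambda>y. h (- y + x)) \<in> borel_measurable borel"
    using L_infty_translates(4)[OF h(1), of x] by (auto simp: L_infty_def)
  moreover have "(\<lambda>y. \<psi> (- g + y)) \<in> borel_measurable borel"
    using L_infty_translates(1)[OF C_c_L_infty[OF h(2)], of g] by (simp add: L_infty_def ltrans_def)
  ultimately have "F \<in> borel_measurable borel" unfolding F_def by measurable
  then have "(\<integral>y. F (g + y) \<partial>m) = (\<integral>y. F y \<partial>m)" by (rule integral_translate)
  then show "conv (ltrans g \<psi>) h x = ltrans g (conv \<psi> h) x"
    by (simp add: F_def conv_def ltrans_def minus_add_add add.assoc[symmetric])
qed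

text \<open>The neighbourhood is the same for all h with the bound C. This is essential because h is
  applied below at all translates x + w or -w + x simultaneously.\<close>

lemma kernel_perturbation:
  assumes k: "k \<in> C_c" and e: "0 < e"
  shows "\<forall>\<^sub>F t in nhds 0. \<forall>h\<in>L_infty. (\<forall>x. \<bar>h x\<bar> \<le> C) \<longrightarrow> \<bar>(\<integral>w. h w * k (t + w) \<partial>m) - (\<integral>w. h w * k w \<partial>m)\<bar> \<le> e"
proof -
  obtain K where K: "compact K"
    "\<And>e. 0 < e \<Longrightarrow> \<forall>\<^sub>F t in nhds 0. \<forall>x. \<bar>k (t + x) - k x\<bar> \<le> e * indicator K x"
    using small_left_translate[OF k] by blast
  \<comment> \<open>The two summands 1 keep c positive when C or the measure of K is 0.\<close>
  define c where "c = (\<bar>C\<bar> + 1) * (measure m K + 1)"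
  define d where "d = e / c"
  have c: "0 < c" unfolding c_def by (intro mult_pos_pos) (auto intro: add_nonneg_pos)
  have d: "0 < d" using e c by (simp add: d_def)
  show ?thesis
    using K(2)[OF d]
  proof eventually_elim
    case (elim t)
    show ?case
    proof (intro ballI impI)
      fix h :: "'a \<Rightarrow> real" assume h: "h \<in> L_infty" "\<forall>x. \<bar>h x\<bar> \<le> C"
      have C: "\<bar>h x\<bar> \<le> \<bar>C\<bar>" for x using h(2)[rule_format, of x] by linarith
      define F where "F w = h w * k (t + w) - h w * k w" for w
      have i: "integrable m (\<lambda>w. h w * k (t + w))" "integrable m (\<lambda>w. h w * k w)"
        by (intro integrable_product C_c_left k h)+
      have "F \<in> borel_measurable borel"
        using borel_measurable_integrable[OF Bochner_Integration.integrable_diff[OF i]]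
        by (simp add: F_def[abs_def] measurable_cong_sets[OF sets_m refl])
      moreover have "\<bar>F w\<bar> \<le> \<bar>C\<bar> * d * indicator K w" for w
        using mult_mono[OF C[of w] elim[rule_format, of w]]
        by (simp add: F_def right_diff_distrib[symmetric] abs_mult mult.assoc)
      ultimately have "\<bar>\<integral>w. F w \<partial>m\<bar> \<le> \<bar>C\<bar> * d * measure m K"
        by (intro integrable_compact(2)[OF K(1)])
      also have "\<dots> \<le> d * c" using d by (simp add: c_def algebra_simps)
      also have "\<dots> = e" using c by (simp add: d_def)
      finally show "\<bar>(\<integral>w. h w * k (t + w) \<partial>m) - (\<integral>w. h w * k w \<partial>m)\<bar> \<le> e"
        using Bochner_Integration.integral_diff[OF i] by (simp add: F_def)
    qed
  qed
qed

lemma conv_left_uniform: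
  assumes "\<psi> \<in> C_c" "u \<in> L_infty"
  shows "left_uniform (conv \<psi> u)"
  unfolding left_uniform_def
proof (intro allI impI)
  fix e :: real assume e: "0 < e"
  obtain C where C: "\<And>x. \<bar>u x\<bar> \<le> C" using assms(2) by (metis L_inftyE)
  have eq: "conv \<psi> u (t + x) = (\<integral>y. u (- y + x) * \<psi> (t + y) \<partial>m)" for t x
    using fun_cong[OF conv_ltrans[OF assms(2,1), of "- t"], of x] by (simp add: conv_def ltrans_def)
  show "\<forall>\<^sub>F t in nhds 0. \<forall>x. \<bar>conv \<psi> u (t + x) - conv \<psi> u x\<bar> \<le> e"
    using kernel_perturbation[OF assms(1) e, of C]
  proof eventually_elim
    case (elim t)
    then show ?case
      using L_infty_translates(4)[OF assms(2)] C unfolding eq by (simp add: conv_def)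
  qed
qed

text \<open>Left invariance of Haar measure moves the right perturbation of h to a left perturbation
  of the kernel, which is continuous with compact support even when h is only measurable.\<close>

lemma rconv_right_uniform:
  assumes "k \<in> C_c" "h \<in> L_infty"
  shows "right_uniform (rconv k h)"
  unfolding right_uniform_def
proof (intro allI impI)
  fix e :: real assume e: "0 < e"
  obtain C where C: "\<And>x. \<bar>h x\<bar> \<le> C" using assms(2) by (metis L_inftyE)
  have eq: "rconv k h (x + t) = (\<integral>w. h (x + w) * k (- t + w) \<partial>m)" for t x
  proof -
    define G where "G w = h (x + w) * k (- t + w)" for w
    have "G \<in> borel_measurable borel"
      using borel_measurable_integrable[OF integrable_rconv[OF C_c_left[OF assms(1)] assms(2)]]
      by (simp add: G_def[abs_def] measurable_cong_sets[OF sets_m refl])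
    then have "(\<integral>w. G (t + w) \<partial>m) = (\<integral>w. G w \<partial>m)" by (rule integral_translate)
    then show ?thesis by (simp add: rconv_def G_def add.assoc[symmetric])
  qed
  have "\<forall>\<^sub>F t in nhds 0. \<forall>h\<in>L_infty. (\<forall>x. \<bar>h x\<bar> \<le> C) \<longrightarrow> \<bar>(\<integral>w. h w * k (- t + w) \<partial>m) - (\<integral>w. h w * k w \<partial>m)\<bar> \<le> e"
    by (rule eventually_nhds_compose[where h=uminus])
      (use kernel_perturbation[OF assms(1) e, of C] in \<open>auto intro!: continuous_intros\<close>)
  then show "\<forall>\<^sub>F t in nhds 0. \<forall>x. \<bar>rconv k h (x + t) - rconv k h x\<bar> \<le> e"
  proof eventually_elim
    case (elim t)
    then show ?case
      using L_infty_translates(2)[OF assms(2)] C unfolding eq by (simp add: rconv_def)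
  qed
qed

lemma integral_product_diff_bound:
  assumes "k \<in> C_c" "h \<in> L_infty" "h' \<in> L_infty" "\<And>x. \<bar>h x - h' x\<bar> \<le> C"
  shows "\<bar>(\<integral>w. h w * k w \<partial>m) - (\<integral>w. h' w * k w \<partial>m)\<bar> \<le> C * (\<integral>w. \<bar>k w\<bar> \<partial>m)"
proof -
  have "(\<integral>w. h w * k w \<partial>m) - (\<integral>w. h' w * k w \<partial>m) = (\<integral>w. h w * k w - h' w * k w \<partial>m)"
    by (rule Bochner_Integration.integral_diff[symmetric]) (intro integrable_product assms)+
  also have "\<dots> = (\<integral>w. (1 * h w + (-1) * h' w) * k w \<partial>m)"
    by (simp add: algebra_simps)
  also have "\<bar>\<dots>\<bar> \<le> C * (\<integral>w. \<bar>k w\<bar> \<partial>m)"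
    using assms by (intro integral_product_bound L_infty_comb) auto
  finally show ?thesis .
qed

lemma function_perturbation:
  assumes k: "k \<in> C_c" and e: "0 < e"
  obtains d where "0 < d" "\<And>h h'. h \<in> L_infty \<Longrightarrow> h' \<in> L_infty \<Longrightarrow> (\<And>x. \<bar>h x - h' x\<bar> \<le> d) \<Longrightarrow>
    \<bar>(\<integral>w. h w * k w \<partial>m) - (\<integral>w. h' w * k w \<partial>m)\<bar> \<le> e"
proof
  define A where "A = (\<integral>w. \<bar>k w\<bar> \<partial>m)"
  have A: "0 < A + 1" unfolding A_def by (intro add_nonneg_pos integral_nonneg) auto
  then show "0 < e / (A + 1)" using e by simp
  fix h h' :: "'a \<Rightarrow> real"
  assume "h \<in> L_infty" "h' \<in> L_infty" "\<And>x. \<bar>h x - h' x\<bar> \<le> e / (A + 1)"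
  then have "\<bar>(\<integral>w. h w * k w \<partial>m) - (\<integral>w. h' w * k w \<partial>m)\<bar> \<le> e / (A + 1) * A"
    unfolding A_def by (rule integral_product_diff_bound[OF k])
  also have "\<dots> \<le> e" using e A by (simp add: field_simps)
  finally show "\<bar>(\<integral>w. h w * k w \<partial>m) - (\<integral>w. h' w * k w \<partial>m)\<bar> \<le> e" .
qed

text \<open>A left perturbation of h passes straight through the integral. Together with the gain on
  the right, this makes the smoothing of a left uniform function uniform on both sides;
  \<open>conv_right_uniform\<close> is the mirror statement.\<close>

lemma rconv_left_uniform:
  assumes k: "k \<in> C_c" and h: "h \<in> L_infty" "left_uniform h"
  shows "left_uniform (rconv k h)"
  unfolding left_uniform_def
proof (intro allI impI)
  fix e :: real assume "0 < e"
  from function_perturbation[OF k this] obtain d where d: "0 < d"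
    "\<And>h h'. h \<in> L_infty \<Longrightarrow> h' \<in> L_infty \<Longrightarrow> (\<And>x. \<bar>h x - h' x\<bar> \<le> d) \<Longrightarrow>
      \<bar>(\<integral>w. h w * k w \<partial>m) - (\<integral>w. h' w * k w \<partial>m)\<bar> \<le> e" by blast
  have "\<forall>\<^sub>F t in nhds 0. \<forall>x. \<bar>h (t + x) - h x\<bar> \<le> d" using h(2) d(1) by (simp add: left_uniform_def)
  then show "\<forall>\<^sub>F t in nhds 0. \<forall>x. \<bar>rconv k h (t + x) - rconv k h x\<bar> \<le> e"
    by eventually_elim (auto simp: rconv_def add.assoc intro!: d(2) L_infty_translates h)
qed

lemma conv_right_uniform:
  assumes \<psi>: "\<psi> \<in> C_c" and u: "u \<in> L_infty" "right_uniform u"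
  shows "right_uniform (conv \<psi> u)"
  unfolding right_uniform_def
proof (intro allI impI)
  fix e :: real assume "0 < e"
  from function_perturbation[OF \<psi> this] obtain d where d: "0 < d"
    "\<And>h h'. h \<in> L_infty \<Longrightarrow> h' \<in> L_infty \<Longrightarrow> (\<And>x. \<bar>h x - h' x\<bar> \<le> d) \<Longrightarrow>
      \<bar>(\<integral>w. h w * \<psi> w \<partial>m) - (\<integral>w. h' w * \<psi> w \<partial>m)\<bar> \<le> e" by blast
  have "\<forall>\<^sub>F t in nhds 0. \<forall>x. \<bar>u (x + t) - u x\<bar> \<le> d" using u(2) d(1) by (simp add: right_uniform_def)
  then show "\<forall>\<^sub>F t in nhds 0. \<forall>x. \<bar>conv \<psi> u (x + t) - conv \<psi> u x\<bar> \<le> e"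
    by eventually_elim (auto simp: conv_def add.assoc[symmetric] intro!: d(2) L_infty_translates u)
qed

lemma rconv_L_infty:
  assumes "k \<in> C_c" "h \<in> L_infty"
  shows "rconv k h \<in> L_infty"
proof -
  obtain C where C: "\<And>x. \<bar>h x\<bar> \<le> C" using assms(2) by (metis L_inftyE)
  show ?thesis
    by (rule L_inftyI[OF _ rconv_bound[OF assms C]])
      (intro borel_measurable_continuous_onI right_uniform_imp_continuous rconv_right_uniform assms)
qed

lemma conv_L_infty:
  assumes "\<psi> \<in> C_c" "u \<in> L_infty"
  shows "conv \<psi> u \<in> L_infty"
proof -
  obtain C where C: "\<And>x. \<bar>u x\<bar> \<le> C" using assms(2) by (metis L_inftyE)
  show ?thesis
    by (rule L_inftyI[OF _ conv_bound[OF assms C]])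
      (intro borel_measurable_continuous_onI left_uniform_imp_continuous conv_left_uniform assms)
qed

lemma rconv_translate_sum:
  assumes k: "k \<in> C_c" and h: "h \<in> L_infty"
  shows "rconv k (translate_sum ts h) = translate_sum ts (rconv k h)"
proof
  fix x
  have "linear_functional L_infty (\<lambda>h. rconv k h x)" by (intro linear_functionalI rconv_comb k)
  from linear_functional_translate_sum[OF this function_space_L_infty L_infty_translates(1)[OF h]]
  show "rconv k (translate_sum ts h) x = translate_sum ts (rconv k h) x"
    by (simp add: translate_sum_def rconv_ltrans)
qed

end

section \<open>Uniqueness of invariant functionals on compactly supported functions\<close>

lemma C_c_translate_sum:
  fixes \<phi> :: "'a::{topological_group_add, t2_space} \<Rightarrow> real"
  shows "\<phi> \<in> C_c \<Longrightarrow> translate_sum ts \<phi> \<in> C_c"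
  by (intro translate_sum_closed function_space_C_c C_c_ltrans)

context haar_group
begin

text \<open>The convolution is an integral of translates of \<phi> with density \<psi>. A partition
  of unity on K, subordinate to small translates of W, turns it into a Riemann sum whose nodes are
  the points of Y.\<close>

lemma approx_by_translates_near:
  assumes \<psi>: "\<psi> \<in> C_c" "\<And>x. x \<notin> K \<Longrightarrow> \<psi> x = 0" "compact K"
    and \<phi>: "\<phi> \<in> C_c" and d: "0 < d"
  obtains Y c where "finite Y" "Y \<subseteq> K"
    "\<And>x. \<bar>conv \<psi> \<phi> x - (\<Sum>t\<in>Y. c t * ltrans t \<phi> x)\<bar> \<le> d"
proof -
  define A where "A = (\<integral>y. \<bar>\<psi> y\<bar> \<partial>m)"
  have A: "0 \<le> A" unfolding A_def by simp
  have [measurable]: "\<psi> \<in> borel_measurable borel" and psiL: "\<psi> \<in> L_infty"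
    using C_c_L_infty[OF \<psi>(1)] by (auto simp: L_infty_def)
  define \<eta> where "\<eta> = d / (A + 1)"
  have \<eta>: "0 < \<eta>" using A d by (simp add: \<eta>_def)
  obtain L where L: "compact L"
    "\<And>e. 0 < e \<Longrightarrow> \<forall>\<^sub>F t in nhds 0. \<forall>x. \<bar>\<phi> (t + x) - \<phi> x\<bar> \<le> e * indicator L x"
    using small_left_translate[OF \<phi>] by blast
  have "\<forall>\<^sub>F t in nhds 0. \<forall>x. \<bar>\<phi> (- t + x) - \<phi> x\<bar> \<le> \<eta> * indicator L x"
    by (rule eventually_nhds_compose[where h=uminus]) (use L(2)[OF \<eta>] in \<open>auto intro!: continuous_intros\<close>)
  then obtain W where W: "open W" "0 \<in> W"
    "\<And>t x. t \<in> W \<Longrightarrow> \<bar>\<phi> (- t + x) - \<phi> x\<bar> \<le> \<eta> * indicator L x"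
    unfolding eventually_nhds by blast
  have W': "\<bar>\<phi> (- t + x) - \<phi> x\<bar> \<le> \<eta>" if "t \<in> W" for t x
    using W(3)[OF that, of x] \<eta> by (cases "x \<in> L") auto
  obtain q :: "'a \<Rightarrow> real" where q: "q \<in> C_c" "\<And>x. 0 \<le> q x" "q 0 = 1" "\<And>x. x \<notin> W \<Longrightarrow> q x = 0"
    using bump_function[OF W(1,2)] by blast
  have qc: "continuous_on UNIV q" using q(1) by (simp add: C_c_def)
  define B where "B t = {y. 0 < q (- t + y)}" for t
  have "open (B t)" for t unfolding B_def
    by (intro open_Collect_less continuous_intros continuous_on_compose2[OF qc]) auto
  moreover have "K \<subseteq> (\<Union>t\<in>K. B t)" using q(3) by (auto simp: B_def)
  ultimately obtain Y where Y: "Y \<subseteq> K" "finite Y" "K \<subseteq> (\<Union>t\<in>Y. B t)"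
    using compactE_image[OF \<psi>(3), of K B] by metis
  define S where "S y = (\<Sum>t\<in>Y. q (- t + y))" for y
  \<comment> \<open>Outside K the sum S may be 0, and then all quotients are 0. Thus the p t add up
    to 1 on K and to at most 1 elsewhere, where \<psi> vanishes.\<close>
  define p where "p t y = q (- t + y) / S y" for t y
  have S0: "0 \<le> S y" for y unfolding S_def by (intro sum_nonneg q)
  have SK: "0 < S y" if yK: "y \<in> K" for y
  proof -
    obtain t where "t \<in> Y" "y \<in> B t" using Y yK by blast
    then have "t \<in> Y" "0 < q (- t + y)" by (auto simp: B_def)
    then show ?thesis unfolding S_def using Y(2) q(2) by (intro sum_pos2[of Y t]) auto
  qed
  have p0: "0 \<le> p t y" for t y using q(2) S0 by (simp add: p_def)
  have p1: "(\<Sum>t\<in>Y. p t y) = 1" if "y \<in> K" for y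
    using SK[OF that] by (simp add: p_def sum_divide_distrib[symmetric] S_def[symmetric])
  have p2: "(\<Sum>t\<in>Y. p t y) \<le> 1" for y
    by (simp add: p_def sum_divide_distrib[symmetric] S_def[symmetric] divide_le_eq_1)
  have ple: "p t y \<le> 1" if "t \<in> Y" for t y
    using p2[of y] member_le_sum[of t Y "\<lambda>t. p t y"] that p0 Y(2) by fastforce
  have qm [measurable]: "(\<lambda>y. q (- t + y)) \<in> borel_measurable borel" for t
    using L_infty_translates(2)[OF C_c_L_infty[OF q(1)], of "- t"] by (simp add: L_infty_def)
  have pm [measurable]: "p t \<in> borel_measurable borel" for t
    unfolding p_def S_def by measurable
  have pL: "p t \<in> L_infty" if "t \<in> Y" for t
    by (rule L_inftyI[OF pm, of t 1]) (use p0 ple that in auto)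
  have intp: "integrable m (\<lambda>y. p t y * \<psi> y)" if "t \<in> Y" for t
    by (rule integrable_product[OF \<psi>(1) pL[OF that]])
  define c where "c t = (\<integral>y. p t y * \<psi> y \<partial>m)" for t
  have main: "\<bar>conv \<psi> \<phi> x - (\<Sum>t\<in>Y. c t * ltrans t \<phi> x)\<bar> \<le> d" for x
  proof -
    have i1: "integrable m (\<lambda>y. \<phi> (- y + x) * \<psi> y)"
      by (rule integrable_conv[OF \<psi>(1) C_c_L_infty[OF \<phi>]])
    have i2: "integrable m (\<lambda>y. \<Sum>t\<in>Y. ltrans t \<phi> x * (p t y * \<psi> y))"
      by (intro Bochner_Integration.integrable_sum integrable_mult_right intp)
    have "(\<Sum>t\<in>Y. c t * ltrans t \<phi> x) = (\<integral>y. (\<Sum>t\<in>Y. ltrans t \<phi> x * (p t y * \<psi> y)) \<partial>m)"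
      using intp by (subst Bochner_Integration.integral_sum) (auto simp: c_def mult.commute)
    then have "conv \<psi> \<phi> x - (\<Sum>t\<in>Y. c t * ltrans t \<phi> x)
      = (\<integral>y. \<phi> (- y + x) * \<psi> y - (\<Sum>t\<in>Y. ltrans t \<phi> x * (p t y * \<psi> y)) \<partial>m)"
      using Bochner_Integration.integral_diff[OF i1 i2] by (simp add: conv_def)
    also have "\<bar>\<dots>\<bar> \<le> (\<integral>y. \<bar>\<phi> (- y + x) * \<psi> y - (\<Sum>t\<in>Y. ltrans t \<phi> x * (p t y * \<psi> y))\<bar> \<partial>m)"
      by (rule integral_abs_bound)
    also have "\<dots> \<le> (\<integral>y. \<eta> * \<bar>\<psi> y\<bar> \<partial>m)"
    proof (rule integral_mono)
      show "integrable m (\<lambda>y. \<bar>\<phi> (- y + x) * \<psi> y - (\<Sum>t\<in>Y. ltrans t \<phi> x * (p t y * \<psi> y))\<bar>)"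
        by (intro integrable_abs Bochner_Integration.integrable_diff i1 i2)
      show "integrable m (\<lambda>y. \<eta> * \<bar>\<psi> y\<bar>)"
        using integrable_C_c[OF \<psi>(1)] by simp
      fix y
      show "\<bar>\<phi> (- y + x) * \<psi> y - (\<Sum>t\<in>Y. ltrans t \<phi> x * (p t y * \<psi> y))\<bar> \<le> \<eta> * \<bar>\<psi> y\<bar>"
      proof (cases "y \<in> K")
        case False
        then show ?thesis using \<psi>(2) by simp
      next
        case True
        \<comment> \<open>Where p t is not 0, y is close to the node t, and the two translates of
          \<phi> differ by at most \<eta>; elsewhere both sides vanish.\<close>
        have near: "\<bar>\<phi> (- y + x) - ltrans t \<phi> x\<bar> * p t y \<le> \<eta> * p t y" for t
        proof (cases "- t + y \<in> W")
          case True
          have "- (- t + y) + (- t + x) = - y + x" by (simp add: minus_add add.assoc[symmetric])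
          then show ?thesis using W'[OF True, of "- t + x"] p0
            by (intro mult_right_mono) (auto simp: ltrans_def)
        next
          case False
          then show ?thesis using q(4) by (simp add: p_def)
        qed
        have "\<phi> (- y + x) * \<psi> y = (\<Sum>t\<in>Y. \<phi> (- y + x) * (p t y * \<psi> y))"
          using p1[OF True] by (simp add: sum_distrib_left[symmetric] sum_distrib_right[symmetric])
        then have "\<phi> (- y + x) * \<psi> y - (\<Sum>t\<in>Y. ltrans t \<phi> x * (p t y * \<psi> y))
          = (\<Sum>t\<in>Y. (\<phi> (- y + x) - ltrans t \<phi> x) * p t y) * \<psi> y"
          by (simp only: sum_subtractf[symmetric] sum_distrib_right left_diff_distrib mult.assoc)
        also have "\<bar>\<dots>\<bar> = \<bar>\<Sum>t\<in>Y. (\<phi> (- y + x) - ltrans t \<phi> x) * p t y\<bar> * \<bar>\<psi> y\<bar>"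
          by (rule abs_mult)
        also have "\<dots> \<le> \<eta> * \<bar>\<psi> y\<bar>"
        proof (rule mult_right_mono)
          have "\<bar>\<Sum>t\<in>Y. (\<phi> (- y + x) - ltrans t \<phi> x) * p t y\<bar>
              \<le> (\<Sum>t\<in>Y. \<bar>(\<phi> (- y + x) - ltrans t \<phi> x) * p t y\<bar>)" by (rule sum_abs)
          also have "\<dots> \<le> (\<Sum>t\<in>Y. \<eta> * p t y)"
            using near p0 by (intro sum_mono) (simp add: abs_mult)
          also have "\<dots> = \<eta>" using p1[OF True] by (simp add: sum_distrib_left[symmetric])
          finally show "\<bar>\<Sum>t\<in>Y. (\<phi> (- y + x) - ltrans t \<phi> x) * p t y\<bar> \<le> \<eta>" .
        qed simp
        finally show ?thesis .
      qed
    qed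
    also have "\<dots> = \<eta> * A" by (simp add: A_def)
    also have "\<dots> \<le> d" using A d by (simp add: \<eta>_def field_simps)
    finally show ?thesis .
  qed
  show ?thesis by (rule that[OF Y(2,1) main])
qed

text \<open>The bump is not normalized. By left invariance the mass of y \<mapsto> \<phi>(-y + x)
  does not depend on x, and it is the integral of the reflected \<phi>; on its support \<psi>(y) is
  within e of \<psi>(x).\<close>

lemma conv_approx_identity:
  assumes \<psi>: "\<psi> \<in> C_c" and \<phi>: "\<phi> \<in> C_c" "\<And>x. 0 \<le> \<phi> x"
    and V: "\<And>x. x \<notin> V \<Longrightarrow> \<phi> x = 0" "\<And>t x. t \<in> V \<Longrightarrow> \<bar>\<psi> (x + - t) - \<psi> x\<bar> \<le> e"
  shows "\<bar>conv \<psi> \<phi> x - (\<integral>y. \<phi> (- y) \<partial>m) * \<psi> x\<bar> \<le> e * (\<integral>y. \<phi> (- y) \<partial>m)"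
proof -
  have pL: "\<phi> \<in> L_infty" by (rule C_c_L_infty[OF \<phi>(1)])
  have cs: "(\<lambda>y. \<phi> (- y + x)) \<in> C_c"
    using C_c_uminus[OF C_c_right[OF \<phi>(1)]] by simp
  have I: "(\<integral>y. \<phi> (- y + x) \<partial>m) = (\<integral>y. \<phi> (- y) \<partial>m)"
  proof -
    have "(\<lambda>y. \<phi> (- y)) \<in> borel_measurable borel"
      using L_infty_translates(4)[OF pL, of 0] by (simp add: L_infty_def)
    then have "(\<integral>y. \<phi> (- (- x + y)) \<partial>m) = (\<integral>y. \<phi> (- y) \<partial>m)" by (rule integral_translate)
    then show ?thesis by (simp add: minus_add)
  qed
  have i1: "integrable m (\<lambda>y. \<phi> (- y + x) * \<psi> y)" by (rule integrable_conv[OF \<psi> pL])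
  have i2: "integrable m (\<lambda>y. \<phi> (- y + x))" by (rule integrable_C_c[OF cs])
  have "conv \<psi> \<phi> x - (\<integral>y. \<phi> (- y) \<partial>m) * \<psi> x = (\<integral>y. \<phi> (- y + x) * \<psi> y - \<phi> (- y + x) * \<psi> x \<partial>m)"
    unfolding conv_def I[symmetric] using i1 i2
    by (subst Bochner_Integration.integral_diff) auto
  also have "\<bar>\<dots>\<bar> \<le> (\<integral>y. \<bar>\<phi> (- y + x) * \<psi> y - \<phi> (- y + x) * \<psi> x\<bar> \<partial>m)"
    by (rule integral_abs_bound)
  also have "\<dots> \<le> (\<integral>y. e * \<phi> (- y + x) \<partial>m)"
  proof (rule integral_mono)
    show "integrable m (\<lambda>y. \<bar>\<phi> (- y + x) * \<psi> y - \<phi> (- y + x) * \<psi> x\<bar>)"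
      using i1 i2 by (intro integrable_abs Bochner_Integration.integrable_diff) auto
    show "integrable m (\<lambda>y. e * \<phi> (- y + x))" using i2 by simp
    fix y
    show "\<bar>\<phi> (- y + x) * \<psi> y - \<phi> (- y + x) * \<psi> x\<bar> \<le> e * \<phi> (- y + x)"
    proof (cases "- y + x \<in> V")
      case True
      have "x + - (- y + x) = y" by (simp add: minus_add add.assoc[symmetric])
      then have "\<bar>\<psi> y - \<psi> x\<bar> \<le> e" using V(2)[OF True, of x] by simp
      then have "\<phi> (- y + x) * \<bar>\<psi> y - \<psi> x\<bar> \<le> \<phi> (- y + x) * e"
        using \<phi>(2) by (intro mult_left_mono) auto
      then show ?thesis using \<phi>(2)[of "- y + x"]
        by (simp add: right_diff_distrib[symmetric] abs_mult mult.commute[of e])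
    next
      case False
      then show ?thesis using V(1) by simp
    qed
  qed
  also have "\<dots> = e * (\<integral>y. \<phi> (- y) \<partial>m)" by (simp add: I)
  finally show ?thesis .
qed

definition bump_in :: "'a set \<Rightarrow> ('a \<Rightarrow> real) \<Rightarrow> bool" where
  "bump_in V \<phi> \<longleftrightarrow> \<phi> \<in> C_c \<and> (\<forall>x. 0 \<le> \<phi> x) \<and> 0 < \<phi> 0 \<and> (\<forall>x. x \<notin> V \<longrightarrow> \<phi> x = 0)"

definition approximated_on :: "'a set \<Rightarrow> real \<Rightarrow> ('a \<Rightarrow> real) \<Rightarrow> ('a \<Rightarrow> real) \<Rightarrow> bool" where
  "approximated_on K e \<psi> \<phi> \<longleftrightarrow> (\<exists>ts. \<forall>x. \<bar>\<psi> x - translate_sum ts \<phi> x\<bar> \<le> e * indicator K x)"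

text \<open>With c' the mass of the reflected bump, \<psi> is close to the convolution of \<psi> and
  \<phi> divided by c', and this is close to a combination of translates of \<phi>; each step costs
  e/2. Every bump in V works, so that two functions can be approximated by translates of the same
  bump.\<close>

lemma approx_by_translates:
  assumes \<psi>: "\<psi> \<in> C_c"
  shows "\<exists>K. compact K \<and>
    (\<forall>e>0. \<exists>V. open V \<and> 0 \<in> V \<and> (\<forall>\<phi>. bump_in V \<phi> \<longrightarrow> approximated_on K e \<psi> \<phi>))"
proof -
  obtain K0 where K0: "compact K0" "\<And>x. x \<notin> K0 \<Longrightarrow> \<psi> x = 0"
    using \<psi> by (auto simp: C_c_def)
  obtain U N :: "'a set" where U: "open U" "0 \<in> U" "U \<subseteq> N" "compact N" by (rule compact_neighbourhood)
  \<comment> \<open>The nodes lie in K0 and the bump in N, so all errors are supported in one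
    compact set that depends neither on e nor on \<phi>.\<close>
  define K where "K = K0 \<union> (\<lambda>p. fst p + snd p) ` (K0 \<times> N)"
  have "compact K" unfolding K_def using U K0
    by (intro compact_Un compact_continuous_image compact_Times) (auto intro!: continuous_intros)
  obtain L where L: "compact L"
    "\<And>e. 0 < e \<Longrightarrow> \<forall>\<^sub>F t in nhds 0. \<forall>x. \<bar>\<psi> (x + t) - \<psi> x\<bar> \<le> e * indicator L x"
    using small_right_translate[OF \<psi>] by blast
  have "\<exists>V. open V \<and> 0 \<in> V \<and> (\<forall>\<phi>. bump_in V \<phi> \<longrightarrow> approximated_on K e \<psi> \<phi>)"
    if e: "0 < e" for e
  proof -
    have e2: "0 < e / 2" using e by simp
    have "\<forall>\<^sub>F t in nhds 0. \<forall>x. \<bar>\<psi> (x + - t) - \<psi> x\<bar> \<le> e / 2 * indicator L x"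
      by (rule eventually_nhds_compose[where h=uminus]) (use L(2)[OF e2] in \<open>auto intro!: continuous_intros\<close>)
    then obtain V0 where V0: "open V0" "0 \<in> V0"
      "\<And>t x. t \<in> V0 \<Longrightarrow> \<bar>\<psi> (x + - t) - \<psi> x\<bar> \<le> e / 2 * indicator L x"
      unfolding eventually_nhds by blast
    have V0': "\<bar>\<psi> (x + - t) - \<psi> x\<bar> \<le> e / 2" if "t \<in> V0" for t x
      using V0(3)[OF that, of x] e by (cases "x \<in> L") auto
    define V where "V = V0 \<inter> U"
    have "approximated_on K e \<psi> \<phi>" if "bump_in V \<phi>" for \<phi>
    proof -
      have \<phi>: "\<phi> \<in> C_c" "\<And>x. 0 \<le> \<phi> x" "0 < \<phi> 0" "\<And>x. x \<notin> V \<Longrightarrow> \<phi> x = 0"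
        using that by (auto simp: bump_in_def)
      define c' where "c' = (\<integral>y. \<phi> (- y) \<partial>m)"
      have csm: "(\<lambda>y. \<phi> (- y)) \<in> C_c" by (rule C_c_uminus[OF \<phi>(1)])
      have c': "0 < c'" unfolding c'_def
        by (rule integral_positive[OF integrable_C_c[OF csm], of 0])
          (use csm \<phi> in \<open>auto simp: C_c_def\<close>)
      have d: "0 < e / 2 * c'" using e c' by simp
      obtain Y c where Y: "finite Y" "Y \<subseteq> K0"
        "\<And>x. \<bar>conv \<psi> \<phi> x - (\<Sum>t\<in>Y. c t * ltrans t \<phi> x)\<bar> \<le> e / 2 * c'"
        using approx_by_translates_near[OF \<psi> K0(2) K0(1) \<phi>(1) d] by metis
      obtain ys where ys: "distinct ys" "set ys = Y" using Y(1) finite_distinct_list by blast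
      define ts where "ts = map (\<lambda>t. (c t / c', t)) ys"
      have ts: "translate_sum ts \<phi> x = (\<Sum>t\<in>Y. c t * ltrans t \<phi> x) / c'" for x
        using ys by (simp add: ts_def translate_sum_def o_def sum_list_distinct_conv_sum_set sum_divide_distrib)
      have "\<bar>\<psi> x - translate_sum ts \<phi> x\<bar> \<le> e * indicator K x" for x
      proof (cases "x \<in> K")
        case False
        have "ltrans t \<phi> x = 0" if "t \<in> Y" for t
        proof (rule ccontr)
          assume "ltrans t \<phi> x \<noteq> 0"
          then have "- t + x \<in> N" using \<phi>(4)[of "- t + x"] U(3) by (auto simp: ltrans_def V_def)
          then have "t + (- t + x) \<in> K" unfolding K_def using that Y(2) by force
          then show False using False by simp
        qed
        moreover have "\<psi> x = 0" using False K0(2) by (auto simp: K_def)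
        ultimately show ?thesis using e by (simp add: ts)
      next
        case True
        have "\<bar>conv \<psi> \<phi> x - c' * \<psi> x\<bar> \<le> e / 2 * c'"
          unfolding c'_def using \<phi> V0'
          by (intro conv_approx_identity[where V=V] \<psi>) (auto simp: V_def)
        then have "\<bar>c' * \<psi> x - (\<Sum>t\<in>Y. c t * ltrans t \<phi> x)\<bar> \<le> e * c'"
          using Y(3)[of x] by linarith
        moreover have "c' * \<psi> x - (\<Sum>t\<in>Y. c t * ltrans t \<phi> x) = c' * (\<psi> x - translate_sum ts \<phi> x)"
          using c' by (simp add: ts right_diff_distrib)
        ultimately have "c' * \<bar>\<psi> x - translate_sum ts \<phi> x\<bar> \<le> c' * e"
          using c' by (simp add: abs_mult mult.commute)
        then show ?thesis using c' True by simp
      qed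
      then show ?thesis unfolding approximated_on_def by blast
    qed
    moreover have "open V" "0 \<in> V" using V0 U by (auto simp: V_def)
    ultimately show ?thesis by blast
  qed
  then show ?thesis using \<open>compact K\<close> by blast
qed

text \<open>A left invariant real Radon measure that may be signed. Boundedness on each compact set
  replaces positivity, because the functionals of interest come from smoothed functions without a
  fixed sign.\<close>

definition locally_bounded_functional :: "(('a \<Rightarrow> real) \<Rightarrow> real) \<Rightarrow> bool" where
  "locally_bounded_functional \<Lambda> \<longleftrightarrow>
     linear_functional C_c \<Lambda> \<and>
     (\<forall>g \<phi>. \<phi> \<in> C_c \<longrightarrow> \<Lambda> (ltrans g \<phi>) = \<Lambda> \<phi>) \<and>
     (\<forall>K. compact K \<longrightarrow> (\<exists>C. \<forall>\<psi> e. \<psi> \<in> C_c \<longrightarrow> 0 < e \<longrightarrow>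
        (\<forall>x. \<bar>\<psi> x\<bar> \<le> e * indicator K x) \<longrightarrow> \<bar>\<Lambda> \<psi>\<bar> \<le> C * e))"

lemma
  assumes "locally_bounded_functional \<Lambda>"
  shows locally_bounded_functional_linear: "linear_functional C_c \<Lambda>"
    and locally_bounded_functional_ltrans: "\<phi> \<in> C_c \<Longrightarrow> \<Lambda> (ltrans g \<phi>) = \<Lambda> \<phi>"
  using assms by (simp_all add: locally_bounded_functional_def)

lemma locally_bounded_functional_bound:
  assumes "locally_bounded_functional \<Lambda>" "compact K"
  obtains C where "\<And>\<psi> e. \<psi> \<in> C_c \<Longrightarrow> 0 < e \<Longrightarrow>
    (\<forall>x. \<bar>\<psi> x\<bar> \<le> e * indicator K x) \<Longrightarrow> \<bar>\<Lambda> \<psi>\<bar> \<le> C * e"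
proof -
  have "\<exists>C. \<forall>\<psi> e. \<psi> \<in> C_c \<longrightarrow> 0 < e \<longrightarrow>
        (\<forall>x. \<bar>\<psi> x\<bar> \<le> e * indicator K x) \<longrightarrow> \<bar>\<Lambda> \<psi>\<bar> \<le> C * e"
    using assms by (simp add: locally_bounded_functional_def)
  then obtain C where C: "\<forall>\<psi> e. \<psi> \<in> C_c \<longrightarrow> 0 < e \<longrightarrow>
        (\<forall>x. \<bar>\<psi> x\<bar> \<le> e * indicator K x) \<longrightarrow> \<bar>\<Lambda> \<psi>\<bar> \<le> C * e" by (rule exE)
  show ?thesis by (rule that[of C]) (use C in simp)
qed

lemma locally_bounded_functional_integral: "locally_bounded_functional (\<lambda>\<phi>. \<integral>x. \<phi> x \<partial>m)"
  unfolding locally_bounded_functional_def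
proof (intro conjI allI impI)
  show "linear_functional C_c (\<lambda>\<phi>. \<integral>x. \<phi> x \<partial>m)"
    by (rule linear_functionalI)
      (subst Bochner_Integration.integral_add, auto intro: integrable_C_c)
next
  fix g and \<phi> :: "'a \<Rightarrow> real" assume "\<phi> \<in> C_c"
  then have "\<phi> \<in> borel_measurable borel" using C_c_L_infty by (auto simp: L_infty_def)
  then show "(\<integral>x. ltrans g \<phi> x \<partial>m) = (\<integral>x. \<phi> x \<partial>m)"
    unfolding ltrans_def by (rule integral_translate)
next
  fix K :: "'a set" assume K: "compact K"
  show "\<exists>C. \<forall>\<psi> e. \<psi> \<in> C_c \<longrightarrow> 0 < e \<longrightarrow>
        (\<forall>x. \<bar>\<psi> x\<bar> \<le> e * indicator K x) \<longrightarrow> \<bar>\<integral>x. \<psi> x \<partial>m\<bar> \<le> C * e"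
  proof (intro exI allI impI)
    fix \<psi> :: "'a \<Rightarrow> real" and e :: real
    assume *: "\<psi> \<in> C_c" "0 < e" "\<forall>x. \<bar>\<psi> x\<bar> \<le> e * indicator K x"
    then have "\<bar>\<integral>x. \<psi> x \<partial>m\<bar> \<le> e * measure m K"
      using C_c_L_infty by (intro integrable_compact(2)[OF K]) (auto simp: L_infty_def)
    then show "\<bar>\<integral>x. \<psi> x \<partial>m\<bar> \<le> measure m K * e" by (simp add: mult.commute)
  qed
qed

lemma locally_bounded_functional_right_translate:
  assumes "locally_bounded_functional \<Lambda>"
  shows "locally_bounded_functional (\<lambda>\<phi>. \<Lambda> (\<lambda>x. \<phi> (x + g)))"
  unfolding locally_bounded_functional_def
proof (intro conjI allI impI)
  show "linear_functional C_c (\<lambda>\<phi>. \<Lambda> (\<lambda>x. \<phi> (x + g)))"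
    by (intro linear_functionalI C_c_right
        linear_functional_comb[OF locally_bounded_functional_linear[OF assms] function_space_C_c])
next
  fix h and \<phi> :: "'a \<Rightarrow> real" assume "\<phi> \<in> C_c"
  then have "\<Lambda> (ltrans h (\<lambda>x. \<phi> (x + g))) = \<Lambda> (\<lambda>x. \<phi> (x + g))"
    by (intro locally_bounded_functional_ltrans[OF assms] C_c_right)
  then show "\<Lambda> (\<lambda>x. ltrans h \<phi> (x + g)) = \<Lambda> (\<lambda>x. \<phi> (x + g))"
    by (simp add: ltrans_def add.assoc)
next
  fix K :: "'a set" assume K: "compact K"
  have "compact ((\<lambda>x. x + - g) ` K)"
    by (intro compact_continuous_image K continuous_intros)
  from locally_bounded_functional_bound[OF assms this]
  obtain C where C: "\<And>\<psi> e. \<psi> \<in> C_c \<Longrightarrow> 0 < e \<Longrightarrow>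
      (\<forall>x. \<bar>\<psi> x\<bar> \<le> e * indicator ((\<lambda>x. x + - g) ` K) x) \<Longrightarrow> \<bar>\<Lambda> \<psi>\<bar> \<le> C * e"
    by metis
  show "\<exists>C. \<forall>\<psi> e. \<psi> \<in> C_c \<longrightarrow> 0 < e \<longrightarrow>
        (\<forall>x. \<bar>\<psi> x\<bar> \<le> e * indicator K x) \<longrightarrow> \<bar>\<Lambda> (\<lambda>x. \<psi> (x + g))\<bar> \<le> C * e"
  proof (intro exI allI impI)
    fix \<psi> :: "'a \<Rightarrow> real" and e :: real
    assume *: "\<psi> \<in> C_c" "0 < e" "\<forall>x. \<bar>\<psi> x\<bar> \<le> e * indicator K x"
    have "(indicator ((\<lambda>x. x + - g) ` K) x :: real) = indicator K (x + g)" for x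
      by (force simp: indicator_def image_iff add.assoc)
    then show "\<bar>\<Lambda> (\<lambda>x. \<psi> (x + g))\<bar> \<le> C * e"
      using * by (intro C C_c_right) auto
  qed
qed

lemma locally_bounded_functional_translate_sum:
  assumes "locally_bounded_functional \<Lambda>" "\<phi> \<in> C_c"
  shows "\<Lambda> (translate_sum ts \<phi>) = weight ts * \<Lambda> \<phi>"
  using linear_functional_translate_sum[OF locally_bounded_functional_linear[OF assms(1)] function_space_C_c
      C_c_ltrans[OF assms(2)]] locally_bounded_functional_ltrans[OF assms]
  by (simp add: weight_def sum_list_mult_const)

text \<open>One bump \<phi> serves both functions. If \<psi>1 and \<psi>2 are approximated by
  combinations of its translates with weights a and b, both sides are close to a b times the values
  of \<Lambda> and of the Haar integral at \<phi>. The product form avoids division by integrals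
  that may be 0. No bound on \<Lambda> \<phi> is required as e shrinks, since only the products with
  the weights are compared.\<close>

lemma locally_bounded_functional_unique:
  assumes \<Lambda>: "locally_bounded_functional \<Lambda>"
    and \<psi>1: "\<psi>1 \<in> C_c" and \<psi>2: "\<psi>2 \<in> C_c"
  shows "\<Lambda> \<psi>1 * (\<integral>x. \<psi>2 x \<partial>m) = \<Lambda> \<psi>2 * (\<integral>x. \<psi>1 x \<partial>m)"
proof -
  let ?I = "\<lambda>\<phi>. \<integral>x. \<phi> x \<partial>m"
  have close: "\<exists>C. \<forall>\<psi>' \<phi> ts e. \<psi>' \<in> {\<psi>1, \<psi>2} \<longrightarrow> \<phi> \<in> C_c \<longrightarrow> 0 < e \<longrightarrow>
      (\<forall>x. \<bar>\<psi>' x - translate_sum ts \<phi> x\<bar> \<le> e * indicator K x) \<longrightarrow> \<bar>M \<psi>' - weight ts * M \<phi>\<bar> \<le> C * e"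
    if M: "locally_bounded_functional M" and K: "compact K" for M K
  proof -
    obtain C where C: "\<And>\<psi> e. \<psi> \<in> C_c \<Longrightarrow> 0 < e \<Longrightarrow>
        (\<forall>x. \<bar>\<psi> x\<bar> \<le> e * indicator K x) \<Longrightarrow> \<bar>M \<psi>\<bar> \<le> C * e"
      using locally_bounded_functional_bound[OF M K] by metis
    show ?thesis
    proof (intro exI allI impI)
      fix \<psi>' \<phi> ts and e :: real
      assume *: "\<psi>' \<in> {\<psi>1, \<psi>2}" "\<phi> \<in> C_c" "0 < e"
        "\<forall>x. \<bar>\<psi>' x - translate_sum ts \<phi> x\<bar> \<le> e * indicator K x"
      have cs: "\<psi>' \<in> C_c" "translate_sum ts \<phi> \<in> C_c"
        using * \<psi>1 \<psi>2 C_c_translate_sum by auto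
      have "M (\<lambda>x. 1 * \<psi>' x + (-1) * translate_sum ts \<phi> x) = 1 * M \<psi>' + (-1) * M (translate_sum ts \<phi>)"
        by (rule linear_functional_comb[OF locally_bounded_functional_linear[OF M] function_space_C_c cs])
      moreover have "\<bar>M (\<lambda>x. 1 * \<psi>' x + (-1) * translate_sum ts \<phi> x)\<bar> \<le> C * e"
        using * by (intro C C_c_comb cs) auto
      ultimately show "\<bar>M \<psi>' - weight ts * M \<phi>\<bar> \<le> C * e"
        using locally_bounded_functional_translate_sum[OF M *(2)] by simp
    qed
  qed
  obtain K1 where K1: "compact K1"
    "\<forall>e>0. \<exists>V. open V \<and> 0 \<in> V \<and> (\<forall>\<phi>. bump_in V \<phi> \<longrightarrow> approximated_on K1 e \<psi>1 \<phi>)"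
    using approx_by_translates[OF \<psi>1] by blast
  obtain K2 where K2: "compact K2"
    "\<forall>e>0. \<exists>V. open V \<and> 0 \<in> V \<and> (\<forall>\<phi>. bump_in V \<phi> \<longrightarrow> approximated_on K2 e \<psi>2 \<phi>)"
    using approx_by_translates[OF \<psi>2] by blast
  define K where "K = K1 \<union> K2"
  have K: "compact K" using K1 K2 by (auto simp: K_def)
  have ind: "e * indicator Ki x \<le> e * indicator K x" if "Ki \<subseteq> K" "0 < e" for Ki x and e :: real
    using that by (auto simp: indicator_def)
  obtain C where C: "\<And>\<psi>' \<phi> ts e. \<psi>' \<in> {\<psi>1, \<psi>2} \<Longrightarrow> \<phi> \<in> C_c \<Longrightarrow> 0 < e \<Longrightarrow>
      (\<forall>x. \<bar>\<psi>' x - translate_sum ts \<phi> x\<bar> \<le> e * indicator K x) \<Longrightarrow> \<bar>\<Lambda> \<psi>' - weight ts * \<Lambda> \<phi>\<bar> \<le> C * e"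
    using close[OF \<Lambda> K] by blast
  obtain D where D: "\<And>\<psi>' \<phi> ts e. \<psi>' \<in> {\<psi>1, \<psi>2} \<Longrightarrow> \<phi> \<in> C_c \<Longrightarrow> 0 < e \<Longrightarrow>
      (\<forall>x. \<bar>\<psi>' x - translate_sum ts \<phi> x\<bar> \<le> e * indicator K x) \<Longrightarrow> \<bar>?I \<psi>' - weight ts * ?I \<phi>\<bar> \<le> D * e"
    using close[OF locally_bounded_functional_integral K] by blast
  define B where "B = \<bar>C\<bar> + \<bar>D\<bar>"
  \<comment> \<open>The constant collects the errors of the two products; the last summand 2 B
    bounds the quadratic terms by means of e \<le> 1.\<close>
  define R where "R = B * (\<bar>\<Lambda> \<psi>1\<bar> + \<bar>?I \<psi>2\<bar> + \<bar>\<Lambda> \<psi>2\<bar> + \<bar>?I \<psi>1\<bar> + 2 * B)"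
  have B0: "0 \<le> B" by (simp add: B_def)
  have R0: "0 \<le> R" using B0 by (auto simp: R_def intro!: mult_nonneg_nonneg add_nonneg_nonneg)
  have prod: "\<bar>p * q - a * b\<bar> \<le> d * (\<bar>a\<bar> + \<bar>b\<bar> + d)"
    if "\<bar>a - p\<bar> \<le> d" "\<bar>b - q\<bar> \<le> d" for a b p q d :: real
  proof -
    have "0 \<le> d" using that by linarith
    have "p * q - a * b = a * (q - b) + (p - a) * b + (p - a) * (q - b)" by algebra
    also have "\<bar>\<dots>\<bar> \<le> \<bar>a * (q - b)\<bar> + \<bar>(p - a) * b\<bar> + \<bar>(p - a) * (q - b)\<bar>" by linarith
    also have "\<dots> \<le> \<bar>a\<bar> * d + d * \<bar>b\<bar> + d * d"
      unfolding abs_mult using that \<open>0 \<le> d\<close> by (intro add_mono mult_mono) auto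
    finally show ?thesis by (simp add: algebra_simps)
  qed
  have bound: "\<bar>\<Lambda> \<psi>1 * ?I \<psi>2 - \<Lambda> \<psi>2 * ?I \<psi>1\<bar> \<le> R * e" if e: "0 < e" "e \<le> 1" for e
  proof -
    obtain V1 where V1: "open V1" "0 \<in> V1" "\<And>\<phi>. bump_in V1 \<phi> \<Longrightarrow> approximated_on K1 e \<psi>1 \<phi>"
      using K1(2) e(1) by blast
    obtain V2 where V2: "open V2" "0 \<in> V2" "\<And>\<phi>. bump_in V2 \<phi> \<Longrightarrow> approximated_on K2 e \<psi>2 \<phi>"
      using K2(2) e(1) by blast
    have "open (V1 \<inter> V2)" "0 \<in> V1 \<inter> V2" using V1 V2 by auto
    then obtain \<phi> :: "'a \<Rightarrow> real" where \<phi>: "\<phi> \<in> C_c" "\<And>x. 0 \<le> \<phi> x" "\<phi> 0 = 1"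
        "\<And>x. x \<notin> V1 \<inter> V2 \<Longrightarrow> \<phi> x = 0"
      by (rule bump_function) auto
    obtain ts where ts: "\<And>x. \<bar>\<psi>1 x - translate_sum ts \<phi> x\<bar> \<le> e * indicator K1 x"
      using V1(3)[of \<phi>] \<phi> by (auto simp: bump_in_def approximated_on_def)
    obtain us where us: "\<And>x. \<bar>\<psi>2 x - translate_sum us \<phi> x\<bar> \<le> e * indicator K2 x"
      using V2(3)[of \<phi>] \<phi> by (auto simp: bump_in_def approximated_on_def)
    have tsK: "\<forall>x. \<bar>\<psi>1 x - translate_sum ts \<phi> x\<bar> \<le> e * indicator K x"
      by (intro allI order_trans[OF ts ind]) (use e in \<open>auto simp: K_def\<close>)
    have usK: "\<forall>x. \<bar>\<psi>2 x - translate_sum us \<phi> x\<bar> \<le> e * indicator K x"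
      by (intro allI order_trans[OF us ind]) (use e in \<open>auto simp: K_def\<close>)
    have le: "C * e \<le> B * e" "D * e \<le> B * e" using e by (auto simp: B_def intro!: mult_right_mono)
    have c1: "\<bar>\<Lambda> \<psi>1 - weight ts * \<Lambda> \<phi>\<bar> \<le> B * e" using C[OF _ \<phi>(1) e(1) tsK] le by simp
    have c2: "\<bar>\<Lambda> \<psi>2 - weight us * \<Lambda> \<phi>\<bar> \<le> B * e" using C[OF _ \<phi>(1) e(1) usK] le by simp
    have d1: "\<bar>?I \<psi>1 - weight ts * ?I \<phi>\<bar> \<le> B * e" using D[OF _ \<phi>(1) e(1) tsK] le by simp
    have d2: "\<bar>?I \<psi>2 - weight us * ?I \<phi>\<bar> \<le> B * e" using D[OF _ \<phi>(1) e(1) usK] le by simp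
    \<comment> \<open>Both cross products have the same approximate value, so the difference is
      bounded by the two product errors alone.\<close>
    have "(weight ts * \<Lambda> \<phi>) * (weight us * ?I \<phi>) = (weight us * \<Lambda> \<phi>) * (weight ts * ?I \<phi>)"
      by (simp add: ac_simps)
    then have "\<bar>\<Lambda> \<psi>1 * ?I \<psi>2 - \<Lambda> \<psi>2 * ?I \<psi>1\<bar>
        \<le> B * e * (\<bar>\<Lambda> \<psi>1\<bar> + \<bar>?I \<psi>2\<bar> + B * e) + B * e * (\<bar>\<Lambda> \<psi>2\<bar> + \<bar>?I \<psi>1\<bar> + B * e)"
      using prod[OF c1 d2] prod[OF c2 d1] by linarith
    also have "\<dots> = e * (B * (\<bar>\<Lambda> \<psi>1\<bar> + \<bar>?I \<psi>2\<bar> + \<bar>\<Lambda> \<psi>2\<bar> + \<bar>?I \<psi>1\<bar> + 2 * (B * e)))"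
      by (simp add: algebra_simps)
    also have "\<dots> \<le> e * R" unfolding R_def using e B0
      by (intro mult_left_mono add_left_mono) (auto simp: mult_left_le)
    finally show ?thesis by (simp add: mult.commute)
  qed
  have "\<bar>\<Lambda> \<psi>1 * ?I \<psi>2 - \<Lambda> \<psi>2 * ?I \<psi>1\<bar> \<le> 0"
  proof (rule field_le_epsilon)
    fix d :: real assume d: "0 < d"
    define e where "e = min 1 (d / (R + 1))"
    have e: "0 < e" "e \<le> 1" using d R0 by (auto simp: e_def)
    have "R * e \<le> R * (d / (R + 1))" using R0 by (intro mult_left_mono) (auto simp: e_def)
    also have "\<dots> \<le> d" using d R0 by (simp add: field_simps)
    finally show "\<bar>\<Lambda> \<psi>1 * ?I \<psi>2 - \<Lambda> \<psi>2 * ?I \<psi>1\<bar> \<le> 0 + d" using bound[OF e] by simp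
  qed
  then show ?thesis by simp
qed

text \<open>The quotient of the two integrals is the value of the modular function at \<open>g\<close>.\<close>

lemma conv_ltrans_right:
  assumes "\<psi> \<in> C_c" "v \<in> L_infty" "continuous_on UNIV v"
  shows "conv \<psi> (ltrans g v) x * (\<integral>z. \<psi> (z + - g) \<partial>m) = (\<integral>z. \<psi> z \<partial>m) * conv (\<lambda>z. \<psi> (z + - g)) v x"
proof -
  define \<psi>' where "\<psi>' = (\<lambda>z. \<psi> (z + - g))"
  have cs: "\<psi>' \<in> C_c" unfolding \<psi>'_def by (rule C_c_right[OF assms(1)])
  \<comment> \<open>Replacing z by z + g in F gives v(-g - z + x) \<psi>(z), the integrand of the
    convolution of \<psi> with gv. Uniqueness is then applied to the right translated Haar integral
    at F and at \<open>\<psi>'\<close>.\<close>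
  define F where "F = (\<lambda>z. v (- z + x) * \<psi>' z)"
  have "F \<in> C_c"
  proof -
    obtain K where K: "compact K" "\<And>z. z \<notin> K \<Longrightarrow> \<psi>' z = 0" "continuous_on UNIV \<psi>'"
      using cs by (auto simp: C_c_def)
    have "continuous_on UNIV (\<lambda>z. v (- z + x))"
      by (rule continuous_on_compose2[OF assms(3)]) (auto intro!: continuous_intros)
    then show ?thesis unfolding C_c_def mem_Collect_eq F_def using K
      by (intro conjI exI[of _ K] continuous_on_mult) auto
  qed
  have "(\<integral>z. F (z + g) \<partial>m) * (\<integral>z. \<psi>' z \<partial>m) = (\<integral>z. \<psi>' (z + g) \<partial>m) * (\<integral>z. F z \<partial>m)"
    by (rule locally_bounded_functional_unique[OF locally_bounded_functional_right_translate[OF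
          locally_bounded_functional_integral] \<open>F \<in> C_c\<close> cs])
  moreover have "(\<integral>z. F (z + g) \<partial>m) = conv \<psi> (ltrans g v) x"
    by (simp add: F_def \<psi>'_def conv_def ltrans_def minus_add add.assoc del: add_uminus_conv_diff)
  moreover have "(\<integral>z. \<psi>' (z + g) \<partial>m) = (\<integral>z. \<psi> z \<partial>m)"
    by (simp add: \<psi>'_def add.assoc)
  moreover have "(\<integral>z. F z \<partial>m) = conv \<psi>' v x" by (simp add: F_def conv_def)
  ultimately show ?thesis by (simp only: \<psi>'_def)
qed

end

section \<open>Integrals and the translate property\<close>

lemma translate_property_weight:
  assumes "translate_property F E" "f \<in> nonzero_nonneg F E"
  shows "translates_nonneg_weight F f"
  unfolding translates_nonneg_weight_def
proof (intro allI impI)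
  fix ts :: "(real \<times> 'a) list"
  assume nn: "nonneg_in F (translate_sum ts f)"
  \<comment> \<open>The sum counts from 1, the positions of a list from 0.\<close>
  define t where "t j = fst (ts ! (j - 1))" for j
  define g where "g j = snd (ts ! (j - 1))" for j
  have eq: "translate_sum ts f = (\<lambda>x. \<Sum>j=1..length ts. t j * ltrans (g j) f x)"
    by (rule ext) (simp add: translate_sum_def sum_list_sum_nth sum.atLeast1_atMost_eq t_def g_def atLeast0LessThan)
  have "nonneg_in F (\<lambda>x. \<Sum>j=1..length ts. t j * ltrans (g j) f x)" using nn unfolding eq .
  then have "0 \<le> (\<Sum>j=1..length ts. t j)"
    using assms unfolding translate_property_def by blast
  then show "0 \<le> weight ts"
    by (simp add: weight_def sum_list_sum_nth sum.atLeast1_atMost_eq t_def atLeast0LessThan)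
qed

lemma translate_sum_nonneg:
  assumes "left_invariant_filter F" "nonneg_in F f"
  shows "\<forall>\<^sub>F x in F. 0 \<le> ltrans g f x"
  using assms unfolding left_invariant_filter_def nonneg_in_def ltrans_def by blast

text \<open>Coefficients are rounded up and then written as repetitions of the same translate; this
  is sound because the translates of f are non-negative.\<close>

lemma translate_sum_le_integer_coefficients:
  assumes "left_invariant_filter F" "nonneg_in F f" "\<forall>p\<in>set ts. 0 \<le> fst p"
  shows "\<exists>gs. \<forall>\<^sub>F x in F. translate_sum ts f x \<le> (\<Sum>g\<leftarrow>gs. ltrans g f x)"
  using assms(3)
proof (induction ts)
  case Nil
  then show ?case by (intro exI[of _ "[]"]) simp
next
  case (Cons p ts)
  then obtain gs where gs: "\<forall>\<^sub>F x in F. translate_sum ts f x \<le> (\<Sum>g\<leftarrow>gs. ltrans g f x)" by auto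
  define k where "k = nat \<lceil>fst p\<rceil>"
  have k: "fst p \<le> real k" unfolding k_def by (simp add: real_nat_ceiling_ge)
  have "\<forall>\<^sub>F x in F. translate_sum (p # ts) f x \<le> (\<Sum>g\<leftarrow>replicate k (snd p) @ gs. ltrans g f x)"
    using gs translate_sum_nonneg[OF assms(1,2), of "snd p"]
  proof eventually_elim
    case (elim x)
    then show ?case using mult_right_mono[OF k elim(2)] by (simp add: sum_list_replicate)
  qed
  then show ?case by blast
qed

lemma
  fixes n :: nat and t :: "nat \<Rightarrow> real" and g :: "nat \<Rightarrow> 'a::group_add"
  defines "ts \<equiv> map (\<lambda>j. (t j, g j)) [1..<Suc n]"
  shows translate_sum_upto: "translate_sum ts f x = (\<Sum>j=1..n. t j * ltrans (g j) f x)"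
    and weight_upto: "weight ts = (\<Sum>j=1..n. t j)"
proof -
  have "translate_sum ts f x = (\<Sum>j\<leftarrow>[1..<Suc n]. t j * ltrans (g j) f x)"
    "weight ts = (\<Sum>j\<leftarrow>[1..<Suc n]. t j)"
    by (simp_all add: ts_def translate_sum_def weight_def o_def del: upt_Suc)
  then show "translate_sum ts f x = (\<Sum>j=1..n. t j * ltrans (g j) f x)" "weight ts = (\<Sum>j=1..n. t j)"
    by (simp_all only: sum_list_distinct_conv_sum_set[OF distinct_upt] set_upt atLeastLessThanSuc_atLeastAtMost)
qed

text \<open>Domination by plain sums of translates and by weighted sums define the same functions.
  The weighted form is the one that carries quantitative information.\<close>

lemma dominated_eq:
  assumes "left_invariant_filter F" "nonneg_in F f"
  shows "dominated F E f = E \<inter> dominated_space F f"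
proof (intro equalityI subsetI)
  fix h assume "h \<in> dominated F E f"
  then obtain n :: nat and g where h: "h \<in> E" "\<forall>\<^sub>F x in F. \<bar>h x\<bar> \<le> (\<Sum>j=1..n. ltrans (g j) f x)"
    by (auto simp: dominated_def)
  define ts where "ts = map (\<lambda>j. (1::real, g j)) [1..<Suc n]"
  have "translate_sum ts f x = (\<Sum>j=1..n. ltrans (g j) f x)" for x
    using translate_sum_upto[of "\<lambda>j. 1" g n f x] by (simp add: ts_def del: upt_Suc)
  then have "dominated_by F f (weight ts) h"
    unfolding dominated_by_def using h by (intro exI[of _ ts]) (auto simp: ts_def simp del: upt_Suc)
  then show "h \<in> E \<inter> dominated_space F f" using h by (auto simp: dominated_space_def)
next
  fix h assume h: "h \<in> E \<inter> dominated_space F f"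
  then obtain ts where ts: "\<forall>p\<in>set ts. 0 \<le> fst p" "\<forall>\<^sub>F x in F. \<bar>h x\<bar> \<le> translate_sum ts f x"
    by (auto simp: dominated_space_def dominated_by_def)
  obtain gs where gs: "\<forall>\<^sub>F x in F. translate_sum ts f x \<le> (\<Sum>g\<leftarrow>gs. ltrans g f x)"
    using translate_sum_le_integer_coefficients[OF assms ts(1)] by blast
  have eq: "(\<Sum>g\<leftarrow>gs. ltrans g f x) = (\<Sum>j=1..length gs. ltrans (gs ! (j - 1)) f x)" for x
    by (simp add: sum_list_sum_nth sum.atLeast1_atMost_eq atLeast0LessThan)
  have "\<forall>\<^sub>F x in F. \<bar>h x\<bar> \<le> (\<Sum>g\<leftarrow>gs. ltrans g f x)"
    using gs ts(2) by eventually_elim auto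
  then have "\<forall>\<^sub>F x in F. \<bar>h x\<bar> \<le> (\<Sum>j=1..length gs. ltrans (gs ! (j - 1)) f x)"
    unfolding eq .
  then show "h \<in> dominated F E f"
    using h unfolding dominated_def by (intro CollectI conjI exI[of _ "length gs"] exI[of _ "\<lambda>j. gs ! (j - 1)"]) auto
qed

lemma function_space_Int: "function_space A \<Longrightarrow> function_space B \<Longrightarrow> function_space (A \<inter> B)"
  by (auto simp: function_space_def)

text \<open>The easy direction: an invariant normalized integral is 1 at every translate of f, so it
  sends the non-negative combination to the sum of its coefficients.\<close>

lemma integral_property_imp_translate_property:
  assumes F: "left_invariant_filter F" and E: "function_space E" "\<And>g h. h \<in> E \<Longrightarrow> ltrans g h \<in> E"
    and I: "invariant_normalized_integral_property F E"
  shows "translate_property F E"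
  unfolding translate_property_def
proof (intro ballI allI impI)
  fix f n and t :: "nat \<Rightarrow> real" and g :: "nat \<Rightarrow> 'a"
  assume f: "f \<in> nonzero_nonneg F E" and nn: "nonneg_in F (\<lambda>x. \<Sum>j=1..n. t j * ltrans (g j) f x)"
  have fE: "f \<in> E" and fn: "nonneg_in F f" using f by (auto simp: nonzero_nonneg_def)
  obtain I where I: "invariant_normalized_integral F E f I"
    using assms(4) f unfolding invariant_normalized_integral_property_def by blast
  let ?D = "dominated F E f"
  have D: "?D = E \<inter> dominated_space F f" by (rule dominated_eq[OF F fn])
  have sD: "function_space ?D" unfolding D by (intro function_space_Int E function_space_dominated)
  have tD: "ltrans h f \<in> ?D" for h
    unfolding D using E(2) fE dominated_space_ltrans[OF F dominated_space_self[OF fn]] by blast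
  have I1: "I (ltrans h f) = 1" for h
    using I tD[of 0] unfolding invariant_normalized_integral_def by simp
  have lin: "linear_functional ?D I"
    using I unfolding invariant_normalized_integral_def linear_functional_def by blast
  define ts where "ts = map (\<lambda>j. (t j, g j)) [1..<Suc n]"
  have ts: "translate_sum ts f = (\<lambda>x. \<Sum>j=1..n. t j * ltrans (g j) f x)" "weight ts = (\<Sum>j=1..n. t j)"
    unfolding ts_def by (rule ext, rule translate_sum_upto) (rule weight_upto)
  have "0 \<le> I (translate_sum ts f)"
    using I nn translate_sum_closed[OF sD tD, of ts] unfolding invariant_normalized_integral_def ts(1) by blast
  then show "0 \<le> (\<Sum>j=1..n. t j)"
    using linear_functional_translate_sum[OF lin sD tD, of ts] I1 unfolding ts(2)[symmetric] by (simp add: weight_def)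
qed

text \<open>Dependence on classes only is a consequence of positivity, applied to both differences
  of two equivalent functions.\<close>

lemma invariant_normalized_integralI:
  assumes F: "left_invariant_filter F" and E: "function_space E" and f: "nonneg_in F f"
    and lin: "linear_functional (dominated F E f) I"
    and pos: "\<And>h. h \<in> dominated F E f \<Longrightarrow> nonneg_in F h \<Longrightarrow> 0 \<le> I h"
    and inv: "\<And>g h. h \<in> dominated F E f \<Longrightarrow> I (ltrans g h) = I h" and 1: "I f = 1"
  shows "invariant_normalized_integral F E f I"
proof -
  let ?D = "dominated F E f"
  have sD: "function_space ?D"
    unfolding dominated_eq[OF F f] by (intro function_space_Int E function_space_dominated)
  have "I h = I k" if "h \<in> ?D" "k \<in> ?D" "eq_in F h k" for h k
  proof -
    have "0 \<le> I (\<lambda>x. h x - k x)"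
      by (rule pos[OF function_space_diff[OF sD that(1,2)]])
        (use that(3) in \<open>auto simp: nonneg_in_def eq_in_def elim: eventually_mono\<close>)
    moreover have "0 \<le> I (\<lambda>x. k x - h x)"
      by (rule pos[OF function_space_diff[OF sD that(2,1)]])
        (use that(3) in \<open>auto simp: nonneg_in_def eq_in_def elim: eventually_mono\<close>)
    ultimately show ?thesis
      using linear_functional_diff[OF lin sD that(1,2)] linear_functional_diff[OF lin sD that(2,1)] by simp
  qed
  then show ?thesis
    using lin pos inv 1 unfolding invariant_normalized_integral_def linear_functional_def by simp
qed

lemma bounded_left_uniform_L_infty:
  "bounded (range b) \<Longrightarrow> left_uniform b \<Longrightarrow> b \<in> L_infty"
  by (simp add: L_infty_def borel_measurable_continuous_onI left_uniform_imp_continuous)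

section \<open>Reduction to uniformly continuous functions\<close>

context haar_group
begin

lemma C_b_u_L_inftyI:
  "f \<in> L_infty \<Longrightarrow> left_uniform f \<Longrightarrow> right_uniform f \<Longrightarrow> f \<in> C_b_u"
  by (simp add: C_b_u_def C_b_ru_iff C_b_lu_iff L_infty_def)

text \<open>Smoothing by right translates is positive, commutes with combinations of left translates
  and carries b into \<open>C_b_u\<close>, so every inequality for b passes to its smoothing. The
  bound b \<ge> 1 keeps the smoothing from being 0.\<close>

lemma translates_nonneg_weight_left_uniform:
  assumes T: "translate_property top (C_b_u :: ('a \<Rightarrow> real) set)"
    and b: "bounded (range b)" "left_uniform b" "\<And>x :: 'a. 1 \<le> b x"
  shows "translates_nonneg_weight top b"
proof -
  obtain k :: "'a \<Rightarrow> real" where k: "k \<in> C_c" "\<And>x. 0 \<le> k x" "k 0 = 1"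
    using bump_function[of UNIV] by auto
  have bL: "b \<in> L_infty" by (rule bounded_left_uniform_L_infty[OF b(1,2)])
  have kpos: "0 < (\<integral>x. k x \<partial>m)"
    using k by (intro integral_positive[of k 0] integrable_C_c)
      (auto simp: C_c_def)
  have "(\<integral>x. k x \<partial>m) \<le> rconv k b x" for x
    using rconv_mono[OF k(1,2) L_infty_const[of 1] bL, of x] b(3) by (simp add: rconv_def)
  then have pos: "0 < rconv k b x" for x using kpos less_le_trans by blast
  then have "rconv k b \<in> nonzero_nonneg top C_b_u"
    using C_b_u_L_inftyI[OF rconv_L_infty rconv_left_uniform rconv_right_uniform] k bL b(2)
    by (auto simp: nonzero_nonneg_def nonneg_in_def eq_in_def less_imp_le intro!: exI[of _ 0])
      (metis less_irrefl)?
  then have *: "translates_nonneg_weight top (rconv k b)" by (rule translate_property_weight[OF T])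
  show ?thesis
    unfolding translates_nonneg_weight_def
  proof (intro allI impI)
    fix ts :: "(real \<times> 'a) list" assume "nonneg_in top (translate_sum ts b)"
    then have "rconv k (\<lambda>x. 0) x \<le> rconv k (translate_sum ts b) x" for x
      by (intro rconv_mono k L_infty_const translate_sum_L_infty bL) (auto simp: nonneg_in_def)
    then have "nonneg_in top (translate_sum ts (rconv k b))"
      unfolding rconv_translate_sum[OF k(1) bL] by (simp add: nonneg_in_def rconv_def)
    then show "0 \<le> weight ts" using * by (auto simp: translates_nonneg_weight_def)
  qed
qed

lemma C_c_majorant:
  assumes "compact (K :: 'a set)"
  obtains \<theta> where "\<theta> \<in> C_c" "\<And>x. indicator K x \<le> \<theta> x" "\<And>x. 0 \<le> \<theta> x"
proof -
  obtain \<phi> :: "'a \<Rightarrow> real" where \<phi>: "\<phi> \<in> C_c" "\<And>x. 0 \<le> \<phi> x" "\<phi> 0 = 1"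
    using bump_function[of UNIV] by auto
  have "(indicator K :: 'a \<Rightarrow> real) \<in> dominated_space top \<phi>"
    using \<phi> assms by (intro compact_support_dominated[where K=K and C=1]) (auto simp: C_c_def)
  then obtain ts where ts: "\<And>x. \<bar>indicator K x\<bar> \<le> translate_sum ts \<phi> x"
    by (auto simp: dominated_space_def dominated_by_def)
  show ?thesis
  proof (rule that)
    show "translate_sum ts \<phi> \<in> C_c"
      by (rule C_c_translate_sum[OF \<phi>(1)])
    show "indicator K x \<le> translate_sum ts \<phi> x" "0 \<le> translate_sum ts \<phi> x" for x
      using ts[of x] by linarith+
  qed
qed

end

text \<open>\<open>rconv k f\<close> need not be left uniformly continuous, while \<open>f\<^sub>0\<close> is uniformly continuous on
  both sides; its translates dominate the convolutions with \<open>rconv k h\<close> for all \<open>h\<close> dominated by \<open>f\<close>.\<close>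

locale regularized = haar_group m
  for m :: "'a::{topological_group_add, t2_space} measure" +
  fixes f k \<phi> :: "'a \<Rightarrow> real"
  assumes f: "f \<in> L_infty" "AE x in m. 0 \<le> f x"
    and k: "k \<in> C_c" "\<And>x. 0 \<le> k x" and k_pos: "0 < rconv k f 0"
    and \<phi>: "\<phi> \<in> C_c" "\<And>x. 0 \<le> \<phi> x" "0 < \<phi> 0"
    and T: "translate_property top (C_b_u :: ('a \<Rightarrow> real) set)"
begin

definition "u = rconv k f"

definition "f\<^sub>0 = conv \<phi> u"

abbreviation "D \<equiv> dominated_space (top :: 'a filter) f\<^sub>0"

lemma u_L: "u \<in> L_infty" and u_cont: "continuous_on UNIV u" and u_nonneg: "0 \<le> u x"
proof -
  show "u \<in> L_infty" unfolding u_def by (rule rconv_L_infty[OF k(1) f(1)])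
  show "continuous_on UNIV u" unfolding u_def
    by (intro right_uniform_imp_continuous rconv_right_uniform k f)
  have "rconv k (\<lambda>x. 0) x \<le> rconv k f x"
    by (intro rconv_mono k f L_infty_const)
  then show "0 \<le> u x" by (simp add: u_def rconv_def)
qed

lemma f0_nonneg: "nonneg_in top f\<^sub>0"
  using \<phi>(2) u_nonneg by (auto simp: nonneg_in_def f\<^sub>0_def conv_def)

lemma f0_translates: "translates_nonneg_weight top f\<^sub>0"
proof (rule translate_property_weight[OF T])
  have "0 < f\<^sub>0 0" unfolding f\<^sub>0_def conv_def
  proof (rule integral_positive[where a=0])
    show "integrable m (\<lambda>y. u (- y + 0) * \<phi> y)" by (rule integrable_conv[OF \<phi>(1) u_L])
    show "continuous_on UNIV (\<lambda>y. u (- y + 0) * \<phi> y)"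
      using \<phi>(1) by (auto intro!: continuous_intros continuous_on_compose2[OF u_cont]
          simp: C_c_def)
  qed (use u_nonneg \<phi> k_pos in \<open>auto simp: u_def\<close>)
  moreover have "f\<^sub>0 \<in> C_b_u" unfolding f\<^sub>0_def
    by (intro C_b_u_L_inftyI conv_L_infty conv_left_uniform conv_right_uniform \<phi> u_L)
      (simp add: u_def rconv_right_uniform k f)
  ultimately show "f\<^sub>0 \<in> nonzero_nonneg top C_b_u"
    using f0_nonneg by (auto simp: nonzero_nonneg_def eq_in_def intro!: exI[of _ 0])
qed

lemma D_mono: "v \<in> D" if "w \<in> D" "\<And>x. \<bar>v x\<bar> \<le> w x" for v w
proof -
  have "\<bar>v x\<bar> \<le> \<bar>w x\<bar>" for x using that(2)[of x] by linarith
  then show ?thesis using that(1) dominated_by_mono[of top f\<^sub>0 _ w v]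
    by (auto simp: dominated_space_def)
qed

lemma conv_translate_sum_left: "conv (translate_sum ts \<phi>) u = translate_sum ts f\<^sub>0"
proof
  fix x
  have "linear_functional C_c (\<lambda>\<psi>. conv \<psi> u x)" by (intro linear_functionalI conv_comb_left u_L)
  from linear_functional_translate_sum[OF this function_space_C_c C_c_ltrans[OF \<phi>(1)]]
  show "conv (translate_sum ts \<phi>) u x = translate_sum ts f\<^sub>0 x"
    by (simp add: translate_sum_def conv_ltrans[OF u_L \<phi>(1)] f\<^sub>0_def)
qed

text \<open>\<psi> is dominated by translates of \<phi>; convolution with u \<ge> 0 turns these into
  translates of \<open>f\<^sub>0\<close>.\<close>

lemma conv_u_in_D:
  assumes "\<psi> \<in> C_c"
  shows "conv \<psi> u \<in> D"
proof -
  obtain C where "\<And>x. \<bar>\<psi> x\<bar> \<le> C" using C_c_bounded[OF assms] by metis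
  moreover obtain K where "compact K" "\<And>x. x \<notin> K \<Longrightarrow> \<psi> x = 0" using assms by (auto simp: C_c_def)
  ultimately have "\<psi> \<in> dominated_space top \<phi>"
    using \<phi> by (intro compact_support_dominated[where K=K]) (auto simp: C_c_def)
  then obtain ts where ts: "\<And>x. \<bar>\<psi> x\<bar> \<le> translate_sum ts \<phi> x"
    by (auto simp: dominated_space_def dominated_by_def)
  show ?thesis
  proof (rule D_mono)
    show "translate_sum ts f\<^sub>0 \<in> D"
      by (rule translate_sum_dominated_space[OF left_invariant_top f0_nonneg])
    show "\<bar>conv \<psi> u x\<bar> \<le> translate_sum ts f\<^sub>0 x" for x
      using conv_abs_le[OF assms C_c_translate_sum[OF \<phi>(1)] ts u_L u_L] u_nonneg
      by (simp add: conv_translate_sum_left)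
  qed
qed

text \<open>The translate now sits on the right factor, so the result is no combination of
  translates of \<open>f\<^sub>0\<close>. The modular identity rewrites it as a multiple of a
  convolution of u itself with a right translate of the kernel.\<close>

lemma conv_ltrans_u_in_D:
  assumes \<psi>: "\<psi> \<in> C_c" "\<And>x. 0 \<le> \<psi> x"
  shows "conv \<psi> (ltrans g u) \<in> D"
proof -
  \<comment> \<open>Adding \<phi> makes the kernel positive at 0, so that the integral A can be
    divided by even when \<psi> = 0.\<close>
  define \<psi>' where "\<psi>' = (\<lambda>x. 1 * \<psi> x + 1 * \<phi> x)"
  have \<psi>': "\<psi>' \<in> C_c" unfolding \<psi>'_def by (rule C_c_comb[OF \<psi>(1) \<phi>(1)])
  have r: "(\<lambda>z. \<psi>' (z + - g)) \<in> C_c" by (rule C_c_right[OF \<psi>'])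
  define A where "A = (\<integral>z. \<psi>' (z + - g) \<partial>m)"
  have A: "0 < A" unfolding A_def
  proof (rule integral_positive[OF integrable_C_c[OF r], where a=g])
    show "continuous_on UNIV (\<lambda>z. \<psi>' (z + - g))" using r by (simp add: C_c_def)
  qed (use \<psi> \<phi> in \<open>auto simp: \<psi>'_def intro: add_nonneg_pos\<close>)
  have "conv \<psi>' (ltrans g u) x * A = (\<integral>z. \<psi>' z \<partial>m) * conv (\<lambda>z. \<psi>' (z + - g)) u x" for x
    unfolding A_def by (rule conv_ltrans_right[OF \<psi>' u_L u_cont])
  then have eq: "conv \<psi>' (ltrans g u) = (\<lambda>x. (\<integral>z. \<psi>' z \<partial>m) / A * conv (\<lambda>z. \<psi>' (z + - g)) u x)"
    using A by (simp add: fun_eq_iff field_simps)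
  have "conv \<psi>' (ltrans g u) \<in> D"
    unfolding eq using function_space_dominated[of top f\<^sub>0] conv_u_in_D[OF r]
    unfolding function_space_def by blast
  moreover have "\<bar>conv \<psi> (ltrans g u) x\<bar> \<le> conv \<psi>' (ltrans g u) x" for x
    using \<psi> \<phi> u_nonneg
    by (intro conv_abs_le \<psi>' L_infty_translates u_L) (auto simp: \<psi>'_def ltrans_def)
  ultimately show ?thesis by (rule D_mono)
qed

lemma conv_translate_sum_u_in_D:
  assumes \<psi>: "\<psi> \<in> C_c" "\<And>x. 0 \<le> \<psi> x"
  shows "conv \<psi> (translate_sum ts u) \<in> D"
proof -
  have "function_space {v \<in> L_infty. conv \<psi> v \<in> D}"
  proof (rule function_spaceI)
    fix v w a b assume *: "v \<in> {v \<in> L_infty. conv \<psi> v \<in> D}" "w \<in> {v \<in> L_infty. conv \<psi> v \<in> D}"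
    then have "conv \<psi> (\<lambda>x. a * v x + b * w x) = (\<lambda>x. a * conv \<psi> v x + b * conv \<psi> w x)"
      by (intro ext conv_comb_right \<psi>) auto
    then show "(\<lambda>x. a * v x + b * w x) \<in> {v \<in> L_infty. conv \<psi> v \<in> D}"
      using * function_space_comb[OF function_space_dominated, of "conv \<psi> v" top f\<^sub>0 "conv \<psi> w"]
      by (simp add: L_infty_comb)
  qed
  then have "translate_sum ts u \<in> {v \<in> L_infty. conv \<psi> v \<in> D}"
    by (rule translate_sum_closed) (use conv_ltrans_u_in_D[OF \<psi>] L_infty_translates(1)[OF u_L] in simp)
  then show ?thesis by simp
qed

text \<open>The smoothings of functions dominated by f have this property, and their convolutions
  with kernels in \<open>C_c\<close> lie in the domain of J.\<close>

definition "controlled w \<longleftrightarrow> w \<in> L_infty \<and> (\<exists>ts. \<forall>x. \<bar>w x\<bar> \<le> translate_sum ts u x)"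

text \<open>All kernels supported in K are bounded by multiples of one majorant \<theta>, hence the
  constant is common to them and the estimate is linear in e. Both the continuity of orbits and the
  local boundedness of \<psi> \<mapsto> J(\<psi> * w) rest on it.\<close>

lemma controlled_bound:
  assumes w: "controlled w" and K: "compact K"
  obtains C where "0 \<le> C" "\<And>\<psi> e. \<psi> \<in> C_c \<Longrightarrow> 0 < e \<Longrightarrow> (\<forall>x. \<bar>\<psi> x\<bar> \<le> e * indicator K x) \<Longrightarrow>
    dominated_by top f\<^sub>0 (C * e) (conv \<psi> w)"
proof -
  obtain ts where ts: "\<And>x. \<bar>w x\<bar> \<le> translate_sum ts u x" and wL: "w \<in> L_infty"
    using w by (auto simp: controlled_def)
  obtain \<theta> where \<theta>: "\<theta> \<in> C_c" "\<And>x. indicator K x \<le> \<theta> x" "\<And>x. 0 \<le> \<theta> x"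
    using C_c_majorant[OF K] by metis
  obtain C where C: "dominated_by top f\<^sub>0 C (conv \<theta> (translate_sum ts u))"
    using conv_translate_sum_u_in_D[OF \<theta>(1,3)] by (auto simp: dominated_space_def)
  have C': "dominated_by top f\<^sub>0 (max C 0) (conv \<theta> (translate_sum ts u))"
    by (rule dominated_by_mono[OF C]) auto
  show ?thesis
  proof (rule that[of "max C 0"])
    fix \<psi> :: "'a \<Rightarrow> real" and e :: real
    assume \<psi>: "\<psi> \<in> C_c" "0 < e" "\<forall>x. \<bar>\<psi> x\<bar> \<le> e * indicator K x"
    have cs: "(\<lambda>x. e * \<theta> x + 0 * \<theta> x) \<in> C_c" by (rule C_c_comb[OF \<theta>(1,1)])
    have "\<bar>conv \<psi> w x\<bar> \<le> e * conv \<theta> (translate_sum ts u) x" for x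
    proof -
      have "\<bar>\<psi> y\<bar> \<le> e * \<theta> y + 0 * \<theta> y" for y
        using \<psi>(3)[rule_format, of y] mult_left_mono[OF \<theta>(2)[of y], of e] \<psi>(2) by linarith
      then have "\<bar>conv \<psi> w x\<bar> \<le> conv (\<lambda>x. e * \<theta> x + 0 * \<theta> x) (translate_sum ts u) x"
        by (intro conv_abs_le \<psi>(1) cs wL translate_sum_L_infty u_L ts)
      also have "\<dots> = e * conv \<theta> (translate_sum ts u) x"
        by (subst conv_comb_left[OF \<theta>(1,1) translate_sum_L_infty[OF u_L]]) simp
      finally show ?thesis .
    qed
    then have "\<bar>conv \<psi> w x\<bar> \<le> \<bar>e * conv \<theta> (translate_sum ts u) x\<bar>" for x
      by (meson abs_ge_self order_trans)
    then show "dominated_by top f\<^sub>0 (max C 0 * e) (conv \<psi> w)"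
      using \<psi>(2) by (intro dominated_by_mono[OF dominated_by_scale[OF C', of e]])
        (auto simp: mult.commute)
  qed simp
qed

lemma conv_controlled_in_D:
  assumes "controlled w" "\<psi> \<in> C_c"
  shows "conv \<psi> w \<in> D"
proof -
  obtain K where K: "compact K" "\<And>x. x \<notin> K \<Longrightarrow> \<psi> x = 0"
    using assms(2) by (auto simp: C_c_def)
  obtain B where B: "0 \<le> B" "\<And>x. \<bar>\<psi> x\<bar> \<le> B" using C_c_bounded[OF assms(2)] by metis
  obtain C where C: "\<And>\<psi> e. \<psi> \<in> C_c \<Longrightarrow> 0 < e \<Longrightarrow> (\<forall>x. \<bar>\<psi> x\<bar> \<le> e * indicator K x) \<Longrightarrow>
    dominated_by top f\<^sub>0 (C * e) (conv \<psi> w)"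
    using controlled_bound[OF assms(1) K(1)] by metis
  have "\<bar>\<psi> x\<bar> \<le> (B + 1) * indicator K x" for x
    using B(2)[of x] K(2)[of x] by (cases "x \<in> K") auto
  then have "dominated_by top f\<^sub>0 (C * (B + 1)) (conv \<psi> w)"
    using B(1) by (intro C assms(2)) auto
  then show ?thesis by (auto simp: dominated_space_def)
qed

text \<open>Continuity of the orbit at the neutral element, measured by domination by
  \<open>f\<^sub>0\<close>, to which J is adapted.\<close>

definition "W = {v \<in> D. \<forall>e>0. \<forall>\<^sub>F t in nhds 0. dominated_by top f\<^sub>0 e (\<lambda>x. v (t + x) - v x)}"

text \<open>The perturbed convolution minus the original is the convolution of w with a kernel that
  is uniformly small and supported in a fixed compact set.\<close>

lemma conv_controlled_in_W:
  assumes w: "controlled w" and \<psi>: "\<psi> \<in> C_c"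
  shows "conv \<psi> w \<in> W"
proof -
  have wL: "w \<in> L_infty" using w by (simp add: controlled_def)
  obtain K where K: "compact K"
    "\<And>e. 0 < e \<Longrightarrow> \<forall>\<^sub>F t in nhds 0. \<forall>x. \<bar>\<psi> (t + x) - \<psi> x\<bar> \<le> e * indicator K x"
    using small_left_translate[OF \<psi>] by blast
  obtain C where C: "0 \<le> C" "\<And>\<psi> e. \<psi> \<in> C_c \<Longrightarrow> 0 < e \<Longrightarrow> (\<forall>x. \<bar>\<psi> x\<bar> \<le> e * indicator K x) \<Longrightarrow>
    dominated_by top f\<^sub>0 (C * e) (conv \<psi> w)"
    using controlled_bound[OF w K(1)] by metis
  have "\<forall>\<^sub>F t in nhds 0. dominated_by top f\<^sub>0 e (\<lambda>x. conv \<psi> w (t + x) - conv \<psi> w x)" if e: "0 < e" for e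
  proof -
    define d where "d = e / (C + 1)"
    have d: "0 < d" using e C(1) by (simp add: d_def)
    have Cd: "C * d \<le> e" using e C(1) by (simp add: d_def field_simps)
    show ?thesis
      using K(2)[OF d]
    proof eventually_elim
      case (elim t)
      have tr: "ltrans (- t) \<psi> \<in> C_c" by (rule C_c_ltrans[OF \<psi>])
      have "conv (\<lambda>x. 1 * ltrans (- t) \<psi> x + (-1) * \<psi> x) w = (\<lambda>x. conv \<psi> w (t + x) - conv \<psi> w x)"
        by (rule ext) (subst conv_comb_left[OF tr \<psi> wL], simp add: conv_ltrans[OF wL \<psi>], simp add: ltrans_def)
      moreover have "dominated_by top f\<^sub>0 (C * d) (conv (\<lambda>x. 1 * ltrans (- t) \<psi> x + (-1) * \<psi> x) w)"
        by (rule C(2)[OF C_c_comb[OF tr \<psi>] d]) (use elim in \<open>simp add: ltrans_def\<close>)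
      ultimately show ?case using Cd dominated_by_mono by fastforce
    qed
  qed
  then show ?thesis using conv_controlled_in_D[OF w \<psi>] by (simp add: W_def)
qed

text \<open>The inverse in the orbit function makes a left perturbation t of s act directly on w:
  the difference of the values is J at the translate by s^-1 of t^-1 w - w. Domination is
  translation invariant, so the bound is uniform in s.\<close>

lemma orbit_left_uniform:
  assumes J: "translate_functional top f\<^sub>0 J" and w: "w \<in> W"
  shows "bounded (range (\<lambda>s. J (ltrans (- s) w) + c))" "left_uniform (\<lambda>s. J (ltrans (- s) w) + c)"
proof -
  have wD: "w \<in> D" using w by (simp add: W_def)
  then obtain C where C: "dominated_by top f\<^sub>0 C w" by (auto simp: dominated_space_def)
  have "\<bar>J (ltrans (- s) w)\<bar> \<le> C" for s
    by (rule translate_functional_bound[OF left_invariant_top f0_nonneg J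
          dominated_by_ltrans[OF left_invariant_top C]])
  then have "\<bar>J (ltrans (- s) w) + c\<bar> \<le> C + \<bar>c\<bar>" for s
    using abs_triangle_ineq[of "J (ltrans (- s) w)" c] by (smt (verit))
  then show "bounded (range (\<lambda>s. J (ltrans (- s) w) + c))" by (auto simp: bounded_iff)
  show "left_uniform (\<lambda>s. J (ltrans (- s) w) + c)"
    unfolding left_uniform_def
  proof (intro allI impI)
    fix e :: real assume "0 < e"
    then have "\<forall>\<^sub>F t in nhds 0. dominated_by top f\<^sub>0 e (\<lambda>x. w (t + x) - w x)"
      using w by (simp add: W_def)
    then show "\<forall>\<^sub>F t in nhds 0. \<forall>s. \<bar>J (ltrans (- (t + s)) w) + c - (J (ltrans (- s) w) + c)\<bar> \<le> e"
    proof eventually_elim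
      case (elim t)
      show ?case
      proof
        fix s
        have "(\<lambda>x. ltrans (- (t + s)) w x - ltrans (- s) w x) = ltrans (- s) (\<lambda>x. w (t + x) - w x)"
          by (simp add: ltrans_def add.assoc)
        then have "\<bar>J (\<lambda>x. ltrans (- (t + s)) w x - ltrans (- s) w x)\<bar> \<le> e"
          using translate_functional_bound[OF left_invariant_top f0_nonneg J
              dominated_by_ltrans[OF left_invariant_top elim, of "- s"]] by simp
        moreover have "J (\<lambda>x. ltrans (- (t + s)) w x - ltrans (- s) w x) = J (ltrans (- (t + s)) w) - J (ltrans (- s) w)"
          using linear_functional_diff[OF _ function_space_dominated
              dominated_space_ltrans[OF left_invariant_top wD] dominated_space_ltrans[OF left_invariant_top wD]] J
          by (simp add: translate_functional_def)
        ultimately show "\<bar>J (ltrans (- (t + s)) w) + c - (J (ltrans (- s) w) + c)\<bar> \<le> e" by simp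
      qed
    qed
  qed
qed

lemma invariant_functional:
  obtains J where "translate_functional top f\<^sub>0 J" "invariant_on W J"
proof (rule invariant_translate_functional[OF left_invariant_top f0_nonneg f0_translates])
  show "W \<subseteq> D" by (auto simp: W_def)
  show "translates_nonneg_weight top (\<lambda>s. J (ltrans (- s) w) + c)"
    if "translate_functional top f\<^sub>0 J" "w \<in> W" "\<And>s. 1 \<le> J (ltrans (- s) w) + c" for J w c
    using that by (intro translates_nonneg_weight_left_uniform[OF T] orbit_left_uniform)
qed (rule that)

text \<open>Smoothing turns domination almost everywhere by translates of f into domination
  everywhere by translates of u.\<close>

lemma rconv_controlled:
  assumes "h \<in> dominated (ae_filter m) L_infty f"
  shows "controlled (rconv k h)"
proof -
  have h: "h \<in> L_infty" "h \<in> dominated_space (ae_filter m) f"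
    using assms dominated_eq[OF left_invariant_ae, of f L_infty] f(2) by (auto simp: nonneg_in_def)
  then obtain ts where "AE x in m. \<bar>h x\<bar> \<le> translate_sum ts f x"
    by (auto simp: dominated_space_def dominated_by_def)
  then have "\<bar>rconv k h x\<bar> \<le> rconv k (translate_sum ts f) x" for x
    by (intro rconv_abs_le k h translate_sum_L_infty f)
  then show ?thesis
    unfolding rconv_translate_sum[OF k(1) f(1)] controlled_def u_def[symmetric]
    using rconv_L_infty[OF k(1) h(1)] by blast
qed

text \<open>Translating the kernel translates the convolution, which lies in W; so the invariance of
  J on W is exactly left invariance in \<psi>.\<close>

lemma conv_functional:
  assumes J: "translate_functional top f\<^sub>0 J" "invariant_on W J" and w: "controlled w"
  shows "locally_bounded_functional (\<lambda>\<psi>. J (conv \<psi> w))"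
  unfolding locally_bounded_functional_def
proof (intro conjI allI impI)
  have wL: "w \<in> L_infty" using w by (simp add: controlled_def)
  have lin: "linear_functional D J" using J by (simp add: translate_functional_def)
  {
    show "linear_functional C_c (\<lambda>\<psi>. J (conv \<psi> w))"
    proof (rule linear_functionalI)
      fix \<psi> \<psi>' :: "'a \<Rightarrow> real" and a b
      assume *: "\<psi> \<in> C_c" "\<psi>' \<in> C_c"
      note in_D = conv_controlled_in_D[OF w *(1)] conv_controlled_in_D[OF w *(2)]
      have "conv (\<lambda>x. a * \<psi> x + b * \<psi>' x) w = (\<lambda>x. a * conv \<psi> w x + b * conv \<psi>' w x)"
        by (rule ext) (rule conv_comb_left[OF * wL])
      then show "J (conv (\<lambda>x. a * \<psi> x + b * \<psi>' x) w) = a * J (conv \<psi> w) + b * J (conv \<psi>' w)"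
        using linear_functional_comb[OF lin function_space_dominated in_D] by simp
    qed
  next
    fix g and \<psi> :: "'a \<Rightarrow> real" assume \<psi>: "\<psi> \<in> C_c"
    show "J (conv (ltrans g \<psi>) w) = J (conv \<psi> w)"
      using J(2) conv_controlled_in_W[OF w \<psi>] by (simp add: conv_ltrans[OF wL \<psi>] invariant_on_def)
  next
    fix K :: "'a set" assume "compact K"
    then obtain C where C: "\<And>\<psi> e. \<psi> \<in> C_c \<Longrightarrow> 0 < e \<Longrightarrow> (\<forall>x. \<bar>\<psi> x\<bar> \<le> e * indicator K x) \<Longrightarrow>
      dominated_by top f\<^sub>0 (C * e) (conv \<psi> w)"
      using controlled_bound[OF w] by metis
    show "\<exists>C. \<forall>\<psi> e. \<psi> \<in> C_c \<longrightarrow> 0 < e \<longrightarrow>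
        (\<forall>x. \<bar>\<psi> x\<bar> \<le> e * indicator K x) \<longrightarrow> \<bar>J (conv \<psi> w)\<bar> \<le> C * e"
      using translate_functional_bound[OF left_invariant_top f0_nonneg J(1)] C by blast
  }
qed

lemma invariant_integral_exists: "\<exists>I. invariant_normalized_integral (ae_filter m) L_infty f I"
proof -
  obtain J where J: "translate_functional top f\<^sub>0 J" "invariant_on W J" by (rule invariant_functional)
  have lin: "linear_functional D J" and posJ: "\<And>v. v \<in> D \<Longrightarrow> nonneg_in top v \<Longrightarrow> 0 \<le> J v"
    and J1: "J (ltrans 0 f\<^sub>0) = 1"
    using J unfolding translate_functional_def by blast+
  let ?D = "dominated (ae_filter m) L_infty f"
  define I where "I h = J (conv \<phi> (rconv k h))" for h
  have fn: "nonneg_in (ae_filter m) f" using f(2) by (simp add: nonneg_in_def)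
  have DL: "h \<in> L_infty" if "h \<in> ?D" for h using that by (simp add: dominated_def)
  have inD: "conv \<phi> (rconv k h) \<in> D" if "h \<in> ?D" for h
    by (rule conv_controlled_in_D[OF rconv_controlled[OF that] \<phi>(1)])
  have rL: "rconv k h \<in> L_infty" if "h \<in> ?D" for h by (rule rconv_L_infty[OF k(1) DL[OF that]])
  have "invariant_normalized_integral (ae_filter m) L_infty f I"
  proof (rule invariant_normalized_integralI[OF left_invariant_ae function_space_L_infty fn])
    show "linear_functional ?D I"
    proof (rule linear_functionalI)
      fix h h' a b assume h: "h \<in> ?D" "h' \<in> ?D"
      have "rconv k (\<lambda>x. a * h x + b * h' x) = (\<lambda>x. a * rconv k h x + b * rconv k h' x)"
        by (intro ext rconv_comb k DL h)
      then have "conv \<phi> (rconv k (\<lambda>x. a * h x + b * h' x)) = (\<lambda>x. a * conv \<phi> (rconv k h) x + b * conv \<phi> (rconv k h') x)"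
        using conv_comb_right[OF \<phi>(1) rL[OF h(1)] rL[OF h(2)]] by (intro ext) simp
      then show "I (\<lambda>x. a * h x + b * h' x) = a * I h + b * I h'"
        using linear_functional_comb[OF lin function_space_dominated inD[OF h(1)] inD[OF h(2)]] by (simp add: I_def)
    qed
  next
    fix h assume h: "h \<in> ?D" "nonneg_in (ae_filter m) h"
    have "rconv k (\<lambda>x. 0) x \<le> rconv k h x" for x
      using h by (intro rconv_mono k DL L_infty_const) (simp_all add: nonneg_in_def)
    then have "0 \<le> rconv k h x" for x by (simp add: rconv_def)
    then have "nonneg_in top (conv \<phi> (rconv k h))"
      using \<phi>(2) by (auto simp: nonneg_in_def conv_def)
    then show "0 \<le> I h" unfolding I_def by (rule posJ[OF inD[OF h(1)]])
  next
    show "I f = 1" using J1 by (simp add: I_def f\<^sub>0_def u_def)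
  next
    fix g h assume h: "h \<in> ?D"
    let ?w = "rconv k h"
    let ?\<phi>' = "\<lambda>z. \<phi> (z + - g)"
    have w: "controlled ?w" by (rule rconv_controlled[OF h])
    have wc: "continuous_on UNIV ?w"
      by (intro right_uniform_imp_continuous rconv_right_uniform k DL h)
    have \<phi>': "?\<phi>' \<in> C_c" by (rule C_c_right[OF \<phi>(1)])
    define A where "A = (\<integral>z. ?\<phi>' z \<partial>m)"
    define B where "B = (\<integral>z. \<phi> z \<partial>m)"
    have A: "0 < A" unfolding A_def
      using \<phi>' \<phi> by (intro integral_positive[OF integrable_C_c, where a=g])
        (auto simp: C_c_def)
    \<comment> \<open>Moving g from the smoothed function to the kernel costs the factor B/A.
      Uniqueness, applied to \<psi> \<mapsto> J(\<psi> * w), shows that the right translate of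
      \<phi> contributes A/B, and the factors cancel.\<close>
    have "conv \<phi> (ltrans g ?w) x * A = B * conv ?\<phi>' ?w x" for x
      unfolding A_def B_def by (rule conv_ltrans_right[OF \<phi>(1) rL[OF h] wc])
    then have "conv \<phi> (ltrans g ?w) = (\<lambda>x. B / A * conv ?\<phi>' ?w x)"
      using A by (simp add: fun_eq_iff field_simps)
    then have "I (ltrans g h) = B / A * J (conv ?\<phi>' ?w)"
      by (simp only: I_def rconv_ltrans linear_functional_scale[OF lin conv_controlled_in_D[OF w \<phi>']])
    moreover have "J (conv ?\<phi>' ?w) * B = J (conv \<phi> ?w) * A"
      unfolding A_def B_def
      by (rule locally_bounded_functional_unique[OF conv_functional[OF J w] \<phi>' \<phi>(1)])
    ultimately show "I (ltrans g h) = I h" using A by (simp add: I_def field_simps)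
  qed
  then show ?thesis by blast
qed

end

context haar_group
begin

text \<open>The kernel is taken to be at least 1 on K, so that the smoothing of f at 0, the integral
  of f k, is positive.\<close>

lemma invariant_integral_exists_locally_nonnull:
  assumes T: "translate_property top (C_b_u :: ('a \<Rightarrow> real) set)"
    and f: "f \<in> L_infty" "AE x in m. 0 \<le> f x"
    and K: "compact K" "\<not> (AE x in m. x \<in> K \<longrightarrow> f x = 0)"
  shows "\<exists>I. invariant_normalized_integral (ae_filter m) L_infty f I"
proof -
  obtain \<phi> :: "'a \<Rightarrow> real" where \<phi>: "\<phi> \<in> C_c" "\<And>x. 0 \<le> \<phi> x" "\<phi> 0 = 1"
    using bump_function[of UNIV] by auto
  obtain k where k: "k \<in> C_c" "\<And>x. indicator K x \<le> k x" "\<And>x. 0 \<le> k x"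
    using C_c_majorant[OF K(1)] by metis
  have "0 < rconv k f 0"
  proof (rule ccontr)
    assume n: "\<not> 0 < rconv k f 0"
    have i: "integrable m (\<lambda>w. f w * k w)" by (rule integrable_product[OF k(1) f(1)])
    have nn: "AE w in m. 0 \<le> f w * k w" using f(2) k(3) by (auto elim: eventually_mono)
    have "0 \<le> (\<integral>w. f w * k w \<partial>m)" by (rule integral_nonneg_AE[OF nn])
    then have "(\<integral>w. f w * k w \<partial>m) = 0" using n by (simp add: rconv_def)
    then have "AE w in m. f w * k w = 0"
      using integral_nonneg_eq_0_iff_AE[OF i nn] by simp
    moreover have "k w \<noteq> 0" if "w \<in> K" for w using k(2)[of w] that by auto
    ultimately have "AE x in m. x \<in> K \<longrightarrow> f x = 0" by (auto elim: eventually_mono)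
    then show False using K(2) by simp
  qed
  then interpret regularized m f k \<phi>
    using f k \<phi> T by unfold_locales auto
  show ?thesis by (rule invariant_integral_exists)
qed

end

section \<open>Functions that vanish almost everywhere on every compact set\<close>

definition generated :: "'a::group_add set \<Rightarrow> 'a set" where
  "generated A = sum_list ` lists (A \<union> uminus ` A)"

lemma generated_zero: "0 \<in> generated A"
  unfolding generated_def by (rule image_eqI[of _ _ "[]"]) auto

lemma generated_add:
  assumes "x \<in> generated A" "y \<in> generated A"
  shows "x + y \<in> generated A"
proof -
  obtain xs ys where *: "xs \<in> lists (A \<union> uminus ` A)" "ys \<in> lists (A \<union> uminus ` A)"
    "x = sum_list xs" "y = sum_list ys"
    using assms unfolding generated_def by blast
  show ?thesis unfolding generated_def
    by (rule image_eqI[of _ _ "xs @ ys"]) (use * in auto)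
qed

lemma generated_incl: "a \<in> A \<Longrightarrow> a \<in> generated A"
  unfolding generated_def by (rule image_eqI[of _ _ "[a]"]) auto

lemma generated_minus:
  assumes "x \<in> generated A"
  shows "- x \<in> generated A"
proof -
  obtain xs where xs: "xs \<in> lists (A \<union> uminus ` A)" "x = sum_list xs"
    using assms unfolding generated_def by blast
  have "- sum_list xs = sum_list (map uminus (rev xs))"
    by (induction xs) (auto simp: minus_add simp del: add_uminus_conv_diff)
  moreover have "map uminus (rev xs) \<in> lists (A \<union> uminus ` A)"
    using xs(1) by (force simp: in_lists_conv_set)
  ultimately show ?thesis unfolding generated_def xs(2) by blast
qed

lemma generated_mono: "A \<subseteq> B \<Longrightarrow> generated A \<subseteq> generated B"
  unfolding generated_def by (intro image_mono lists_mono) auto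

lemma countable_generated: "countable A \<Longrightarrow> countable (generated A)"
  unfolding generated_def by (intro countable_image countable_lists countable_Un)

lemma generated_sigma_compact:
  fixes A :: "'a::topological_group_add set"
  assumes "compact A"
  obtains P :: "nat \<Rightarrow> 'a set" where "\<And>n. compact (P n)" "generated A = (\<Union>n. P n)"
proof -
  define B where "B = A \<union> uminus ` A"
  have B: "compact B" unfolding B_def using assms
    by (intro compact_Un compact_continuous_image) (auto intro!: continuous_intros)
  define P where "P n = sum_list ` {xs \<in> lists B. length xs = n}" for n
  have "compact (P n)" for n
  proof (induction n)
    case 0
    have "P 0 = {0}" by (auto simp: P_def image_iff)
    then show ?case by simp
  next
    case (Suc n)
    have "P (Suc n) = (\<lambda>p. fst p + snd p) ` (B \<times> P n)"
    proof (intro equalityI subsetI)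
      fix x assume "x \<in> P (Suc n)"
      then obtain ys where ys: "ys \<in> lists B" "length ys = Suc n" "x = sum_list ys"
        by (auto simp: P_def)
      obtain a xs where "ys = a # xs" using ys(2) by (cases ys) auto
      with ys have "a \<in> B" "xs \<in> lists B" "length xs = n" "x = a + sum_list xs" by auto
      then show "x \<in> (\<lambda>p. fst p + snd p) ` (B \<times> P n)"
        by (intro image_eqI[of _ _ "(a, sum_list xs)"]) (auto simp: P_def)
    next
      fix x assume "x \<in> (\<lambda>p. fst p + snd p) ` (B \<times> P n)"
      then obtain a y where ay: "a \<in> B" "y \<in> P n" "x = a + y" by auto
      then obtain xs where "xs \<in> lists B" "length xs = n" "y = sum_list xs" by (auto simp: P_def)
      with ay show "x \<in> P (Suc n)" unfolding P_def
        by (intro image_eqI[of _ _ "a # xs"]) auto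
    qed
    then show ?case using Suc B
      by (auto intro!: compact_continuous_image compact_Times continuous_intros)
  qed
  moreover have "generated A = (\<Union>n. P n)" by (auto simp: P_def generated_def B_def)
  ultimately show ?thesis by (rule that)
qed

lemma open_generated:
  fixes A :: "'a::topological_group_add set"
  assumes "open U" "0 \<in> U" "U \<subseteq> A"
  shows "open (generated A)"
proof -
  have "generated A = (\<Union>h\<in>generated A. (\<lambda>x. - h + x) -` U)"
  proof (intro equalityI subsetI)
    fix x assume "x \<in> generated A"
    then show "x \<in> (\<Union>h\<in>generated A. (\<lambda>x. - h + x) -` U)"
      using assms(2) by (auto intro!: bexI[of _ x])
  next
    fix x assume "x \<in> (\<Union>h\<in>generated A. (\<lambda>x. - h + x) -` U)"
    then obtain h where "h \<in> generated A" "- h + x \<in> generated A"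
      using assms(3) generated_incl by auto
    then have "h + (- h + x) \<in> generated A" by (rule generated_add)
    then show "x \<in> generated A" by simp
  qed
  moreover have "open ((\<lambda>x. - h + x) -` U)" for h
    by (intro open_vimage assms continuous_intros)
  ultimately show ?thesis by (metis open_UN)
qed

context haar_group
begin

text \<open>The measure on U is pushed forward along p to the discrete space. Each r in R becomes an
  atom, because U meets the fibre over r in a non-empty open set, and a finite measure has only
  countably many atoms.\<close>

lemma countable_open_fibres:
  fixes p :: "'a \<Rightarrow> 'a"
  assumes op: "\<And>B. open (p -` B)" and U: "open U" "emeasure m U < \<infinity>" "R \<subseteq> U" "\<And>r. r \<in> R \<Longrightarrow> p r = r"
  shows "countable R"
proof -
  define M where "M = distr (density m (indicator U)) (count_space UNIV) p"
  have [measurable]: "U \<in> sets m" using U(1) by simp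
  have pm [measurable]: "p \<in> measurable m (count_space UNIV)"
    by (rule measurableI) (use op in auto)
  have em: "emeasure M B = emeasure m (U \<inter> p -` B)" for B
  proof -
    have pB: "p -` B \<in> sets m" using op by simp
    have "emeasure M B = emeasure (density m (indicator U)) (p -` B)"
      unfolding M_def using pm by (subst emeasure_distr) auto
    also have "\<dots> = (\<integral>\<^sup>+x. indicator U x * indicator (p -` B) x \<partial>m)"
      using pB by (intro emeasure_density) auto
    also have "\<dots> = (\<integral>\<^sup>+x. indicator (U \<inter> p -` B) x \<partial>m)"
      by (simp add: indicator_inter_arith)
    also have "\<dots> = emeasure m (U \<inter> p -` B)"
      using pB \<open>U \<in> sets m\<close> by (intro nn_integral_indicator) auto
    finally show ?thesis .
  qed
  interpret M: finite_measure M
    by (rule finite_measureI) (use em[of UNIV] U(2) in \<open>auto simp: M_def less_top\<close>)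
  have "measure M {r} \<noteq> 0" if "r \<in> R" for r
  proof -
    have "0 < emeasure m (U \<inter> p -` {r})"
      using that U by (intro open_positive open_Int op) auto
    then show ?thesis using em[of "{r}"] M.emeasure_eq_measure[of "{r}"] by auto
  qed
  then have "R \<subseteq> {r. measure M {r} \<noteq> 0}" by blast
  then show ?thesis using M.countable_support countable_subset by blast
qed

text \<open>Under these hypotheses countably many translated compact sets cover G. Read the other
  way, it makes the transversal uncountable when f is locally null but not null.\<close>

lemma null_of_countable_cosets:
  assumes null: "\<And>K. compact K \<Longrightarrow> AE x in m. x \<in> K \<longrightarrow> f x = 0"
    and P: "\<And>n. compact (P n :: 'a set)" and R: "countable R" and cover: "\<And>x. \<exists>r\<in>R. \<exists>n::nat. x - r \<in> P n"
  shows "AE x in m. f x = (0::real)"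
proof -
  have "AE x in m. x - r \<in> P n \<longrightarrow> f x = 0" for r n
  proof -
    have "compact ((\<lambda>x. x + r) ` P n)" by (intro compact_continuous_image P continuous_intros)
    from null[OF this] show ?thesis
      by (rule eventually_mono) (metis diff_add_cancel imageI)
  qed
  then have "\<forall>r\<in>R. AE x in m. \<forall>n. x - r \<in> P n \<longrightarrow> f x = 0"
    by (simp only: AE_all_countable) blast
  then have "AE x in m. \<forall>r\<in>R. \<forall>n. x - r \<in> P n \<longrightarrow> f x = 0"
    unfolding AE_ball_countable[OF R] .
  then show ?thesis by (rule eventually_mono) (use cover in blast)
qed

text \<open>Let \<open>H\<close> be an open \<open>\<sigma>\<close>-compact subgroup containing the group elements of \<open>ts\<close>, let \<open>Q \<subseteq> H\<close>
  be the countable subgroup which they generate and \<open>R\<close> a transversal of the right cosets of \<open>H\<close>.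
  As \<open>f\<close> is not null, \<open>R\<close> is uncountable, and \<open>N = Q + R\<close> has infinite measure although all of its
  subsets are Borel. The function equal to \<open>b\<close> on the \<open>Q\<close>-invariant set \<open>N\<close> and to \<open>0\<close> elsewhere
  therefore represents a non-zero element of \<open>L\<^sup>\<infinity>\<close>.\<close>

lemma translates_nonneg_weight_locally_null:
  assumes T: "translate_property (ae_filter m) L_infty"
    and f: "f \<in> nonzero_nonneg (ae_filter m) L_infty"
    and null: "\<And>K. compact K \<Longrightarrow> AE x in m. x \<in> K \<longrightarrow> f x = 0"
    and b: "\<And>x :: 'a. 1 \<le> b x" "\<And>x. \<bar>b x\<bar> \<le> C"
  shows "translates_nonneg_weight top b"
  unfolding translates_nonneg_weight_def
proof (intro allI impI)
  fix ts :: "(real \<times> 'a) list"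
  assume nn: "nonneg_in top (translate_sum ts b)"
  define S where "S = snd ` set ts"
  obtain U V :: "'a set" where UV: "open U" "0 \<in> U" "U \<subseteq> V" "compact V" by (rule compact_neighbourhood)
  define H where "H = generated (S \<union> V)"
  define Q where "Q = generated S"
  have QH: "Q \<subseteq> H" unfolding Q_def H_def by (rule generated_mono) auto
  have opH: "open H" unfolding H_def using UV by (intro open_generated[of U]) auto
  have "compact (S \<union> V)" using UV by (intro compact_Un[OF finite_imp_compact]) (auto simp: S_def)
  then obtain P :: "nat \<Rightarrow> 'a set" where P: "\<And>n. compact (P n)" "H = (\<Union>n. P n)"
    unfolding H_def by (metis generated_sigma_compact)
  have Hadd: "x + y \<in> H" if "x \<in> H" "y \<in> H" for x y using that unfolding H_def by (rule generated_add)
  have Hdiff: "x - y \<in> H" if "y - x \<in> H" for x y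
    using generated_minus[of "y - x" "S \<union> V"] that unfolding H_def by simp
  have Htrans: "x - z \<in> H" if "x - y \<in> H" "y - z \<in> H" for x y z
    using Hadd[OF that] by (simp add: diff_add_eq add.assoc[symmetric] add_diff_eq)
  \<comment> \<open>The predicate is the same for all points of the right coset of x, so the choice
    operator picks one representative for the whole coset.\<close>
  define rep where "rep x = (SOME y. y - x \<in> H)" for x
  have rep: "rep x - x \<in> H" for x
    unfolding rep_def by (rule someI[of _ x]) (simp add: H_def generated_zero)
  have rep_eq: "rep x = rep y" if "x - y \<in> H" for x y
  proof -
    have "(z - x \<in> H) = (z - y \<in> H)" for z using that Hdiff Htrans by blast
    then show ?thesis by (simp add: rep_def)
  qed
  have rep_iff: "rep x = rep y \<longleftrightarrow> x - y \<in> H" for x y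
    using rep_eq rep Hdiff Htrans by metis
  have rep_rep: "rep (rep x) = rep x" for x using rep by (simp add: rep_iff)
  have rep_add: "rep (h + x) = rep x" if "h \<in> H" for h x using that by (simp add: rep_iff)
  have open_rep: "open (rep -` B)" for B
  proof -
    have "rep -` B = (\<Union>y\<in>rep -` B. (\<lambda>z. z - y) -` H)"
      using rep_iff by (auto simp: H_def generated_zero)
    moreover have "open ((\<lambda>z. z - y) -` H)" for y by (intro open_vimage opH continuous_intros)
    ultimately show ?thesis by (metis open_UN)
  qed
  \<comment> \<open>The fibres of \<open>rep\<close> are open, and A meets the fibre of x in at most
    the point q + rep x. Removing that point leaves a neighbourhood of x that misses A.\<close>
  have closed_piece: "closed A" if A: "\<And>x. x \<in> A \<Longrightarrow> x - rep x = q" for A q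
    unfolding closed_def
  proof (subst open_subopen, intro ballI)
    fix x assume x: "x \<in> - A"
    let ?T = "rep -` {rep x} - ({q + rep x} \<inter> A)"
    have "open ?T" by (intro open_Diff open_rep) (auto intro: finite_imp_closed)
    moreover have "?T \<subseteq> - A"
    proof (intro subsetI ComplI)
      fix z assume z: "z \<in> ?T" "z \<in> A"
      then have "z = q + rep x" using A[of z] by (auto simp: diff_eq_eq)
      then show False using z by simp
    qed
    ultimately show "\<exists>T. open T \<and> x \<in> T \<and> T \<subseteq> - A" using x by (intro exI[of _ ?T]) auto
  qed
  define N where "N = {x. x - rep x \<in> Q}"
  have sets_N: "A \<in> sets borel" if "A \<subseteq> N" for A
  proof -
    have "A = (\<Union>q\<in>Q. {x \<in> A. x - rep x = q})" using that by (auto simp: N_def)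
    moreover have "(\<Union>q\<in>Q. {x \<in> A. x - rep x = q}) \<in> sets borel"
    proof (rule sets.countable_UN')
      show "countable Q" unfolding Q_def S_def by (intro countable_generated countable_finite) simp
      have "closed {x \<in> A. x - rep x = q}" for q by (rule closed_piece[where q=q]) simp
      then show "(\<lambda>q. {x \<in> A. x - rep x = q}) ` Q \<subseteq> sets borel" by auto
    qed
    ultimately show ?thesis by simp
  qed
  \<comment> \<open>g lies in Q and Q in H, so translation by -g keeps the coset representative and
    moves x - rep x within Q.\<close>
  have N_inv: "- g + x \<in> N \<longleftrightarrow> x \<in> N" if "g \<in> S" for g x
  proof -
    have g: "g \<in> Q" "- g \<in> Q" using that by (auto simp: Q_def intro: generated_incl generated_minus)
    have "rep (- g + x) = rep x" using rep_add g(2) QH by blast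
    then have "- g + x - rep (- g + x) = - g + (x - rep x)" by (simp add: add_diff_eq)
    moreover have "- g + y \<in> Q \<longleftrightarrow> y \<in> Q" for y
      using generated_add[of g S "- g + y"] generated_add[of "- g" S y] g by (auto simp: Q_def)
    ultimately show ?thesis by (simp add: N_def)
  qed
  define f1 where "f1 x = (if x \<in> N then b x else 0)" for x
  have f1_meas: "f1 \<in> borel_measurable borel"
  proof (rule measurableI)
    fix B :: "real set"
    have "f1 -` B = {x \<in> N. b x \<in> B} \<union> (if 0 \<in> B then - N else {})"
      by (auto simp: f1_def split: if_splits)
    moreover have "{x \<in> N. b x \<in> B} \<in> sets borel" "- N \<in> sets borel"
      using sets_N[of N] by (auto intro: sets_N borel_comp)
    ultimately show "f1 -` B \<inter> space borel \<in> sets borel" by auto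
  qed auto
  have f1_bound: "\<bar>f1 x\<bar> \<le> C" for x using b(2)[of x] by (auto simp: f1_def)
  have f1L: "f1 \<in> L_infty" by (rule L_inftyI[OF f1_meas f1_bound])
  have f1_nonneg: "0 \<le> f1 x" for x using b(1)[of x] by (auto simp: f1_def)
  have "\<not> (AE x in m. f1 x = 0)"
  proof
    assume "AE x in m. f1 x = 0"
    moreover have "x \<notin> range rep" if "f1 x = 0" for x
    proof
      assume "x \<in> range rep"
      then have "x \<in> N" by (auto simp: N_def rep_rep Q_def generated_zero)
      then show False using b(1)[of x] that by (simp add: f1_def)
    qed
    ultimately have "AE x in m. x \<notin> range rep" by (auto elim: eventually_mono)
    moreover have sR: "range rep \<in> sets borel"
      by (rule sets_N) (auto simp: N_def rep_rep Q_def generated_zero)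
    ultimately have "emeasure m (range rep) = 0"
      by (subst AE_iff_measurable[symmetric, where P="\<lambda>x. x \<notin> range rep"]) auto
    \<comment> \<open>Outer regularity encloses the supposedly null transversal in an open set of
      finite measure; as the cosets are open, the transversal is then countable.\<close>
    then have "(INF U\<in>{U. open U \<and> range rep \<subseteq> U}. emeasure m U) < 1"
      using haar sR by (simp add: left_haar_measure_def)
    then obtain O' where O': "open O'" "range rep \<subseteq> O'" "emeasure m O' < 1"
      by (auto simp: INF_less_iff)
    have "emeasure m O' < \<infinity>" using O'(3) by (rule less_trans) simp
    then have "countable (range rep)"
      using O' rep_rep by (intro countable_open_fibres[of rep O'] open_rep) auto
    moreover have "\<exists>r\<in>range rep. \<exists>n. x - r \<in> P n" for x
      using Hdiff[OF rep[of x]] unfolding P(2) by blast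
    ultimately have "AE x in m. f x = 0"
      by (intro null_of_countable_cosets[where P=P and R="range rep"] null P(1)) blast+
    then show False using f by (simp add: nonzero_nonneg_def eq_in_def)
  qed
  then have "f1 \<in> nonzero_nonneg (ae_filter m) L_infty"
    using f1L f1_nonneg by (simp add: nonzero_nonneg_def nonneg_in_def eq_in_def)
  then have T1: "translates_nonneg_weight (ae_filter m) f1" by (rule translate_property_weight[OF T])
  have "translate_sum ts f1 x = (if x \<in> N then translate_sum ts b x else 0)" for x
  proof -
    have "(\<Sum>p\<leftarrow>ts. fst p * ltrans (snd p) f1 x)
        = (\<Sum>p\<leftarrow>ts. if x \<in> N then fst p * ltrans (snd p) b x else 0)"
      using N_inv by (intro arg_cong[where f=sum_list] map_cong refl) (auto simp: f1_def ltrans_def S_def)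
    then show ?thesis by (simp add: translate_sum_def)
  qed
  then have "0 \<le> translate_sum ts f1 x" for x using nn by (simp add: nonneg_in_def)
  then show "0 \<le> weight ts" using T1 by (auto simp: translates_nonneg_weight_def nonneg_in_def)
qed

text \<open>Orbit functions are bounded, and here boundedness is enough for the averaging step.
  Hence J can be made invariant on the whole dominated space, with no restriction to continuous
  orbits.\<close>

lemma invariant_integral_exists_locally_null:
  assumes T: "translate_property (ae_filter m) L_infty"
    and f: "f \<in> nonzero_nonneg (ae_filter m) L_infty"
    and null: "\<And>K. compact K \<Longrightarrow> AE x in m. x \<in> K \<longrightarrow> f x = 0"
  shows "\<exists>I. invariant_normalized_integral (ae_filter m) L_infty f I"
proof -
  let ?D = "dominated_space (ae_filter m) f"
  have fn: "nonneg_in (ae_filter m) f" using f by (simp add: nonzero_nonneg_def)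
  obtain J where J: "translate_functional (ae_filter m) f J" "invariant_on ?D J"
  proof (rule invariant_translate_functional[OF left_invariant_ae fn translate_property_weight[OF T f]])
    fix J w c assume *: "translate_functional (ae_filter m) f J" "w \<in> ?D" "\<And>s. 1 \<le> J (ltrans (- s) w) + c"
    then obtain C where C: "dominated_by (ae_filter m) f C w" by (auto simp: dominated_space_def)
    have "\<bar>J (ltrans (- s) w)\<bar> \<le> C" for s
      by (rule translate_functional_bound[OF left_invariant_ae fn *(1) dominated_by_ltrans[OF left_invariant_ae C]])
    then have bd: "\<bar>J (ltrans (- s) w) + c\<bar> \<le> C + \<bar>c\<bar>" for s
      by (rule order_trans[OF abs_triangle_ineq add_right_mono])
    show "translates_nonneg_weight top (\<lambda>s. J (ltrans (- s) w) + c)"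
      by (rule translates_nonneg_weight_locally_null[OF T f, where C="C + \<bar>c\<bar>"])
        (use null *(3) bd in auto)
  qed auto
  have D: "dominated (ae_filter m) L_infty f \<subseteq> ?D" using dominated_eq[OF left_invariant_ae fn] by blast
  have "J f = 1" using J(1) ltrans_zero[of f] unfolding translate_functional_def by metis
  then have "invariant_normalized_integral (ae_filter m) L_infty f J"
    using J D by (intro invariant_normalized_integralI[OF left_invariant_ae function_space_L_infty fn])
      (auto simp: translate_functional_def linear_functional_def invariant_on_def subset_iff)
  then show ?thesis by blast
qed

section \<open>Comparison of \<open>L_infty\<close> with the spaces of continuous functions\<close>

lemma open_not_null:
  assumes "open U" "a \<in> U" "AE x in m. x \<notin> (U :: 'a set)"
  shows False
proof -
  have "emeasure m U = 0"
    using assms by (subst AE_iff_measurable[symmetric, where P="\<lambda>x. x \<notin> U"]) auto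
  then show False using open_positive[OF assms(1)] assms(2) by auto
qed

text \<open>A continuous function that is positive at a point is positive on an open set inside a
  compact one, and such a set is not null. The locally null case therefore arises for
  \<open>L_infty\<close> only.\<close>

lemma nonzero_continuous_nonnull:
  assumes f: "continuous_on UNIV f" "nonneg_in top f" "\<not> eq_in top f (\<lambda>x. 0)"
  obtains K where "compact K" "\<not> (AE x in m. x \<in> K \<longrightarrow> f x = 0)"
proof -
  obtain a where a: "0 < f a" using f(2,3) by (auto simp: nonneg_in_def eq_in_def less_le)
  obtain U V :: "'a set" where UV: "open U" "0 \<in> U" "U \<subseteq> V" "compact V" by (rule compact_neighbourhood)
  define K where "K = (\<lambda>x. a + x) ` V"
  define O' where "O' = {x. 0 < f x} \<inter> (\<lambda>x. - a + x) -` U"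
  have "open O'" unfolding O'_def
    by (intro open_Int open_Collect_less open_vimage UV continuous_intros f)
  moreover have "a \<in> O'" using a UV by (simp add: O'_def)
  moreover have "O' \<subseteq> {x \<in> K. f x \<noteq> 0}"
  proof
    fix x assume "x \<in> O'"
    then have "- a + x \<in> V" "f x \<noteq> 0" using UV by (auto simp: O'_def)
    then show "x \<in> {x \<in> K. f x \<noteq> 0}" by (auto simp: K_def intro!: image_eqI[of _ _ "- a + x"])
  qed
  ultimately have "\<not> (AE x in m. x \<in> K \<longrightarrow> f x = 0)"
    using open_not_null[of O' a] eventually_mono[of "\<lambda>x. x \<in> K \<longrightarrow> f x = 0" "ae_filter m" "\<lambda>x. x \<notin> O'"]
    by blast
  moreover have "compact K" unfolding K_def by (intro compact_continuous_image UV continuous_intros)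
  ultimately show ?thesis using that by blast
qed

text \<open>A non-zero uniformly continuous f remains non-zero in \<open>L_infty\<close>, and a
  pointwise inequality holds almost everywhere.\<close>

lemma translate_property_C_b_u:
  assumes "translate_property (ae_filter m) L_infty"
  shows "translate_property top (C_b_u :: ('a \<Rightarrow> real) set)"
  unfolding translate_property_def
proof (intro ballI allI impI)
  fix f :: "'a \<Rightarrow> real" and n and t :: "nat \<Rightarrow> real" and g
  assume f: "f \<in> nonzero_nonneg top C_b_u" and nn: "nonneg_in top (\<lambda>x. \<Sum>j=1..n. t j * ltrans (g j) f x)"
  then have fb: "f \<in> bcontfun" by (simp add: nonzero_nonneg_def C_b_u_def C_b_ru_def C_b_def)
  then obtain K where "compact K" "\<not> (AE x in m. x \<in> K \<longrightarrow> f x = 0)"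
    using nonzero_continuous_nonnull[of f] f by (auto simp: nonzero_nonneg_def bcontfun_def)
  then have "\<not> (AE x in m. f x = 0)"
    using eventually_mono[of "\<lambda>x. f x = 0" "ae_filter m" "\<lambda>x. x \<in> K \<longrightarrow> f x = 0"] by blast
  then have "f \<in> nonzero_nonneg (ae_filter m) L_infty"
    using f bcontfun_L_infty[OF fb] by (auto simp: nonzero_nonneg_def nonneg_in_def eq_in_def)
  moreover have "nonneg_in (ae_filter m) (\<lambda>x. \<Sum>j=1..n. t j * ltrans (g j) f x)"
    using nn by (simp add: nonneg_in_def)
  ultimately show "0 \<le> (\<Sum>j=1..n. t j)"
    using assms unfolding translate_property_def by blast
qed

text \<open>Pointwise domination implies domination almost everywhere, so the spaces of continuous
  functions inherit their integrals from the one on bounded Borel functions.\<close>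

lemma invariant_integral_restrict:
  assumes "invariant_normalized_integral (ae_filter m) L_infty f I" "E \<subseteq> L_infty"
  shows "invariant_normalized_integral top E f I"
proof -
  have "dominated top E f \<subseteq> dominated (ae_filter m) L_infty f"
  proof
    fix h assume "h \<in> dominated top E f"
    then obtain n :: nat and g where h: "h \<in> E" "\<And>x. \<bar>h x\<bar> \<le> (\<Sum>j=1..n. ltrans (g j) f x)"
      by (auto simp: dominated_def)
    then have "AE x in m. \<bar>h x\<bar> \<le> (\<Sum>j=1..n. ltrans (g j) f x)" by (intro AE_I2)
    then show "h \<in> dominated (ae_filter m) L_infty f"
      using h(1) assms(2) unfolding dominated_def by blast
  qed
  then show ?thesis
    using assms(1) unfolding invariant_normalized_integral_def eq_in_def nonneg_in_def eventually_top
    by (simp add: subset_iff)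
qed

lemma integral_property_L_infty:
  assumes T: "translate_property (ae_filter m) L_infty"
  shows "invariant_normalized_integral_property (ae_filter m) L_infty"
  unfolding invariant_normalized_integral_property_def
proof
  fix f :: "'a \<Rightarrow> real" assume f: "f \<in> nonzero_nonneg (ae_filter m) L_infty"
  show "\<exists>I. invariant_normalized_integral (ae_filter m) L_infty f I"
  proof (cases "\<forall>K. compact K \<longrightarrow> (AE x in m. x \<in> K \<longrightarrow> f x = 0)")
    case True
    then show ?thesis by (intro invariant_integral_exists_locally_null[OF T f]) blast
  next
    case False
    then show ?thesis
      using f invariant_integral_exists_locally_nonnull[OF translate_property_C_b_u[OF T], of f]
      by (auto simp: nonzero_nonneg_def nonneg_in_def)
  qed
qed

text \<open>Only the property for \<open>C_b_u\<close> is drawn from E, and the integral is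
  constructed on \<open>L_infty\<close>. This treats the four spaces of continuous functions at
  once.\<close>

lemma integral_property_continuous:
  assumes E: "C_b_u \<subseteq> E" "E \<subseteq> (C_b :: ('a \<Rightarrow> real) set)" and T: "translate_property top E"
  shows "invariant_normalized_integral_property top E"
  unfolding invariant_normalized_integral_property_def
proof
  fix f :: "'a \<Rightarrow> real" assume f: "f \<in> nonzero_nonneg top E"
  then have fb: "f \<in> bcontfun" using E(2) by (auto simp: nonzero_nonneg_def C_b_def)
  have T': "translate_property top (C_b_u :: ('a \<Rightarrow> real) set)"
    using T E(1) unfolding translate_property_def nonzero_nonneg_def by blast
  obtain K where "compact K" "\<not> (AE x in m. x \<in> K \<longrightarrow> f x = 0)"
    using nonzero_continuous_nonnull[of f] f fb by (auto simp: nonzero_nonneg_def bcontfun_def)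
  then obtain I where "invariant_normalized_integral (ae_filter m) L_infty f I"
    using f invariant_integral_exists_locally_nonnull[OF T' bcontfun_L_infty[OF fb]]
    by (auto simp: nonzero_nonneg_def nonneg_in_def)
  moreover have "E \<subseteq> L_infty" using E(2) bcontfun_L_infty by (auto simp: C_b_def)
  ultimately show "\<exists>I. invariant_normalized_integral top E f I"
    using invariant_integral_restrict by blast
qed

end

section \<open>The equivalence\<close>

text \<open>The map \<tau> stands for perturbation on either side, so that one computation serves
  both kinds of uniform continuity.\<close>

lemma uniform_comb:
  fixes v w :: "'a \<Rightarrow> real"
  assumes "\<forall>e>0. \<forall>\<^sub>F t in F. \<forall>x. \<bar>v (\<tau> t x) - v x\<bar> \<le> e" "\<forall>e>0. \<forall>\<^sub>F t in F. \<forall>x. \<bar>w (\<tau> t x) - w x\<bar> \<le> e"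
  shows "\<forall>e>0. \<forall>\<^sub>F t in F. \<forall>x. \<bar>(a * v (\<tau> t x) + b * w (\<tau> t x)) - (a * v x + b * w x)\<bar> \<le> e"
proof (intro allI impI)
  fix e :: real assume e: "0 < e"
  define d where "d = e / (\<bar>a\<bar> + \<bar>b\<bar> + 1)"
  have c: "0 < \<bar>a\<bar> + \<bar>b\<bar> + 1" by linarith
  have d0: "0 < d" using e c by (simp add: d_def)
  have "d * (\<bar>a\<bar> + \<bar>b\<bar> + 1) = e" using c by (simp add: d_def)
  then have d: "0 < d" "\<bar>a\<bar> * d + \<bar>b\<bar> * d \<le> e" using d0 by (simp_all add: algebra_simps)
  have "\<forall>\<^sub>F t in F. \<forall>x. \<bar>v (\<tau> t x) - v x\<bar> \<le> d" "\<forall>\<^sub>F t in F. \<forall>x. \<bar>w (\<tau> t x) - w x\<bar> \<le> d"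
    using assms d by auto
  then show "\<forall>\<^sub>F t in F. \<forall>x. \<bar>(a * v (\<tau> t x) + b * w (\<tau> t x)) - (a * v x + b * w x)\<bar> \<le> e"
  proof eventually_elim
    case (elim t)
    show ?case
    proof
      fix x
      have "(a * v (\<tau> t x) + b * w (\<tau> t x)) - (a * v x + b * w x) = a * (v (\<tau> t x) - v x) + b * (w (\<tau> t x) - w x)"
        by (simp add: algebra_simps)
      also have "\<bar>\<dots>\<bar> \<le> \<bar>a\<bar> * \<bar>v (\<tau> t x) - v x\<bar> + \<bar>b\<bar> * \<bar>w (\<tau> t x) - w x\<bar>"
        unfolding abs_mult[symmetric] by (rule abs_triangle_ineq)
      also have "\<dots> \<le> \<bar>a\<bar> * d + \<bar>b\<bar> * d" using elim by (intro add_mono mult_left_mono) auto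
      finally show "\<bar>(a * v (\<tau> t x) + b * w (\<tau> t x)) - (a * v x + b * w x)\<bar> \<le> e" using d(2) by linarith
    qed
  qed
qed

lemma bounded_comb:
  fixes v w :: "'a \<Rightarrow> real"
  assumes "bounded (range v)" "bounded (range w)"
  shows "bounded (range (\<lambda>x. a * v x + b * w x))"
proof -
  have "bounded (range (\<lambda>x. a *\<^sub>R v x))" "bounded (range (\<lambda>x. b *\<^sub>R w x))"
    using bounded_scaling[OF assms(1), of a] bounded_scaling[OF assms(2), of b] by (simp_all add: image_image)
  then show ?thesis using bounded_plus_comp[of "\<lambda>x. a *\<^sub>R v x" UNIV "\<lambda>x. b *\<^sub>R w x"] by simp
qed

lemma function_space_C_b: "function_space C_b"
  by (rule function_spaceI) (auto simp: C_b_def bcontfun_def intro!: bounded_comb continuous_intros)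

lemma function_space_C_b_ru: "function_space C_b_ru"
  by (rule function_spaceI)
    (auto simp: C_b_ru_iff left_uniform_def intro!: bounded_comb uniform_comb[where \<tau>="\<lambda>t x. t + x", rule_format])

lemma function_space_C_b_lu: "function_space C_b_lu"
  by (rule function_spaceI)
    (auto simp: C_b_lu_iff right_uniform_def intro!: bounded_comb uniform_comb[where \<tau>="\<lambda>t x. x + t", rule_format])

lemma bounded_ltrans: "bounded (range f) \<Longrightarrow> bounded (range (ltrans g f))"
  by (erule bounded_subset) (auto simp: ltrans_def)


theorem theorem7:
  fixes m :: "'a::{topological_group_add, t2_space} measure"
    and F :: "'a filter" and E :: "('a \<Rightarrow> real) set"
  assumes "locally_compact_space (euclidean :: 'a topology)"
    and "left_haar_measure m"
    and "(F, E) \<in> {(ae_filter m, L_infty), (top, C_b), (top, C_b_lu), (top, C_b_ru), (top, C_b_u)}"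
  shows "translate_property F E \<longleftrightarrow> invariant_normalized_integral_property F E"
proof -
  interpret haar_group m using assms(1,2) by unfold_locales
  have C: "C_b_u \<subseteq> E" "E \<subseteq> C_b" "function_space E" "\<And>g h. h \<in> E \<Longrightarrow> ltrans g h \<in> E"
    if "E \<in> {C_b, C_b_lu, C_b_ru, C_b_u}"
  proof -
    have b: "ltrans g h \<in> C_b" if "h \<in> C_b" for g and h :: "'a \<Rightarrow> real"
      using that bcontfun_translates(1) by (simp add: C_b_def)
    have lu: "ltrans g h \<in> C_b_lu" if "h \<in> C_b_lu" for g and h :: "'a \<Rightarrow> real"
      using that by (simp add: C_b_lu_iff bounded_ltrans right_uniform_ltrans)
    have ru: "ltrans g h \<in> C_b_ru" if "h \<in> C_b_ru" for g and h :: "'a \<Rightarrow> real"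
      using that by (simp add: C_b_ru_iff bounded_ltrans left_uniform_ltrans)
    show "C_b_u \<subseteq> E" "E \<subseteq> C_b"
      using that by (auto simp: C_b_u_def C_b_ru_def C_b_lu_def)
    show "function_space E"
      using that function_space_C_b function_space_C_b_lu function_space_C_b_ru
        function_space_Int[OF function_space_C_b_ru function_space_C_b_lu]
      by (auto simp: C_b_u_def)
    show "ltrans g h \<in> E" if "h \<in> E" for g h
      using that \<open>E \<in> _\<close> b lu ru by (auto simp: C_b_u_def)
  qed
  consider "F = ae_filter m" "E = L_infty" | "F = top" "E \<in> {C_b, C_b_lu, C_b_ru, C_b_u}"
    using assms(3) by auto
  then show ?thesis
  proof cases
    case 1
    then show ?thesis
      using integral_property_L_infty integral_property_imp_translate_property[OF left_invariant_ae
          function_space_L_infty L_infty_translates(1)] by blast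
  next
    case 2
    then show ?thesis
      using integral_property_continuous[OF C(1,2)[OF 2(2)]]
        integral_property_imp_translate_property[OF left_invariant_top C(3,4)[OF 2(2)]] by blast
  qed
qed

end
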